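(* Let $\phi\in C_L(1)$ and let $h\in C_0^\infty$ be fixed. Then, as $x\to0^+$, $$ m_\phi\int_0^\infty h(xu)\,du-\sum_{L_\phi^*(\rho)=0}\int_0^\infty h(xu)u^{\rho}\frac{du}{u} =\int_0^\infty h(xu)\phi(u)\,du-\sum_{\zeta^*(\rho)=0}\int_0^\infty h(xu)\phi(u)u^{\rho}\frac{du}{u}+O(1), $$ where the first sum runs over all zeros of $L_\phi^*$ and the second over all zeros of $\zeta^*$, each counted with multiplicity, and the implied constant depends on $\phi$ and $h$.
   Context: Throughout, $\mathbb R_+=(0,\infty)$, $C_0^\infty$ is the space of smooth compactly supported functions $h:\mathbb R_+\to\mathbb C$, and $\widehat h(s)=\int_0^\infty h(u)u^{s-1}\,du$ is the Mellin transform. The Selberg class $\mathcal S$ consists of functions $L(s)$ such that: (S1) $L(s)=\sum_{n\ge1}a(n)n^{-s}$ converges absolutely for $\mathrm{Re}(s)>1$; (S2) for some integer $m\ge0$, $(s-1)^mL(s)$ extends to an entire function of finite order, and $m_L$ denotes the least such $m$; (S3) there are $Q>0$, $r\ge1$, $\lambda_j>0$, $\mu_j\in\mathbb C$ with $\mathrm{Re}(\mu_j)\ge0$ ($1\le j\le r$) and $|\omega|=1$ such that the completed function $L^*(s):=Q^s\prod_{j=1}^r\Gamma(\lambda_js+\mu_j)L(s)$ satisfies $L^*(s)=\omega\overline{L^*(1-\bar s)}$; (S4) $a(n)\ll_\varepsilon n^{\varepsilon}$ for every $\varepsilon>0$; (S5) $\log L(s)=\sum_{n\ge1}b(n)n^{-s}$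 where $b(n)=0$ unless $n=p^m$ is a prime power with $m\ge1$, and $b(n)\ll n^{\theta}$ for some $\theta<1/2$. Write $-L'(s)/L(s)=\sum_{n\ge1}\Lambda_L(n)n^{-s}$, so $\Lambda_L(n)=b(n)\log n$. Each $L\in\mathcal S$ has an Euler product $L(s)=\prod_pL_p(s)$ with $L_p(s)=\sum_{m\ge0}a(p^m)p^{-ms}$. $L\in\mathcal S$ has a rank $N$ Euler product if for every prime $p$, $L_p(s)=P_p(p^{-s})^{-1}$ with a polynomial $P_p(X)=1-c_1(p)X-\dots-c_N(p)X^N$ and $c_N(p)\ne0$ for all but finitely many $p$; $S_L$ denotes the finite set of primes with $c_N(p)=0$. For a function $\phi:\mathbb R_+\to\mathbb C$ put $L_\phi(s)=\sum_{n\ge1}\phi(n)n^{-s}$. $C_L(N)$ is the set of smooth $\phi:\mathbb R_+\to\mathbb C$ such that $|\phi(u)|\le Cu^2$ for some $C>0$ and all $u>0$, $L_\phi\in\mathcal S$, and $L_\phi$ has a rank $N$ Euler product. For $\phi\in C_L(N)$ write $m_\phi=m_{L_\phi}$, $\Lambda_\phi=\Lambda_{L_\phi}$, $P_{\phi,p}=P_p$, $c_{\phi,l}(p)=c_l(p)$ (with $c_{\phi,l}(p)=0$ for $l>N$) and $S_\phi=S_{L_\phi}$. $\zeta^*(s)=\pi^{-s/2}\Gamma(s/2)\zeta(s)$. Sums over zeros $\rho$ of a completed function run over all its zeros counted with multiplicity. *)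

theory Defs
  imports "HOL-Complex_Analysis.Complex_Analysis" "HOL-Computational_Algebra.Primes"
begin

definition dirichlet_series :: "(nat \<Rightarrow> complex) \<Rightarrow> complex \<Rightarrow> complex" where
  "dirichlet_series a s = (\<Sum>n. a (Suc n) / of_nat (Suc n) powr s)"

definition finite_order :: "(complex \<Rightarrow> complex) \<Rightarrow> bool" where
  "finite_order F \<longleftrightarrow> (\<exists>\<rho> C. \<forall>s. norm (F s) \<le> C * exp (norm s powr \<rho>))"

definition continues :: "(nat \<Rightarrow> complex) \<Rightarrow> nat \<Rightarrow> (complex \<Rightarrow> complex) \<Rightarrow> bool" where
  "continues a m F \<longleftrightarrow> F holomorphic_on UNIV \<and> finite_order F \<and>
     (\<forall>s. 1 < Re s \<longrightarrow> F s = (s - 1) ^ m * dirichlet_series a s)"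

definition m_of :: "(nat \<Rightarrow> complex) \<Rightarrow> nat" where
  "m_of a = (LEAST m. \<exists>F. continues a m F)"

text \<open>The meromorphic continuation of L (value at s = 1 is irrelevant).\<close>
definition L_cont :: "(nat \<Rightarrow> complex) \<Rightarrow> complex \<Rightarrow> complex" where
  "L_cont a s = (SOME F. continues a (m_of a) F) s / (s - 1) ^ m_of a"

definition completed ::
  "(nat \<Rightarrow> complex) \<Rightarrow> real \<Rightarrow> nat \<Rightarrow> (nat \<Rightarrow> real) \<Rightarrow> (nat \<Rightarrow> complex) \<Rightarrow> complex \<Rightarrow> complex" where
  "completed a Q r lam mu s =
     of_real Q powr s * (\<Prod>j<r. Gamma (of_real (lam j) * s + mu j)) * L_cont a s"

text \<open>(S3): admissible gamma-factor data. The functional equation of the meromorphic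
  functions is imposed on the open strip 0 < Re s < 1 (equivalent by analytic continuation).\<close>
definition gamma_data ::
  "(nat \<Rightarrow> complex) \<Rightarrow> real \<Rightarrow> nat \<Rightarrow> (nat \<Rightarrow> real) \<Rightarrow> (nat \<Rightarrow> complex) \<Rightarrow> complex \<Rightarrow> bool" where
  "gamma_data a Q r lam mu \<omega> \<longleftrightarrow> Q > 0 \<and> r \<ge> 1 \<and> (\<forall>j<r. lam j > 0 \<and> Re (mu j) \<ge> 0) \<and>
     norm \<omega> = 1 \<and>
     (\<forall>s. 0 < Re s \<and> Re s < 1 \<longrightarrow>
        completed a Q r lam mu s = \<omega> * cnj (completed a Q r lam mu (1 - cnj s)))"

definition selberg_class :: "(nat \<Rightarrow> complex) \<Rightarrow> bool" where
  "selberg_class a \<longleftrightarrow>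
     (\<forall>s. 1 < Re s \<longrightarrow> summable (\<lambda>n. norm (a (Suc n) / of_nat (Suc n) powr s))) \<and>
     (\<exists>m F. continues a m F) \<and>
     (\<exists>Q r lam mu \<omega>. gamma_data a Q r lam mu \<omega>) \<and>
     (\<forall>\<epsilon>>0. \<exists>C. \<forall>n\<ge>1. norm (a n) \<le> C * real n powr \<epsilon>) \<and>
     (\<exists>b \<theta>. \<theta> < 1/2 \<and>
        (\<forall>n. b n \<noteq> 0 \<longrightarrow> (\<exists>p k. prime p \<and> k \<ge> 1 \<and> n = p ^ k)) \<and>
        (\<exists>C. \<forall>n\<ge>1. norm (b n) \<le> C * real n powr \<theta>) \<and>
        (\<forall>s. 1 < Re s \<longrightarrow> summable (\<lambda>n. b (Suc n) / of_nat (Suc n) powr s) \<and>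
              exp (dirichlet_series b s) = dirichlet_series a s))"

definition euler_rank :: "(nat \<Rightarrow> complex) \<Rightarrow> nat \<Rightarrow> bool" where
  "euler_rank a N \<longleftrightarrow> (\<exists>c :: nat \<Rightarrow> nat \<Rightarrow> complex.
     (\<forall>p. prime p \<longrightarrow> (\<forall>s. 1 < Re s \<longrightarrow>
        (\<Sum>m. a (p ^ m) * (of_nat p powr (- s)) ^ m) =
          1 / (1 - (\<Sum>l=1..N. c p l * (of_nat p powr (- s)) ^ l)))) \<and>
     finite {p. prime p \<and> c p N = 0})"

definition smooth_on :: "real set \<Rightarrow> (real \<Rightarrow> complex) \<Rightarrow> bool" where
  "smooth_on S f \<longleftrightarrow> (\<exists>D :: nat \<Rightarrow> real \<Rightarrow> complex. (\<forall>x\<in>S. D 0 x = f x) \<and>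
     (\<forall>k. \<forall>x\<in>S. (D k has_vector_derivative D (Suc k) x) (at x)))"

definition C0inf :: "(real \<Rightarrow> complex) set" where
  "C0inf = {h. smooth_on {0<..} h \<and> (\<exists>a b. 0 < a \<and> (\<forall>u. u < a \<or> b < u \<longrightarrow> h u = 0))}"

definition C_L :: "nat \<Rightarrow> (real \<Rightarrow> complex) set" where
  "C_L N = {\<phi>. smooth_on {0<..} \<phi> \<and> (\<exists>C>0. \<forall>u>0. norm (\<phi> u) \<le> C * u ^ 2) \<and>
     selberg_class (\<lambda>n. \<phi> (real n)) \<and> euler_rank (\<lambda>n. \<phi> (real n)) N}"

definition zero_mult :: "(complex \<Rightarrow> complex) \<Rightarrow> complex \<Rightarrow> nat" where
  "zero_mult f \<rho> = (if isolated_singularity_at f \<rho> \<and> not_essential f \<rho> \<and>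
      (\<exists>\<^sub>F w in at \<rho>. f w \<noteq> 0) \<and> zorder f \<rho> > 0 then nat (zorder f \<rho>) else 0)"

definition zeros_of :: "(complex \<Rightarrow> complex) \<Rightarrow> complex set" where
  "zeros_of f = {\<rho>. zero_mult f \<rho> > 0}"

definition zeta_star :: "complex \<Rightarrow> complex" where
  "zeta_star s = of_real pi powr (- s / 2) * Gamma (s / 2) * L_cont (\<lambda>_. 1) s"

end

theory Submission
  imports Defs "HOL-Number_Theory.Prime_Powers" "HOL-Probability.Characteristic_Functions"
begin

text \<open>For a rank one Euler product \<open>\<Lambda>\<^sub>\<phi>(n) = \<Lambda>(n) \<phi>(n)\<close>, so the explicit formula
  for \<open>L\<^sub>\<phi>\<close> with test function \<open>h(xu)\<close> and the one for \<open>\<zeta>\<close> with test function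
  \<open>h(xu) \<phi>(u)\<close> have the same sum over prime powers. Both formulas run over all zeros of the
  continued \<open>L\<close>-function; the zeros that are missing from the completed function come from the
  poles of the gamma factors in \<open>Re \<rho> \<le> 0\<close>. For small \<open>x\<close> the test functions live on
  \<open>u \<ge> 2\<close>, so these contribute at most a constant times \<open>\<Sum>\<^sub>\<rho> 2 powr Re \<rho>\<close>, which
  is \<open>O(1)\<close>. On the zeta side the bound \<open>\<phi>(u) = O(u\<^sup>2)\<close> suffices because the trivial
  zeros start at \<open>-2\<close>.

  No contour is shifted in the proof of the explicit formula. For an entire function of finite order a
  sufficiently high derivative of the logarithmic derivative is the sum of its partial fractions over
  the zeros (Jensen and Borel--Caratheodory); evaluated at the large integers this is the explicit
  formula for the test functions \<open>(ln u) ^ k * u powr - (N + j)\<close>. Polynomial approximation in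
  \<open>1 / u\<close>, with control of derivatives, extends it to smooth test functions supported in
  \<open>u > 1\<close>.\<close>

section \<open>Logarithmic derivatives of entire functions of finite order\<close>

text \<open>On u > 1 the Mellin transform of \<open>(ln u) ^ k * u powr - (N + j)\<close> at -rho,
  that is its pairing with u^rho du/u, equals k! / (N + j - rho)^(k+1). Up to sign this is the k-th
  derivative of 1/(s - rho) at s = N + j, which is why derivatives of L'/L at integers carry the
  explicit formula. Taking k beyond the growth exponent of L serves twice. The sums over zeros
  converge absolutely, and k integrations by parts bound the transform of a C^k function by a
  multiple of its C^k norm over |N - rho|^k. Hence the sum over zeros is continuous in a norm in
  which polynomials are dense; plain uniform approximation would not control it. The logarithms kill
  the boundary terms at u = 1. They have to be divided out of a test function again, which is
  possible because its support keeps away from u = 1; this is the source of the restriction to small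
  x. The formula is applied to zeta as well, so zeta is shown to lie in the Selberg class: its
  continuation and functional equation come from the theta function, and Poisson summation for the
  Gaussian from Abel summation of a Fourier series.\<close>

lemma Borel_Caratheodory_half:
  fixes f :: "complex \<Rightarrow> complex"
  assumes holf: "f holomorphic_on ball z0 R" and R: "R > 0"
    and M: "\<And>z. z \<in> ball z0 R \<Longrightarrow> Re (f z) < M"
    and z: "z \<in> cball z0 (R/2)"
  shows "norm (f z - f z0) \<le> 2 * (M - Re (f z0))"
proof -
  define A where "A = M - Re (f z0)"
  have A: "A > 0" using M[of z0] R by (simp add: A_def)
  define g where "g = (\<lambda>\<zeta>. f (z0 + of_real R * \<zeta>) - f z0)"
  have inball: "z0 + of_real R * \<zeta> \<in> ball z0 R" if "norm \<zeta> < 1" for \<zeta>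
    using that R by (simp add: dist_norm norm_mult)
  have g_hol: "g holomorphic_on ball 0 1"
    unfolding g_def
    by (intro holomorphic_intros holomorphic_on_compose_gen[OF _ holf, unfolded o_def])
       (use inball in auto)
  have Re_g: "Re (g \<zeta>) < A" if "norm \<zeta> < 1" for \<zeta>
    using M[OF inball[OF that]] by (simp add: g_def A_def)
  have ne: "2 * of_real A - g \<zeta> \<noteq> 0" if "norm \<zeta> < 1" for \<zeta>
  proof
    assume "2 * of_real A - g \<zeta> = 0"
    hence "Re (2 * of_real A - g \<zeta>) = 0" by simp
    thus False using Re_g[OF that] A by simp
  qed
  \<comment> \<open>The map w / (2A - w) sends the half plane Re w < A into the unit disc and fixes
    0, so the Schwarz lemma bounds \<open>h\<close>. Solving back, g = 2A h / (1 + h), and |h| <=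
    1/2 gives |g| <= 2A.\<close>
  define h where "h = (\<lambda>\<zeta>. g \<zeta> / (2 * of_real A - g \<zeta>))"
  have h_hol: "h holomorphic_on ball 0 1"
    unfolding h_def by (intro holomorphic_intros g_hol) (use ne in auto)
  have h_less: "norm (h \<zeta>) < 1" if "norm \<zeta> < 1" for \<zeta>
  proof -
    have "(norm (2 * of_real A - g \<zeta>))\<^sup>2 - (norm (g \<zeta>))\<^sup>2 = 4 * A * (A - Re (g \<zeta>))"
      unfolding cmod_power2 by (simp add: power2_eq_square algebra_simps)
    moreover have "\<dots> > 0" using A Re_g[OF that] by simp
    ultimately have "(norm (g \<zeta>))\<^sup>2 < (norm (2 * of_real A - g \<zeta>))\<^sup>2" by linarith
    hence "norm (g \<zeta>) < norm (2 * of_real A - g \<zeta>)"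
      using power2_less_imp_less norm_ge_zero by blast
    thus ?thesis using ne[OF that] by (simp add: h_def norm_divide)
  qed
  have h0: "h 0 = 0" by (simp add: h_def g_def)
  define \<zeta> where "\<zeta> = (z - z0) / of_real R"
  have \<zeta>: "norm \<zeta> \<le> 1/2" using z R by (simp add: \<zeta>_def norm_divide dist_norm norm_minus_commute field_simps)
  have hz: "norm (h \<zeta>) \<le> norm \<zeta>" by (rule Schwarz_Lemma(1)[OF h_hol h0 h_less]) (use \<zeta> in auto)
  have gz: "g \<zeta> * (1 + h \<zeta>) = 2 * of_real A * h \<zeta>"
    using ne[of \<zeta>] \<zeta> by (simp add: h_def field_simps)
  have h2: "norm (h \<zeta>) \<le> 1/2" using hz \<zeta> by linarith
  have "1/2 \<le> norm (1 + h \<zeta>)"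
    using h2 norm_triangle_ineq2[of 1 "- h \<zeta>"] by simp
  hence "norm (g \<zeta>) * (1/2) \<le> norm (g \<zeta>) * norm (1 + h \<zeta>)" by (intro mult_left_mono) auto
  also have "\<dots> = 2 * A * norm (h \<zeta>)"
    using arg_cong[OF gz, of norm] A by (simp add: norm_mult)
  also have "\<dots> \<le> 2 * A * (1/2)" using h2 A by (intro mult_left_mono) auto
  finally have "norm (g \<zeta>) \<le> 2 * A" by simp
  moreover have "g \<zeta> = f z - f z0" using R by (simp add: g_def \<zeta>_def)
  ultimately show ?thesis by (simp add: A_def)
qed

text \<open>Cauchy's inequality wants a bound on the modulus, and Borel-Caratheodory extracts one
  from the real part. It will be used for a logarithm, whose real part is ln of a modulus.
  Subtracting the constant \<open>f z0\<close> is harmless because at least one derivative is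
  taken.\<close>

lemma higher_deriv_bound_Re:
  fixes f :: "complex \<Rightarrow> complex"
  assumes holf: "f holomorphic_on ball z0 R" and R: "R > 0"
    and M: "\<And>z. z \<in> ball z0 R \<Longrightarrow> Re (f z) < M" and K: "K \<ge> 1"
  shows "norm ((deriv ^^ K) f z0) \<le> fact K * (2 * (M - Re (f z0))) / (R/2) ^ K"
proof -
  define g where "g = (\<lambda>z. f z - f z0)"
  have "(deriv ^^ K) g z0 = (deriv ^^ K) f z0 - (deriv ^^ K) (\<lambda>z. f z0) z0"
    unfolding g_def by (rule higher_deriv_diff[of _ "ball z0 R"]) (use holf R in auto)
  hence eq: "(deriv ^^ K) g z0 = (deriv ^^ K) f z0" using K by simp
  have g_hol: "g holomorphic_on ball z0 R" unfolding g_def by (intro holomorphic_intros holf)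
  have sub: "cball z0 (R/2) \<subseteq> ball z0 R" using R by auto
  have "norm ((deriv ^^ K) g z0) \<le> fact K * (2 * (M - Re (f z0))) / (R/2) ^ K"
  proof (rule Cauchy_inequality)
    show "g holomorphic_on ball z0 (R/2)" using g_hol R by (auto intro: holomorphic_on_subset)
    show "continuous_on (cball z0 (R/2)) g"
      using g_hol sub holomorphic_on_imp_continuous_on holomorphic_on_subset by blast
    show "norm (g x) \<le> 2 * (M - Re (f z0))" if "norm (z0 - x) = R/2" for x
      unfolding g_def using that by (intro Borel_Caratheodory_half[OF holf R M]) (auto simp: dist_norm)
  qed (use R in auto)
  thus ?thesis using eq by simp
qed

lemma entire_frequently_nonzero:
  assumes "f holomorphic_on UNIV" "f z0 \<noteq> 0"
  shows "\<exists>\<^sub>F w in at (z::complex). f w \<noteq> 0"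
proof -
  have "\<forall>\<^sub>F w in at z. f w \<noteq> 0 \<and> w \<in> UNIV"
    by (rule non_zero_neighbour_alt[where ?\<beta> = z0]) (use assms in auto)
  thus ?thesis by (simp add: eventually_frequently)
qed

text \<open>\<open>zor_poly\<close> is controlled only near the zero, whereas the cofactor has to be
  entire; it is glued from \<open>zor_poly\<close> on a small ball and the plain quotient
  elsewhere.\<close>

lemma entire_factor_zero:
  assumes f: "f holomorphic_on UNIV" and nz: "f z0 \<noteq> 0"
  obtains g where "g holomorphic_on UNIV" "g \<rho> \<noteq> 0"
    "\<And>z. f z = (z - \<rho>) ^ nat (zorder f \<rho>) * g z"
proof -
  define n where "n = nat (zorder f \<rho>)"
  have *: "(if f \<rho>=0 then zorder f \<rho> > 0 else zorder f \<rho>=0) \<and>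
     (\<exists>r. r>0 \<and> cball \<rho> r \<subseteq> UNIV \<and> zor_poly f \<rho> holomorphic_on cball \<rho> r
    \<and> (\<forall>w\<in>cball \<rho> r. f w  = zor_poly f \<rho> w * (w-\<rho>) ^ nat (zorder f \<rho>) \<and> zor_poly f \<rho> w \<noteq>0))"
    by (rule zorder_exist_zero[OF f]) (use nz in auto)
  then obtain r where r: "r > 0" "zor_poly f \<rho> holomorphic_on cball \<rho> r"
    "\<And>w. w\<in>cball \<rho> r \<Longrightarrow> f w  = zor_poly f \<rho> w * (w-\<rho>) ^ n \<and> zor_poly f \<rho> w \<noteq>0"
    unfolding n_def by blast
  define g where "g = (\<lambda>z. if z = \<rho> then zor_poly f \<rho> \<rho> else f z / (z - \<rho>) ^ n)"
  have gball: "g z = zor_poly f \<rho> z" if "z \<in> ball \<rho> r" for z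
    using r(3)[of z] that by (auto simp: g_def)
  have "g holomorphic_on ball \<rho> r"
    using r(2) by (rule holomorphic_transform[OF holomorphic_on_subset]) (use gball in auto)
  moreover have "g holomorphic_on (UNIV - {\<rho>})"
  proof (rule holomorphic_transform)
    show "(\<lambda>z. f z / (z - \<rho>) ^ n) holomorphic_on (UNIV - {\<rho>})"
      by (intro holomorphic_intros holomorphic_on_subset[OF f]) auto
  qed (auto simp: g_def)
  ultimately have "g holomorphic_on (ball \<rho> r \<union> (UNIV - {\<rho>}))"
    by (intro holomorphic_on_Un) auto
  moreover have "ball \<rho> r \<union> (UNIV - {\<rho>}) = UNIV" using r(1) by auto
  ultimately have "g holomorphic_on UNIV" by simp
  moreover have "g \<rho> \<noteq> 0" using r(3)[of \<rho>] r(1) by (simp add: g_def)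
  moreover have "f z = (z - \<rho>) ^ n * g z" for z
    using r(3)[of \<rho>] r(1) by (cases "z = \<rho>") (auto simp: g_def)
  ultimately show thesis using that unfolding n_def by blast
qed

lemma zorder_mult_entire_nonzero:
  assumes "f holomorphic_on UNIV" "g holomorphic_on UNIV" "f \<rho> \<noteq> 0" "g z0 \<noteq> 0"
  shows "zorder (\<lambda>z. f z * g z) \<rho> = zorder g \<rho>"
proof -
  have an: "f analytic_on {\<rho>}" "g analytic_on {\<rho>}"
    unfolding analytic_at using assms by blast+
  have "\<forall>\<^sub>F w in at \<rho>. f w \<noteq> 0 \<and> w \<in> UNIV"
    by (rule non_zero_neighbour_alt[where ?\<beta> = \<rho>]) (use assms in auto)
  moreover have "\<forall>\<^sub>F w in at \<rho>. g w \<noteq> 0 \<and> w \<in> UNIV"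
    by (rule non_zero_neighbour_alt[where ?\<beta> = z0]) (use assms in auto)
  ultimately have "\<forall>\<^sub>F w in at \<rho>. f w * g w \<noteq> 0" by eventually_elim auto
  thus ?thesis using zorder_times_analytic[OF an] zorder_eq_0I[OF an(1) assms(3)] by simp
qed

lemma entire_factor_zeros:
  assumes f: "f holomorphic_on UNIV" and nz: "f z0 \<noteq> 0" and fin: "finite Z"
  obtains g where "g holomorphic_on UNIV" "\<And>\<rho>. \<rho> \<in> Z \<Longrightarrow> g \<rho> \<noteq> 0"
    "\<And>z. f z = (\<Prod>\<rho>\<in>Z. (z - \<rho>) ^ nat (zorder f \<rho>)) * g z"
proof -
  have "\<exists>g. g holomorphic_on UNIV \<and> (\<forall>\<rho>\<in>Z. g \<rho> \<noteq> 0) \<and>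
    (\<forall>z. f z = (\<Prod>\<rho>\<in>Z. (z - \<rho>) ^ nat (zorder f \<rho>)) * g z)"
    using fin
  proof (induction Z rule: finite_induct)
    case empty
    show ?case using f by auto
  next
    case (insert \<sigma> Z)
    then obtain g where g: "g holomorphic_on UNIV" "\<forall>\<rho>\<in>Z. g \<rho> \<noteq> 0"
      "\<And>z. f z = (\<Prod>\<rho>\<in>Z. (z - \<rho>) ^ nat (zorder f \<rho>)) * g z" by blast
    have gz0: "g z0 \<noteq> 0" using g(3)[of z0] nz by (metis mult_zero_right)
    have feq: "f = (\<lambda>z. (\<Prod>\<rho>\<in>Z. (z - \<rho>) ^ nat (zorder f \<rho>)) * g z)"
      by (rule ext) (rule g(3))
    have "zorder f \<sigma> = zorder (\<lambda>z. (\<Prod>\<rho>\<in>Z. (z - \<rho>) ^ nat (zorder f \<rho>)) * g z) \<sigma>"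
      by (rule arg_cong[OF feq, of "\<lambda>h. zorder h \<sigma>"])
    also have "\<dots> = zorder g \<sigma>"
      by (rule zorder_mult_entire_nonzero[OF _ g(1) _ gz0])
         (use insert.hyps in \<open>auto intro!: holomorphic_intros\<close>)
    finally have ord: "zorder f \<sigma> = zorder g \<sigma>" .
    obtain h where h: "h holomorphic_on UNIV" "h \<sigma> \<noteq> 0"
      "\<And>z. g z = (z - \<sigma>) ^ nat (zorder g \<sigma>) * h z"
      using entire_factor_zero[OF g(1) gz0] by blast
    show ?case
    proof (intro exI[of _ h] conjI ballI allI)
      show "h \<rho> \<noteq> 0" if "\<rho> \<in> insert \<sigma> Z" for \<rho>
        using that h(2) g(2) h(3)[of \<rho>] by auto
      show "f z = (\<Prod>\<rho>\<in>insert \<sigma> Z. (z - \<rho>) ^ nat (zorder f \<rho>)) * h z" for z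
        using insert.hyps g(3)[of z] h(3)[of z] ord by simp
    qed (use h in auto)
  qed
  thus thesis using that by blast
qed

lemma entire_finite_zeros_cball:
  assumes "f holomorphic_on UNIV" "f z0 \<noteq> (0::complex)"
  shows "finite {\<rho> \<in> cball c R. f \<rho> = 0}"
proof (cases "f constant_on UNIV")
  case True
  hence "{\<rho> \<in> cball c R. f \<rho> = 0} = {}" using assms(2) by (auto simp: constant_on_def)
  thus ?thesis by (metis finite.emptyI)
next
  case False
  have "finite {z \<in> cball c R. f z = 0}"
    by (rule holomorphic_compact_finite_zeros[OF assms(1) _ _ _ _ False]) auto
  thus ?thesis .
qed

text \<open>On the circle of radius 4R each factor (z - rho)/(s0 - rho) has modulus at least 3R / R
  = 3, so the maximum principle makes \<open>G\<close> smaller than the bound for \<open>F\<close>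
  by 3 to the number of zeros. The factors are normalised to be 1 at \<open>s0\<close>. At z = s0
  this is a crude Jensen inequality, and on the small disc \<open>G\<close> is zero-free and has a
  logarithm.\<close>

lemma jensen_factorization:
  fixes F :: "complex \<Rightarrow> complex"
  assumes F: "F holomorphic_on UNIV" and nz: "F s0 \<noteq> 0" and R: "R > 0"
    and B: "\<And>z. norm (z - s0) = 4 * R \<Longrightarrow> norm (F z) \<le> B"
  defines "Z \<equiv> {\<rho> \<in> cball s0 R. F \<rho> = 0}"
  obtains G where "G holomorphic_on UNIV" "\<And>z. z \<in> cball s0 R \<Longrightarrow> G z \<noteq> 0" "G s0 = F s0"
    "\<And>z. F z = (\<Prod>\<rho>\<in>Z. ((z - \<rho>) / (s0 - \<rho>)) ^ nat (zorder F \<rho>)) * G z"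
    "\<And>z. z \<in> cball s0 (4 * R) \<Longrightarrow> norm (G z) * 3 ^ (\<Sum>\<rho>\<in>Z. nat (zorder F \<rho>)) \<le> B"
proof -
  define m where "m = (\<lambda>\<rho>. nat (zorder F \<rho>))"
  have fin: "finite Z" unfolding Z_def by (rule entire_finite_zeros_cball[OF F nz])
  obtain g where g: "g holomorphic_on UNIV" "\<And>\<rho>. \<rho> \<in> Z \<Longrightarrow> g \<rho> \<noteq> 0"
    "\<And>z. F z = (\<Prod>\<rho>\<in>Z. (z - \<rho>) ^ m \<rho>) * g z"
    unfolding m_def using entire_factor_zeros[OF F nz fin] by blast
  define c where "c = (\<Prod>\<rho>\<in>Z. (s0 - \<rho>) ^ m \<rho>)"
  have sZ: "s0 - \<rho> \<noteq> 0" if "\<rho> \<in> Z" for \<rho> using that nz by (auto simp: Z_def)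
  have c: "c \<noteq> 0" unfolding c_def using fin sZ by auto
  define G where "G = (\<lambda>z. c * g z)"
  have G_hol: "G holomorphic_on UNIV" unfolding G_def by (intro holomorphic_intros g)
  have prod: "(\<Prod>\<rho>\<in>Z. ((z - \<rho>) / (s0 - \<rho>)) ^ m \<rho>) * c = (\<Prod>\<rho>\<in>Z. (z - \<rho>) ^ m \<rho>)" for z
    unfolding c_def using fin sZ by (auto simp: power_divide prod_dividef)
  have FG: "F z = (\<Prod>\<rho>\<in>Z. ((z - \<rho>) / (s0 - \<rho>)) ^ m \<rho>) * G z" for z
    using g(3)[of z] prod[of z] by (simp add: G_def mult.assoc[symmetric])
  have Gnz: "G z \<noteq> 0" if "z \<in> cball s0 R" for z
  proof (cases "z \<in> Z")
    case True thus ?thesis using g(2) c by (simp add: G_def)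
  next
    case False
    hence "F z \<noteq> 0" using that by (auto simp: Z_def)
    thus ?thesis using FG[of z] by auto
  qed
  have Gs0: "G s0 = F s0" using FG[of s0] sZ by simp
  have Gb: "norm (G z) * 3 ^ (\<Sum>\<rho>\<in>Z. m \<rho>) \<le> B" if "z \<in> cball s0 (4 * R)" for z
  proof -
    let ?n = "\<Sum>\<rho>\<in>Z. m \<rho>"
    have "norm (G z) \<le> B / 3 ^ ?n"
    proof (rule maximum_modulus_frontier[where S = "cball s0 (4 * R)" and f = G])
      fix z assume "z \<in> frontier (cball s0 (4 * R))"
      hence z: "norm (z - s0) = 4 * R" using R by (auto simp: dist_norm norm_minus_commute)
      have "3 ^ ?n = (\<Prod>\<rho>\<in>Z. (3::real) ^ m \<rho>)" by (simp add: power_sum)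
      also have "\<dots> \<le> (\<Prod>\<rho>\<in>Z. norm (((z - \<rho>) / (s0 - \<rho>)) ^ m \<rho>))"
      proof (intro prod_mono conjI)
        fix \<rho> assume \<rho>: "\<rho> \<in> Z"
        have 1: "norm (s0 - \<rho>) \<le> R" using \<rho> by (simp add: Z_def dist_norm)
        have "norm (z - \<rho>) \<ge> 3 * R"
          using norm_triangle_ineq[of "z - \<rho>" "\<rho> - s0"] z 1 by (simp add: norm_minus_commute)
        hence "3 * norm (s0 - \<rho>) \<le> norm (z - \<rho>)" using 1 by linarith
        hence "3 \<le> norm ((z - \<rho>) / (s0 - \<rho>))" using sZ[OF \<rho>] by (simp add: norm_divide field_simps)
        thus "3 ^ m \<rho> \<le> norm (((z - \<rho>) / (s0 - \<rho>)) ^ m \<rho>)"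
          by (simp add: norm_power power_mono)
      qed auto
      also have "\<dots> = norm (\<Prod>\<rho>\<in>Z. ((z - \<rho>) / (s0 - \<rho>)) ^ m \<rho>)" by (simp add: prod_norm)
      finally have "norm (G z) * 3 ^ ?n \<le> norm (G z) * norm (\<Prod>\<rho>\<in>Z. ((z - \<rho>) / (s0 - \<rho>)) ^ m \<rho>)"
        by (intro mult_left_mono) auto
      also have "\<dots> = norm (F z)" by (subst FG) (simp add: norm_mult)
      also have "\<dots> \<le> B" by (rule B[OF z])
      finally show "norm (G z) \<le> B / 3 ^ ?n" by (simp add: field_simps)
    qed (use that G_hol R in \<open>auto intro: holomorphic_on_subset holomorphic_on_imp_continuous_on\<close>)
    thus ?thesis by (simp add: field_simps)
  qed
  show thesis
    by (rule that[OF G_hol Gnz Gs0 FG[unfolded m_def] Gb[unfolded m_def]])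
qed

lemma higher_deriv_sum_simple_poles:
  fixes m :: "complex \<Rightarrow> complex"
  assumes fin: "finite Z" and z: "z \<notin> Z"
  shows "(deriv ^^ n) (\<lambda>z. \<Sum>\<rho>\<in>Z. m \<rho> / (z - \<rho>)) z =
    (\<Sum>\<rho>\<in>Z. m \<rho> * ((-1) ^ n * fact n / (z - \<rho>) ^ Suc n))"
  using z
proof (induction n arbitrary: z)
  case 0
  show ?case by simp
next
  case (Suc n)
  have op: "open (- Z)" using fin by (simp add: finite_imp_closed open_Compl)
  let ?h = "\<lambda>z. \<Sum>\<rho>\<in>Z. m \<rho> / (z - \<rho>)"
  have "(deriv ^^ Suc n) ?h z = deriv ((deriv ^^ n) ?h) z" by simp
  also have "\<dots> = deriv (\<lambda>z. \<Sum>\<rho>\<in>Z. m \<rho> * ((-1) ^ n * fact n / (z - \<rho>) ^ Suc n)) z"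
  proof (rule deriv_cong_ev[OF _ refl])
    have "\<forall>\<^sub>F w in nhds z. w \<in> - Z" using op Suc.prems by (intro eventually_nhds_in_open) auto
    thus "\<forall>\<^sub>F w in nhds z. (deriv ^^ n) ?h w =
        (\<Sum>\<rho>\<in>Z. m \<rho> * ((-1) ^ n * fact n / (w - \<rho>) ^ Suc n))"
      by eventually_elim (use Suc.IH in auto)
  qed
  also have "\<dots> = (\<Sum>\<rho>\<in>Z. m \<rho> * ((-1) ^ Suc n * fact (Suc n) / (z - \<rho>) ^ Suc (Suc n)))"
  proof (rule DERIV_imp_deriv, rule DERIV_sum)
    fix \<rho> assume "\<rho> \<in> Z"
    hence ne: "z - \<rho> \<noteq> 0" using Suc.prems by auto
    have "((\<lambda>z. inverse (z - \<rho>)) has_field_derivative - (inverse (z - \<rho>) ^ 2)) (at z)"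
      using ne by (auto intro!: derivative_eq_intros simp: power2_eq_square)
    from DERIV_power_Suc[OF this, of n]
    have "((\<lambda>z. inverse (z - \<rho>) ^ Suc n) has_field_derivative
       (of_nat (Suc n) * inverse (z - \<rho>) ^ n * (- (inverse (z - \<rho>) ^ 2)))) (at z)"
      by (simp add: mult_ac)
    from DERIV_cmult[OF this, of "m \<rho> * ((-1) ^ n * fact n)"]
    show "((\<lambda>z. m \<rho> * ((-1) ^ n * fact n / (z - \<rho>) ^ Suc n)) has_field_derivative
       m \<rho> * ((-1) ^ Suc n * fact (Suc n) / (z - \<rho>) ^ Suc (Suc n))) (at z)"
      using ne by (simp add: field_simps power_inverse power2_eq_square del: of_nat_Suc)
  qed
  finally show ?case .
qed

lemma has_field_derivative_prod_linear_powers: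
  fixes m :: "complex \<Rightarrow> nat"
  assumes "finite Z" "z \<notin> Z" "s0 \<notin> Z"
  shows "((\<lambda>z. \<Prod>\<rho>\<in>Z. ((z - \<rho>) / (s0 - \<rho>)) ^ m \<rho>) has_field_derivative
     (\<Prod>\<rho>\<in>Z. ((z - \<rho>) / (s0 - \<rho>)) ^ m \<rho>) * (\<Sum>\<rho>\<in>Z. of_nat (m \<rho>) / (z - \<rho>))) (at z)"
  using assms
proof (induction Z rule: finite_induct)
  case (insert \<sigma> Z)
  have ne: "z - \<sigma> \<noteq> 0" "s0 - \<sigma> \<noteq> 0" using insert.prems by auto
  have d1: "((\<lambda>z. ((z - \<sigma>) / (s0 - \<sigma>)) ^ m \<sigma>) has_field_derivative
     ((z - \<sigma>) / (s0 - \<sigma>)) ^ m \<sigma> * (of_nat (m \<sigma>) / (z - \<sigma>))) (at z)"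
  proof (cases "m \<sigma>")
    case (Suc k)
    have "((\<lambda>z. (z - \<sigma>) / (s0 - \<sigma>)) has_field_derivative 1 / (s0 - \<sigma>)) (at z)"
      by (intro DERIV_cdivide) (auto intro!: derivative_eq_intros)
    from DERIV_power_Suc[OF this, of k] show ?thesis
      unfolding Suc power_Suc using ne by (simp add: mult_ac)
  qed simp
  have d2: "((\<lambda>z. \<Prod>\<rho>\<in>Z. ((z - \<rho>) / (s0 - \<rho>)) ^ m \<rho>) has_field_derivative
     (\<Prod>\<rho>\<in>Z. ((z - \<rho>) / (s0 - \<rho>)) ^ m \<rho>) * (\<Sum>\<rho>\<in>Z. of_nat (m \<rho>) / (z - \<rho>))) (at z)"
    using insert by auto
  from DERIV_mult[OF d1 d2] insert.hyps show ?case by (simp add: algebra_simps)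
qed simp

text \<open>The count is the bound for \<open>G\<close> read at \<open>s0\<close>. For the other
  claim, F'/F is the sum of partial fractions over the zeros in the disc plus (log G)'; the error is
  therefore the K-th derivative of log G at \<open>s0\<close>, which Borel-Caratheodory bounds by
  O(R^q / R^K).\<close>

lemma zero_count_and_logderiv_truncation:
  fixes F :: "complex \<Rightarrow> complex"
  assumes F: "F holomorphic_on UNIV" and nz: "F s0 \<noteq> 0" and K: "K \<ge> 1"
    and C: "C > 0" and bd: "\<And>z. norm z \<ge> 1 \<Longrightarrow> norm (F z) \<le> C * exp (norm z ^ q)"
  obtains D where "D \<ge> 0"
    "\<And>R. R \<ge> norm s0 + 1 \<Longrightarrow> real (\<Sum>\<rho>\<in>{\<rho> \<in> cball s0 R. F \<rho> = 0}. nat (zorder F \<rho>)) \<le> D * R ^ q"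
    "\<And>R. R \<ge> norm s0 + 1 \<Longrightarrow> norm ((deriv ^^ (K - 1)) (\<lambda>s. deriv F s / F s) s0 -
        (\<Sum>\<rho>\<in>{\<rho> \<in> cball s0 R. F \<rho> = 0}. of_nat (nat (zorder F \<rho>)) *
          ((-1) ^ (K - 1) * fact (K - 1) / (s0 - \<rho>) ^ K))) \<le> D * R ^ q / R ^ K"
proof -
  define L where "L = \<bar>ln (C / norm (F s0))\<bar>"
  define D1 where "D1 = L + 5 ^ q"
  define D2 where "D2 = fact K * 2 * (L + 1 + 5 ^ q) * 2 ^ K"
  have D: "D1 \<ge> 0" "D2 \<ge> 0" by (auto simp: D1_def D2_def L_def)
  have main: "real (\<Sum>\<rho>\<in>{\<rho> \<in> cball s0 R. F \<rho> = 0}. nat (zorder F \<rho>)) \<le> D1 * R ^ q \<and>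
     norm ((deriv ^^ (K - 1)) (\<lambda>s. deriv F s / F s) s0 -
        (\<Sum>\<rho>\<in>{\<rho> \<in> cball s0 R. F \<rho> = 0}. of_nat (nat (zorder F \<rho>)) *
          ((-1) ^ (K - 1) * fact (K - 1) / (s0 - \<rho>) ^ K))) \<le> D2 * R ^ q / R ^ K"
    if R: "R \<ge> norm s0 + 1" for R
  proof -
    define Z where "Z = {\<rho> \<in> cball s0 R. F \<rho> = 0}"
    define m where "m = (\<lambda>\<rho>. nat (zorder F \<rho>))"
    have R1: "R \<ge> 1" "R > 0" using R norm_ge_zero[of s0] by linarith+
    have Rq: "R ^ q \<ge> 1" using R1 by simp
    \<comment> \<open>Since R >= |s0| + 1, the circle |z - s0| = 4R lies in 1 <= |z| <= 5R, where
      the growth hypothesis applies.\<close>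
    define B where "B = C * exp ((5 * R) ^ q)"
    have B: "norm (F z) \<le> B" if z: "norm (z - s0) = 4 * R" for z
    proof -
      have "norm z \<le> 5 * R" using norm_triangle_ineq[of "z - s0" s0] z R by simp
      moreover have "norm z \<ge> 1" using norm_triangle_ineq2[of "z - s0" "- s0"] z R R1 by simp
      ultimately show ?thesis
        using bd[of z] C unfolding B_def
        by (smt (verit, best) exp_le_cancel_iff mult_left_mono norm_ge_zero power_mono)
    qed
    obtain G where G: "G holomorphic_on UNIV" "\<And>z. z \<in> cball s0 R \<Longrightarrow> G z \<noteq> 0" "G s0 = F s0"
      "\<And>z. F z = (\<Prod>\<rho>\<in>Z. ((z - \<rho>) / (s0 - \<rho>)) ^ m \<rho>) * G z"
      "\<And>z. z \<in> cball s0 (4 * R) \<Longrightarrow> norm (G z) * 3 ^ (\<Sum>\<rho>\<in>Z. m \<rho>) \<le> B"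
      unfolding Z_def m_def by (rule jensen_factorization[OF F nz R1(2) B]; blast)
    define n where "n = (\<Sum>\<rho>\<in>Z. m \<rho>)"
    have fin: "finite Z" unfolding Z_def by (rule entire_finite_zeros_cball[OF F nz])
    have s0Z: "s0 \<notin> Z" using nz by (simp add: Z_def)
    have Bpos: "B > 0" using C by (simp add: B_def)
    have lnB: "ln B = ln C + (5 * R) ^ q" using C by (simp add: B_def ln_mult)
    have lnC: "ln C - ln (norm (F s0)) \<le> L" using C nz by (simp add: L_def ln_div)
    have "norm (F s0) * 3 ^ n \<le> B" using G(5)[of s0] G(3) R1 by (simp add: n_def)
    hence "ln (norm (F s0) * 3 ^ n) \<le> ln B"
      using Bpos nz by (subst ln_le_cancel_iff) auto
    hence "ln (norm (F s0)) + n * ln 3 \<le> ln C + (5 * R) ^ q"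
      using nz by (simp add: ln_mult ln_realpow lnB)
    hence "n * ln 3 \<le> L + 5 ^ q * R ^ q" using lnC by (simp add: power_mult_distrib)
    \<comment> \<open>\<open>exp_le\<close> says that e <= 3, hence ln 3 >= 1.\<close>
    moreover have "real n * 1 \<le> n * ln 3"
      using exp_le by (intro mult_left_mono) (simp_all add: ln_ge_iff)
    moreover have "L \<le> L * R ^ q" using Rq by (simp add: L_def mult_le_cancel_left1)
    ultimately have cnt: "real n \<le> D1 * R ^ q" by (simp add: D1_def algebra_simps)
    have cvx: "convex (ball s0 R)" "open (ball s0 R)" by auto
    obtain g where g: "g holomorphic_on ball s0 R" "\<And>z. z \<in> ball s0 R \<Longrightarrow> exp (g z) = G z"
      using holomorphic_logarithm_exists[OF cvx, of G s0] G(1,2) R1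
      by (metis ball_subset_cball centre_in_ball holomorphic_on_subset subset_UNIV subsetD)
    have Re_g: "Re (g z) = ln (norm (G z))" if "z \<in> ball s0 R" for z
      using g(2)[OF that] by (metis ln_exp norm_exp_eq_Re)
    \<comment> \<open>The added 1 makes the inequality strict, as
      \<open>higher_deriv_bound_Re\<close> demands.\<close>
    have Re_less: "Re (g z) < ln B + 1" if z: "z \<in> ball s0 R" for z
    proof -
      have "norm (G z) * 1 \<le> norm (G z) * 3 ^ n" by (intro mult_left_mono) auto
      also have "\<dots> \<le> B" using G(5)[of z] z R1 by (simp add: n_def)
      finally have "ln (norm (G z)) \<le> ln B" using Bpos G(2)[of z] z by (subst ln_le_cancel_iff) auto
      thus ?thesis using Re_g[OF z] by linarith
    qed
    have "norm ((deriv ^^ K) g s0) \<le> fact K * (2 * (ln B + 1 - Re (g s0))) / (R / 2) ^ K"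
      by (rule higher_deriv_bound_Re[OF g(1) R1(2) Re_less K])
    also have "\<dots> \<le> fact K * (2 * ((L + 1 + 5 ^ q) * R ^ q)) / (R / 2) ^ K"
    proof (intro divide_right_mono mult_left_mono)
      have "Re (g s0) = ln (norm (F s0))" using Re_g[of s0] R1 G(3) by simp
      hence "ln B + 1 - Re (g s0) \<le> L + 1 + 5 ^ q * R ^ q"
        using lnC by (simp add: lnB power_mult_distrib)
      moreover have "L + 1 \<le> (L + 1) * R ^ q" using Rq by (simp add: L_def mult_le_cancel_left1)
      ultimately show "ln B + 1 - Re (g s0) \<le> (L + 1 + 5 ^ q) * R ^ q"
        by (simp add: algebra_simps)
    qed (use R1 in auto)
    also have "\<dots> = D2 * R ^ q / R ^ K" by (simp add: D2_def power_divide mult_ac)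
    finally have gK: "norm ((deriv ^^ K) g s0) \<le> D2 * R ^ q / R ^ K" .
    define U where "U = ball s0 R - Z"
    have U: "open U" "s0 \<in> U" using fin s0Z R1 by (auto simp: U_def finite_imp_closed open_Diff)
    have ld: "deriv F z / F z = (\<Sum>\<rho>\<in>Z. of_nat (m \<rho>) / (z - \<rho>)) + deriv g z" if z: "z \<in> U" for z
    proof -
      let ?P = "\<lambda>z. \<Prod>\<rho>\<in>Z. ((z - \<rho>) / (s0 - \<rho>)) ^ m \<rho>"
      have zb: "z \<in> ball s0 R" "z \<notin> Z" using z by (auto simp: U_def)
      have dg: "(g has_field_derivative deriv g z) (at z)"
        by (rule holomorphic_derivI[OF g(1)]) (use zb in auto)
      have "((\<lambda>z. exp (g z)) has_field_derivative exp (g z) * deriv g z) (at z)"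
        by (rule DERIV_fun_exp[OF dg])
      hence "(G has_field_derivative exp (g z) * deriv g z) (at z)"
        by (rule has_field_derivative_transform_within_open[where S = "ball s0 R"])
           (use g(2) zb in auto)
      hence dG: "(G has_field_derivative G z * deriv g z) (at z)" using g(2)[OF zb(1)] by simp
      have dF: "((\<lambda>z. ?P z * G z) has_field_derivative
          (?P z * (\<Sum>\<rho>\<in>Z. of_nat (m \<rho>) / (z - \<rho>))) * G z + G z * deriv g z * ?P z) (at z)"
        by (rule DERIV_mult[OF has_field_derivative_prod_linear_powers[OF fin zb(2) s0Z] dG])
      have "F = (\<lambda>z. ?P z * G z)" using G(4) by (rule ext)
      hence "deriv F z = F z * ((\<Sum>\<rho>\<in>Z. of_nat (m \<rho>) / (z - \<rho>)) + deriv g z)"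
        using DERIV_imp_deriv[OF dF] by (simp add: algebra_simps)
      moreover have "F z \<noteq> 0" using zb by (auto simp: Z_def)
      ultimately show ?thesis by simp
    qed
    have "(deriv ^^ (K - 1)) (\<lambda>s. deriv F s / F s) s0 =
      (deriv ^^ (K - 1)) (\<lambda>z. (\<Sum>\<rho>\<in>Z. of_nat (m \<rho>) / (z - \<rho>)) + deriv g z) s0"
    proof (rule higher_deriv_transform_within_open[where S = U])
      have nzU: "F z \<noteq> 0" if "z \<in> U" for z using that by (auto simp: U_def Z_def)
      show "(\<lambda>s. deriv F s / F s) holomorphic_on U"
        by (intro holomorphic_intros holomorphic_on_subset[OF F] holomorphic_deriv)
           (use nzU U in auto)
      show "(\<lambda>z. (\<Sum>\<rho>\<in>Z. of_nat (m \<rho>) / (z - \<rho>)) + deriv g z) holomorphic_on U"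
        by (intro holomorphic_intros holomorphic_on_subset[OF holomorphic_deriv[OF g(1)]])
           (auto simp: U_def)
    qed (use U ld in auto)
    also have "\<dots> = (deriv ^^ (K - 1)) (\<lambda>z. \<Sum>\<rho>\<in>Z. of_nat (m \<rho>) / (z - \<rho>)) s0 +
        (deriv ^^ (K - 1)) (deriv g) s0"
    proof (rule higher_deriv_add[where S = U])
      show "(\<lambda>z. \<Sum>\<rho>\<in>Z. of_nat (m \<rho>) / (z - \<rho>)) holomorphic_on U"
        by (intro holomorphic_intros) (auto simp: U_def)
      show "deriv g holomorphic_on U"
        by (rule holomorphic_on_subset[OF holomorphic_deriv[OF g(1)]]) (auto simp: U_def)
    qed (use U in auto)
    also have "(deriv ^^ (K - 1)) (deriv g) = (deriv ^^ K) g"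
      using K by (metis Suc_pred' funpow_Suc_right less_eq_Suc_le o_apply One_nat_def)
    finally have "(deriv ^^ (K - 1)) (\<lambda>s. deriv F s / F s) s0 -
        (\<Sum>\<rho>\<in>Z. of_nat (m \<rho>) * ((-1) ^ (K - 1) * fact (K - 1) / (s0 - \<rho>) ^ K)) = (deriv ^^ K) g s0"
      using higher_deriv_sum_simple_poles[OF fin s0Z, of "K - 1" "\<lambda>\<rho>. of_nat (m \<rho>)"] K by simp
    thus ?thesis using cnt gK unfolding n_def Z_def m_def by simp
  qed
  show thesis
  proof (rule that[of "max D1 D2"])
    fix R assume R: "R \<ge> norm s0 + 1"
    hence R0: "R \<ge> 0" using norm_ge_zero[of s0] by linarith
    have "D1 * R ^ q \<le> max D1 D2 * R ^ q" using R0 by (intro mult_right_mono) auto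
    with main[OF R] show "real (\<Sum>\<rho>\<in>{\<rho> \<in> cball s0 R. F \<rho> = 0}. nat (zorder F \<rho>)) \<le> max D1 D2 * R ^ q"
      by linarith
    have "D2 * R ^ q / R ^ K \<le> max D1 D2 * R ^ q / R ^ K"
      using R0 by (intro divide_right_mono mult_right_mono) auto
    with main[OF R] show "norm ((deriv ^^ (K - 1)) (\<lambda>s. deriv F s / F s) s0 -
        (\<Sum>\<rho>\<in>{\<rho> \<in> cball s0 R. F \<rho> = 0}. of_nat (nat (zorder F \<rho>)) *
          ((-1) ^ (K - 1) * fact (K - 1) / (s0 - \<rho>) ^ K))) \<le> max D1 D2 * R ^ q / R ^ K"
      by linarith
  qed (use D in auto)
qed

text \<open>K > q makes the truncation error D R^q / R^K tend to 0. Absolute convergence comes from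
  dyadic shells: the one starting at radius R0 2^J holds at most D (R0 2^(J+1))^q zeros, each of
  weight at most (R0 2^J)^-K, together at most D 2^q 2^-J.\<close>

theorem higher_deriv_logderiv_entire:
  fixes F :: "complex \<Rightarrow> complex"
  assumes F: "F holomorphic_on UNIV" and nz: "F s0 \<noteq> 0" and K: "K > q"
    and C: "C > 0" and bd: "\<And>z. norm z \<ge> 1 \<Longrightarrow> norm (F z) \<le> C * exp (norm z ^ q)"
  shows "(\<lambda>\<rho>. real (nat (zorder F \<rho>)) / norm (s0 - \<rho>) ^ K) summable_on {\<rho>. F \<rho> = 0}"
    and "((\<lambda>\<rho>. of_nat (nat (zorder F \<rho>)) * ((-1) ^ (K - 1) * fact (K - 1) / (s0 - \<rho>) ^ K)) has_sum
      (deriv ^^ (K - 1)) (\<lambda>s. deriv F s / F s) s0) {\<rho>. F \<rho> = 0}"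
proof -
  have K1: "K \<ge> 1" using K by simp
  define Z where "Z = (\<lambda>R. {\<rho> \<in> cball s0 R. F \<rho> = 0})"
  define m where "m = (\<lambda>\<rho>. real (nat (zorder F \<rho>)))"
  define a where "a = (\<lambda>\<rho>. m \<rho> / norm (s0 - \<rho>) ^ K)"
  define t where "t = (\<lambda>\<rho>. of_nat (nat (zorder F \<rho>)) * ((-1) ^ (K - 1) * fact (K - 1) / (s0 - \<rho>) ^ K))"
  define T where "T = (deriv ^^ (K - 1)) (\<lambda>s. deriv F s / F s) s0"
  obtain D where D: "D \<ge> 0"
    "\<And>R. R \<ge> norm s0 + 1 \<Longrightarrow> (\<Sum>\<rho>\<in>Z R. m \<rho>) \<le> D * R ^ q"
    "\<And>R. R \<ge> norm s0 + 1 \<Longrightarrow> norm (T - (\<Sum>\<rho>\<in>Z R. t \<rho>)) \<le> D * R ^ q / R ^ K"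
    using zero_count_and_logderiv_truncation[OF F nz K1 C bd]
    unfolding Z_def m_def t_def T_def of_nat_sum by blast
  define R0 where "R0 = norm s0 + 1"
  have R0: "R0 \<ge> 1" by (simp add: R0_def)
  have finZ: "finite (Z R)" for R unfolding Z_def by (rule entire_finite_zeros_cball[OF F nz])
  have a0: "a \<rho> \<ge> 0" for \<rho> by (simp add: a_def m_def)
  have monoZ: "Z R \<subseteq> Z R'" if "R \<le> R'" for R R' using that by (auto simp: Z_def)
  define S0 where "S0 = (\<Sum>\<rho>\<in>Z R0. a \<rho>)"
  \<comment> \<open>The right-hand side is \<open>S0\<close> plus the geometric partial sum of D 2^q
    2^-i over i < J.\<close>
  have dy: "(\<Sum>\<rho>\<in>Z (R0 * 2 ^ J). a \<rho>) \<le> S0 + 2 * D * 2 ^ q * (1 - (1/2) ^ J)" for J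
  proof (induction J)
    case 0
    show ?case by (simp add: S0_def)
  next
    case (Suc J)
    let ?R = "R0 * 2 ^ J"
    have R: "?R \<ge> 1" "?R \<ge> R0" "?R \<ge> 2 ^ J" using R0 by (auto simp: mult_ge1_I)
    have sub: "Z ?R \<subseteq> Z (R0 * 2 ^ Suc J)" using R0 by (intro monoZ) auto
    have "(\<Sum>\<rho>\<in>Z (R0 * 2 ^ Suc J). a \<rho>) = (\<Sum>\<rho>\<in>Z (R0 * 2 ^ Suc J) - Z ?R. a \<rho>) + (\<Sum>\<rho>\<in>Z ?R. a \<rho>)"
      by (rule sum.subset_diff[OF sub finZ])
    moreover have "(\<Sum>\<rho>\<in>Z (R0 * 2 ^ Suc J) - Z ?R. a \<rho>) \<le> D * 2 ^ q * (1/2) ^ J"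
    proof -
      have "(\<Sum>\<rho>\<in>Z (R0 * 2 ^ Suc J) - Z ?R. a \<rho>) \<le> (\<Sum>\<rho>\<in>Z (R0 * 2 ^ Suc J) - Z ?R. m \<rho> / ?R ^ K)"
      proof (rule sum_mono)
        fix \<rho> assume "\<rho> \<in> Z (R0 * 2 ^ Suc J) - Z ?R"
        hence "norm (s0 - \<rho>) \<ge> ?R" by (auto simp: Z_def dist_norm)
        hence "norm (s0 - \<rho>) ^ K \<ge> ?R ^ K" using R by (intro power_mono) auto
        moreover have "?R ^ K > 0" using R0 by simp
        ultimately have "norm (s0 - \<rho>) ^ K > 0" "?R ^ K > 0" "norm (s0 - \<rho>) ^ K \<ge> ?R ^ K" by linarith+
        thus "a \<rho> \<le> m \<rho> / ?R ^ K" unfolding a_def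
          by (intro divide_left_mono mult_pos_pos) (simp_all add: m_def)
      qed
      also have "\<dots> \<le> (\<Sum>\<rho>\<in>Z (R0 * 2 ^ Suc J). m \<rho> / ?R ^ K)"
        using finZ R0 by (intro sum_mono2) (auto simp: m_def)
      also have "\<dots> = (\<Sum>\<rho>\<in>Z (R0 * 2 ^ Suc J). m \<rho>) / ?R ^ K" by (rule sum_divide_distrib[symmetric])
      also have "\<dots> \<le> D * (R0 * 2 ^ Suc J) ^ q / ?R ^ K"
      proof (intro divide_right_mono D(2))
        show "norm s0 + 1 \<le> R0 * 2 ^ Suc J" 
          using R0 mult_left_mono[OF one_le_power[of "2::real" "Suc J"], of R0]
          unfolding R0_def[symmetric] by (simp del: power_Suc)
      qed (use R0 in auto)
      also have "\<dots> = D * 2 ^ q * (?R ^ q / ?R ^ K)" by (simp add: power_mult_distrib)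
      also have "?R ^ q / ?R ^ K = 1 / ?R ^ (K - q)"
        using K R0 by (simp add: power_diff field_simps)
      also have "D * 2 ^ q * \<dots> \<le> D * 2 ^ q * (1 / 2 ^ J)"
      proof (intro mult_left_mono divide_left_mono)
        have "2 ^ J \<le> ?R ^ 1" using R by simp
        also have "\<dots> \<le> ?R ^ (K - q)" by (rule power_increasing) (use R(1) K in linarith)+
        finally show "2 ^ J \<le> ?R ^ (K - q)" .
      qed (use D R0 in auto)
      finally show ?thesis by (simp add: power_one_over)
    qed
    ultimately show ?case using Suc.IH by (simp add: algebra_simps)
  qed
  have "a summable_on {\<rho>. F \<rho> = 0}"
  proof (rule nonneg_bdd_above_summable_on)
    show "bdd_above (sum a ` {X. X \<subseteq> {\<rho>. F \<rho> = 0} \<and> finite X})"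
    proof (rule bdd_aboveI2)
      fix X assume "X \<in> {X. X \<subseteq> {\<rho>. F \<rho> = 0} \<and> finite X}"
      hence X: "X \<subseteq> {\<rho>. F \<rho> = 0}" "finite X" by auto
      obtain B where B: "\<And>\<rho>. \<rho> \<in> X \<Longrightarrow> norm (s0 - \<rho>) \<le> B"
        using finite_imp_bounded[of "(\<lambda>\<rho>. s0 - \<rho>) ` X"] X(2) by (auto simp: bounded_iff)
      obtain J :: nat where J: "B \<le> real J" using real_arch_simple by blast
      have "real J \<le> 2 ^ J" by (simp add: less_imp_le of_nat_less_two_power)
      also have "\<dots> \<le> R0 * 2 ^ J" using R0 by simp
      finally have "X \<subseteq> Z (R0 * 2 ^ J)" using X B J by (force simp: Z_def dist_norm)
      hence "sum a X \<le> (\<Sum>\<rho>\<in>Z (R0 * 2 ^ J). a \<rho>)" using finZ a0 by (intro sum_mono2) auto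
      also have "\<dots> \<le> S0 + 2 * D * 2 ^ q * (1 - (1/2) ^ J)" by (rule dy)
      also have "\<dots> \<le> S0 + 2 * D * 2 ^ q * 1" using D by (intro add_left_mono mult_left_mono) auto
      finally show "sum a X \<le> S0 + 2 * D * 2 ^ q * 1" .
    qed
  qed (use a0 in auto)
  thus summ: "(\<lambda>\<rho>. real (nat (zorder F \<rho>)) / norm (s0 - \<rho>) ^ K) summable_on {\<rho>. F \<rho> = 0}"
    unfolding a_def m_def .
  have "(\<lambda>\<rho>. norm (t \<rho>)) = (\<lambda>\<rho>. fact (K - 1) * a \<rho>)"
    by (auto simp: t_def a_def m_def norm_mult norm_divide norm_power)
  hence "(\<lambda>\<rho>. norm (t \<rho>)) summable_on {\<rho>. F \<rho> = 0}"
    using summable_on_cmult_right[OF summ, of "fact (K - 1)"] by (simp add: a_def m_def)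
  hence "t summable_on {\<rho>. F \<rho> = 0}" by (rule abs_summable_summable)
  then obtain T' where T': "(t has_sum T') {\<rho>. F \<rho> = 0}" by (auto simp: summable_on_def)
  \<comment> \<open>Every finite set of zeros is eventually swallowed by the growing discs, so the
    unordered sum is the limit of the disc sums and can be compared with the truncation
    bound.\<close>
  have flt: "filterlim (\<lambda>n. Z (R0 + real n)) (finite_subsets_at_top {\<rho>. F \<rho> = 0}) sequentially"
  proof (subst filterlim_finite_subsets_at_top, intro allI impI)
    fix X assume X: "finite X \<and> X \<subseteq> {\<rho>. F \<rho> = 0}"
    obtain B where B: "\<And>\<rho>. \<rho> \<in> X \<Longrightarrow> norm (s0 - \<rho>) \<le> B"
      using finite_imp_bounded[of "(\<lambda>\<rho>. s0 - \<rho>) ` X"] X by (auto simp: bounded_iff)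
    obtain J :: nat where J: "B \<le> real J" using real_arch_simple by blast
    have "X \<subseteq> Z (R0 + real n)" if "n \<ge> J" for n
      using X B J that R0 by (force simp: Z_def dist_norm)
    thus "\<forall>\<^sub>F n in sequentially. finite (Z (R0 + real n)) \<and> X \<subseteq> Z (R0 + real n) \<and>
        Z (R0 + real n) \<subseteq> {\<rho>. F \<rho> = 0}"
      using finZ by (intro eventually_sequentiallyI[of J]) (auto simp: Z_def)
  qed
  have lim1: "(\<lambda>n. \<Sum>\<rho>\<in>Z (R0 + real n). t \<rho>) \<longlonglongrightarrow> T'"
    using filterlim_compose[OF T'[unfolded has_sum_def] flt] .
  have "(\<lambda>n. T - (\<Sum>\<rho>\<in>Z (R0 + real n). t \<rho>)) \<longlonglongrightarrow> 0"
  proof (rule Lim_null_comparison)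
    show "\<forall>\<^sub>F n in sequentially. norm (T - (\<Sum>\<rho>\<in>Z (R0 + real n). t \<rho>)) \<le> D * inverse (real n)"
    proof (rule eventually_sequentiallyI[of 1])
      fix n :: nat assume n: "n \<ge> 1"
      let ?R = "R0 + real n"
      have R: "?R \<ge> 1" "?R \<ge> n" using R0 by auto
      have "norm (T - (\<Sum>\<rho>\<in>Z ?R. t \<rho>)) \<le> D * ?R ^ q / ?R ^ K" by (rule D(3)) (simp add: R0_def)
      also have "\<dots> = D * (1 / ?R ^ (K - q))" using K R by (simp add: power_diff field_simps)
      also have "\<dots> \<le> D * (1 / real n)"
      proof (intro mult_left_mono divide_left_mono)
        have "real n \<le> ?R ^ 1" using R by simp
        also have "\<dots> \<le> ?R ^ (K - q)" by (rule power_increasing) (use R(1) K in linarith)+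
        finally show "real n \<le> ?R ^ (K - q)" .
      qed (use D n R0 in auto)
      finally show "norm (T - (\<Sum>\<rho>\<in>Z ?R. t \<rho>)) \<le> D * inverse (real n)" by (simp add: field_simps)
    qed
    show "(\<lambda>n. D * inverse (real n)) \<longlonglongrightarrow> 0"
      using tendsto_mult_right_zero[OF lim_inverse_n[where 'a = real]] by simp
  qed
  hence "(\<lambda>n. T - (T - (\<Sum>\<rho>\<in>Z (R0 + real n). t \<rho>))) \<longlonglongrightarrow> T - 0" by (intro tendsto_intros)
  hence "(\<lambda>n. \<Sum>\<rho>\<in>Z (R0 + real n). t \<rho>) \<longlonglongrightarrow> T" by simp
  hence "T' = T" using lim1 LIMSEQ_unique by blast
  thus "((\<lambda>\<rho>. of_nat (nat (zorder F \<rho>)) * ((-1) ^ (K - 1) * fact (K - 1) / (s0 - \<rho>) ^ K)) has_sum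
      (deriv ^^ (K - 1)) (\<lambda>s. deriv F s / F s) s0) {\<rho>. F \<rho> = 0}"
    using T' unfolding t_def T_def by simp
qed

section \<open>Mellin integrals of smooth functions\<close>

text \<open>\<open>vector_derivative\<close> is total, so C^n is expressed without naming the
  derivatives. They are taken at x in the full sense and not within S, which is why the calculus
  rules below assume S open.\<close>

primrec cont_diff :: "nat \<Rightarrow> real set \<Rightarrow> (real \<Rightarrow> complex) \<Rightarrow> bool" where
  "cont_diff 0 S f \<longleftrightarrow> continuous_on S f"
| "cont_diff (Suc n) S f \<longleftrightarrow> (\<forall>x\<in>S. f differentiable at x) \<and> cont_diff n S (\<lambda>x. vector_derivative f (at x))"

lemma cont_diff_cong:
  assumes "open S" "\<And>x. x \<in> S \<Longrightarrow> f x = g x" "cont_diff n S f"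
  shows "cont_diff n S g"
  using assms(2,3)
proof (induction n arbitrary: f g)
  case 0
  thus ?case using continuous_on_cong[of S S f g] by simp
next
  case (Suc n)
  have d: "(g has_vector_derivative vector_derivative f (at x)) (at x)" if x: "x \<in> S" for x
  proof (rule has_vector_derivative_transform_within_open[OF _ assms(1) x])
    show "(f has_vector_derivative vector_derivative f (at x)) (at x)"
      using Suc.prems(2) x by (simp add: vector_derivative_works)
  qed (use Suc.prems in auto)
  have "cont_diff n S (\<lambda>x. vector_derivative g (at x))"
    by (rule Suc.IH[of "\<lambda>x. vector_derivative f (at x)"])
       (use Suc.prems d in \<open>auto simp: vector_derivative_at[OF d]\<close>)
  thus ?case unfolding cont_diff.simps using differentiableI_vector[OF d] by blast
qed

lemma cont_diff_SucI:
  assumes "open S" "\<And>x. x \<in> S \<Longrightarrow> (f has_vector_derivative f' x) (at x)" "cont_diff n S f'"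
  shows "cont_diff (Suc n) S f"
proof -
  have "cont_diff n S (\<lambda>x. vector_derivative f (at x))"
    by (rule cont_diff_cong[OF assms(1) _ assms(3)]) (simp add: vector_derivative_at[OF assms(2)])
  thus ?thesis using assms(2) by (auto intro: differentiableI_vector)
qed

lemma cont_diff_SucE:
  assumes "cont_diff (Suc n) S f"
  obtains f' where "\<And>x. x \<in> S \<Longrightarrow> (f has_vector_derivative f' x) (at x)" "cont_diff n S f'"
proof (rule that)
  show "(f has_vector_derivative vector_derivative f (at x)) (at x)" if "x \<in> S" for x
    using assms that by (auto simp: vector_derivative_works)
qed (use assms in auto)

lemma cont_diff_Suc_imp: "cont_diff (Suc n) S f \<Longrightarrow> cont_diff n S f"
proof (induction n arbitrary: f)
  case 0
  thus ?case by (auto intro!: continuous_at_imp_continuous_on differentiable_imp_continuous_within)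
qed auto

lemma cont_diff_imp_continuous_on: "cont_diff n S f \<Longrightarrow> continuous_on S f"
  by (induction n) (use cont_diff_Suc_imp in \<open>auto simp del: cont_diff.simps(2)\<close>)

lemma cont_diff_const: "open S \<Longrightarrow> cont_diff n S (\<lambda>_. c)"
proof (induction n arbitrary: c)
  case (Suc n)
  show ?case by (rule cont_diff_SucI[where f' = "\<lambda>_. 0"]) (use Suc in auto)
qed auto

lemma cont_diff_add:
  assumes S: "open S"
  shows "cont_diff n S f \<Longrightarrow> cont_diff n S g \<Longrightarrow> cont_diff n S (\<lambda>x. f x + g x)"
proof (induction n arbitrary: f g)
  case 0
  thus ?case by (auto intro: continuous_intros)
next
  case (Suc n)
  obtain f' where f: "\<And>x. x \<in> S \<Longrightarrow> (f has_vector_derivative f' x) (at x)" "cont_diff n S f'"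
    by (rule cont_diff_SucE[OF Suc.prems(1)]) blast
  obtain g' where g: "\<And>x. x \<in> S \<Longrightarrow> (g has_vector_derivative g' x) (at x)" "cont_diff n S g'"
    by (rule cont_diff_SucE[OF Suc.prems(2)]) blast
  show ?case
    by (rule cont_diff_SucI[OF S, where f' = "\<lambda>x. f' x + g' x"])
       (auto intro!: has_vector_derivative_add f g Suc.IH)
qed

lemma cont_diff_mult:
  assumes S: "open S"
  shows "cont_diff n S f \<Longrightarrow> cont_diff n S g \<Longrightarrow> cont_diff n S (\<lambda>x. f x * g x)"
proof (induction n arbitrary: f g)
  case 0
  thus ?case by (auto intro: continuous_intros)
next
  case (Suc n)
  obtain f' where f: "\<And>x. x \<in> S \<Longrightarrow> (f has_vector_derivative f' x) (at x)" "cont_diff n S f'"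
    by (rule cont_diff_SucE[OF Suc.prems(1)]) blast
  obtain g' where g: "\<And>x. x \<in> S \<Longrightarrow> (g has_vector_derivative g' x) (at x)" "cont_diff n S g'"
    by (rule cont_diff_SucE[OF Suc.prems(2)]) blast
  have fg: "cont_diff n S f" "cont_diff n S g" using Suc.prems cont_diff_Suc_imp by blast+
  show ?case
    by (rule cont_diff_SucI[OF S, where f' = "\<lambda>x. f x * g' x + f' x * g x"])
       (auto intro!: has_vector_derivative_mult f g fg Suc.IH cont_diff_add[OF S])
qed

lemma cont_diff_power: "open S \<Longrightarrow> cont_diff n S f \<Longrightarrow> cont_diff n S (\<lambda>x. f x ^ m)"
  by (induction m) (auto intro: cont_diff_mult cont_diff_const)

lemma cont_diff_Un:
  assumes "cont_diff n S f" "cont_diff n T f"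
  shows "open S \<Longrightarrow> open T \<Longrightarrow> cont_diff n (S \<union> T) f"
  using assms by (induction n arbitrary: f) (auto intro: continuous_on_open_Un)

lemma cont_diff_subset: "cont_diff n S f \<Longrightarrow> T \<subseteq> S \<Longrightarrow> cont_diff n T f"
  by (induction n arbitrary: f) (simp_all add: continuous_on_subset subset_iff)

lemma cont_diff_recip: "cont_diff n {0<..} (\<lambda>v. complex_of_real (1 / v))"
proof (induction n)
  case 0
  show ?case by (auto intro!: continuous_intros)
next
  case (Suc n)
  show ?case
  proof (rule cont_diff_SucI)
    show "cont_diff n {0<..} (\<lambda>v. (-1) * (complex_of_real (1 / v) * complex_of_real (1 / v)))"
      by (intro cont_diff_mult cont_diff_const Suc) auto
    fix v :: real assume v: "v \<in> {0<..}"
    have "((\<lambda>v. 1 / v) has_real_derivative - (1 / v * (1 / v))) (at v)"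
      using v by (auto intro!: derivative_eq_intros)
    from has_vector_derivative_of_real[OF this]
    show "((\<lambda>v. complex_of_real (1 / v)) has_vector_derivative
       (-1) * (complex_of_real (1 / v) * complex_of_real (1 / v))) (at v)"
      by (simp only: of_real_mult of_real_minus mult_minus1)
  qed auto
qed

lemma cont_diff_recip_ln: "cont_diff n {0<..<1} (\<lambda>v. complex_of_real (1 / (- ln v)))"
proof (induction n)
  case 0
  show ?case by (auto intro!: continuous_intros)
next
  case (Suc n)
  have sub: "cont_diff n {0<..<1} (\<lambda>v. complex_of_real (1 / v))"
    by (rule cont_diff_subset[OF cont_diff_recip]) auto
  show ?case
  proof (rule cont_diff_SucI)
    show "cont_diff n {0<..<1} (\<lambda>v. complex_of_real (1 / (- ln v)) * complex_of_real (1 / (- ln v)) * complex_of_real (1 / v))"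
      by (intro cont_diff_mult Suc sub) auto
    fix v :: real assume v: "v \<in> {0<..<1}"
    have "((\<lambda>v. 1 / (- ln v)) has_real_derivative (1 / (- ln v)) * (1 / (- ln v)) * (1 / v)) (at v)"
      using v by (auto intro!: derivative_eq_intros simp: field_simps)
    from has_vector_derivative_of_real[OF this]
    show "((\<lambda>v. complex_of_real (1 / (- ln v))) has_vector_derivative
       complex_of_real (1 / (- ln v)) * complex_of_real (1 / (- ln v)) * complex_of_real (1 / v)) (at v)"  by (simp only: of_real_mult)
  qed auto
qed

lemma cont_diff_compose_recip: "cont_diff n {0<..} g \<Longrightarrow> cont_diff n {0<..} (\<lambda>v. g (1 / v))"
proof (induction n arbitrary: g)
  case 0
  have "continuous_on {0<..} (g \<circ> (\<lambda>v. 1 / v))"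
    using 0 by (intro continuous_on_compose continuous_intros) (auto elim: continuous_on_subset)
  thus ?case by (simp add: o_def)
next
  case (Suc n)
  obtain g' where g: "\<And>x. x \<in> {0<..} \<Longrightarrow> (g has_vector_derivative g' x) (at x)" "cont_diff n {0<..} g'"
    by (rule cont_diff_SucE[OF Suc.prems]) blast
  show ?case
  proof (rule cont_diff_SucI)
    show "cont_diff n {0<..} (\<lambda>v. (-1) * (complex_of_real (1 / v) * complex_of_real (1 / v)) * g' (1 / v))"
      by (intro cont_diff_mult cont_diff_const cont_diff_recip Suc.IH g) auto
    fix v :: real assume v: "v \<in> {0<..}"
    have "((\<lambda>v. 1 / v) has_real_derivative - (1 / v * (1 / v))) (at v)"
      using v by (auto intro!: derivative_eq_intros)
    hence "((\<lambda>v. 1 / v) has_vector_derivative - (1 / v * (1 / v))) (at v)"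
      by (simp add: has_real_derivative_iff_has_vector_derivative)
    from vector_diff_chain_at[OF this, of g "g' (1 / v)"] g(1)[of "1 / v"] v
    show "((\<lambda>v. g (1 / v)) has_vector_derivative
       (-1) * (complex_of_real (1 / v) * complex_of_real (1 / v)) * g' (1 / v)) (at v)"
      by (simp add: o_def scaleR_conv_of_real)
  qed auto
qed

lemma cont_diff_compose_scale:
  assumes "x > (0::real)"
  shows "cont_diff n {0<..} g \<Longrightarrow> cont_diff n {0<..} (\<lambda>v. g (x * v))"
proof (induction n arbitrary: g)
  case 0
  have "continuous_on {0<..} (g \<circ> (\<lambda>v. x * v))"
    using 0 assms by (intro continuous_on_compose continuous_intros) (auto elim: continuous_on_subset)
  thus ?case by (simp add: o_def)
next
  case (Suc n)
  obtain g' where g: "\<And>x. x \<in> {0<..} \<Longrightarrow> (g has_vector_derivative g' x) (at x)" "cont_diff n {0<..} g'"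
    by (rule cont_diff_SucE[OF Suc.prems]) blast
  show ?case
  proof (rule cont_diff_SucI)
    show "cont_diff n {0<..} (\<lambda>v. of_real x * g' (x * v))"
      by (intro cont_diff_mult cont_diff_const Suc.IH g) auto
    fix v :: real assume v: "v \<in> {0<..}"
    have "((\<lambda>v. x * v) has_vector_derivative x) (at v)"
      by (auto intro!: derivative_eq_intros simp: has_real_derivative_iff_has_vector_derivative[symmetric])
    from vector_diff_chain_at[OF this, of g "g' (x * v)"] g(1)[of "x * v"] v assms
    show "((\<lambda>v. g (x * v)) has_vector_derivative of_real x * g' (x * v)) (at v)"
      by (simp add: o_def scaleR_conv_of_real)
  qed auto
qed

text \<open>A closed ball of the C^n norm on [0,1]. Derivatives at the end points are one-sided, so
  they enter as witnesses within the interval and not through \<open>vector_derivative\<close> at a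
  point.\<close>

primrec cont_diff_bd :: "nat \<Rightarrow> real \<Rightarrow> (real \<Rightarrow> complex) \<Rightarrow> bool" where
  "cont_diff_bd 0 \<epsilon> f \<longleftrightarrow> continuous_on {0..1} f \<and> (\<forall>v\<in>{0..1}. norm (f v) \<le> \<epsilon>)"
| "cont_diff_bd (Suc n) \<epsilon> f \<longleftrightarrow> (\<forall>v\<in>{0..1}. norm (f v) \<le> \<epsilon>) \<and>
     (\<exists>f'. (\<forall>v\<in>{0..1}. (f has_vector_derivative f' v) (at v within {0..1})) \<and> cont_diff_bd n \<epsilon> f')"

lemma cont_diff_bd_bound: "cont_diff_bd n \<epsilon> f \<Longrightarrow> v \<in> {0..1} \<Longrightarrow> norm (f v) \<le> \<epsilon>"
  by (cases n) auto

lemma cont_diff_bd_nonneg: "cont_diff_bd n \<epsilon> f \<Longrightarrow> \<epsilon> \<ge> 0"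
  using cont_diff_bd_bound[of n \<epsilon> f 0] norm_ge_zero[of "f 0"] by (simp del: norm_ge_zero)

lemma cont_diff_bd_continuous: "cont_diff_bd n \<epsilon> f \<Longrightarrow> continuous_on {0..1} f"
  by (cases n) (auto intro: continuous_on_vector_derivative)

lemma cont_diff_bd_mono: "cont_diff_bd n \<epsilon> f \<Longrightarrow> \<epsilon> \<le> \<epsilon>' \<Longrightarrow> cont_diff_bd n \<epsilon>' f"
  by (induction n arbitrary: f) (fastforce intro: order_trans)+

lemma cont_diff_bd_Suc_imp: "cont_diff_bd (Suc n) \<epsilon> f \<Longrightarrow> cont_diff_bd n \<epsilon> f"
proof (induction n arbitrary: f)
  case 0
  thus ?case using cont_diff_bd_continuous[OF 0] by simp
next
  case (Suc n)
  then obtain f' where f: "\<forall>v\<in>{0..1}. norm (f v) \<le> \<epsilon>"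
    "\<forall>v\<in>{0..1}. (f has_vector_derivative f' v) (at v within {0..1})" "cont_diff_bd (Suc n) \<epsilon> f'"
    unfolding cont_diff_bd.simps(2)[of "Suc n"] by blast
  show ?case unfolding cont_diff_bd.simps(2) using f Suc.IH by blast
qed

lemma cont_diff_imp_bd: "cont_diff n UNIV f \<Longrightarrow> \<exists>M. cont_diff_bd n M f"
proof (induction n arbitrary: f)
  case 0
  hence c: "continuous_on {0..1} f" by (auto elim: continuous_on_subset)
  hence "bounded (f ` {0..1})" by (intro compact_imp_bounded compact_continuous_image) auto
  thus ?case using c by (auto simp: bounded_iff)
next
  case (Suc n)
  have "continuous_on {0..1} f" using cont_diff_imp_continuous_on[OF Suc.prems] by (auto elim: continuous_on_subset)
  hence "bounded (f ` {0..1})" by (intro compact_imp_bounded compact_continuous_image) auto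
  then obtain M1 where "\<forall>v\<in>{0..1}. norm (f v) \<le> M1" by (auto simp: bounded_iff)
  hence M1: "\<And>v. v \<in> {0..1} \<Longrightarrow> norm (f v) \<le> M1" by blast
  obtain f' where f: "\<And>x. (f has_vector_derivative f' x) (at x)" "cont_diff n UNIV f'"
    by (rule cont_diff_SucE[OF Suc.prems]) blast
  obtain M where M: "cont_diff_bd n M f'" using Suc.IH[OF f(2)] by blast
  have "cont_diff_bd (Suc n) (max M1 M) f"
    unfolding cont_diff_bd.simps(2)
  proof (intro conjI ballI exI[of _ f'])
    show "cont_diff_bd n (max M1 M) f'" by (rule cont_diff_bd_mono[OF M]) simp
    show "norm (f v) \<le> max M1 M" if "v \<in> {0..1}" for v using M1[OF that] by linarith
    show "(f has_vector_derivative f' v) (at v within {0..1})" for v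
      by (rule has_vector_derivative_at_within[OF f(1)])
  qed
  thus ?case by blast
qed

section \<open>Polynomial approximation together with derivatives\<close>

lemma complex_Weierstrass_poly:
  fixes f :: "real \<Rightarrow> complex"
  assumes "continuous_on {0..1} f" "\<epsilon> > 0"
  obtains P where "\<And>v. v \<in> {0..1} \<Longrightarrow> norm (f v - poly P (of_real v)) \<le> \<epsilon>"
proof -
  obtain g where g: "polynomial_function g" "\<And>v. v \<in> {0..1} \<Longrightarrow> norm (f v - g v) < \<epsilon>"
    using Stone_Weierstrass_polynomial_function[of "{0..1::real}" f \<epsilon>] assms by auto
  have "real_polynomial_function (Re \<circ> g)" "real_polynomial_function (Im \<circ> g)"
    using g(1) unfolding polynomial_function_def by (auto intro: bounded_linear_Re bounded_linear_Im)
  then obtain a n b m where ab: "Re \<circ> g = (\<lambda>x. \<Sum>i\<le>n. a i * x ^ i)" "Im \<circ> g = (\<lambda>x. \<Sum>i\<le>m. b i * x ^ i)"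
    unfolding real_polynomial_function_iff_sum by blast
  define P where "P = (\<Sum>i\<le>n. monom (complex_of_real (a i)) i) + (\<Sum>i\<le>m. monom (\<i> * complex_of_real (b i)) i)"
  have "g v = poly P (of_real v)" for v
  proof -
    have "g v = of_real ((Re \<circ> g) v) + \<i> * of_real ((Im \<circ> g) v)" by (simp add: complex_eq)
    also have "\<dots> = poly P (of_real v)" unfolding ab P_def
      by (simp add: poly_sum poly_monom sum_distrib_left mult_ac)
    finally show ?thesis .
  qed
  thus thesis using that[of P] g(2) by (metis less_imp_le)
qed

lemma poly_antiderivative:
  fixes Q :: "complex poly"
  obtains P where "pderiv P = Q" "poly P 0 = c"
proof -
  define P where "P = [:c:] + (\<Sum>i\<le>degree Q. monom (coeff Q i / of_nat (Suc i)) (Suc i))"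
  have "pderiv (\<Sum>i\<in>A. monom (coeff Q i / of_nat (Suc i)) (Suc i)) = (\<Sum>i\<in>A. monom (coeff Q i) i)"
    if "finite A" for A
    using that by (induction A rule: finite_induct)
      (simp_all add: pderiv_add pderiv_monom del: of_nat_Suc)
  hence "pderiv P = (\<Sum>i\<le>degree Q. monom (coeff Q i) i)"
    unfolding P_def by (simp add: pderiv_add pderiv_pCons)
  also have "\<dots> = Q" by (rule poly_as_sum_of_monoms)
  finally have "pderiv P = Q" .
  moreover have "poly P 0 = c" by (simp add: P_def poly_sum poly_monom)
  ultimately show thesis by (rule that)
qed

text \<open>Uniform approximation of f says nothing about derivatives, so the n-th derivative is
  approximated and integrated back n times, with the value at 0 matched each time. The interval has
  length 1, so integration does not enlarge the error.\<close>

lemma cont_diff_bd_poly_approx: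
  assumes "cont_diff n UNIV f" "\<epsilon> > 0"
  shows "\<exists>P. cont_diff_bd n \<epsilon> (\<lambda>v. f v - poly P (of_real v))"
  using assms(1)
proof (induction n arbitrary: f)
  case 0
  hence c: "continuous_on {0..1} f" by (auto elim: continuous_on_subset)
  obtain P where "\<And>v. v \<in> {0..1} \<Longrightarrow> norm (f v - poly P (of_real v)) \<le> \<epsilon>"
    using complex_Weierstrass_poly[OF c assms(2)] by blast
  thus ?case using c by (auto intro!: exI[of _ P] continuous_intros)
next
  case (Suc n)
  obtain f' where f: "\<And>x. (f has_vector_derivative f' x) (at x)" "cont_diff n UNIV f'"
    by (rule cont_diff_SucE[OF Suc.prems]) blast
  obtain Q where Q: "cont_diff_bd n \<epsilon> (\<lambda>v. f' v - poly Q (of_real v))" using Suc.IH[OF f(2)] by blast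
  obtain P where P: "pderiv P = Q" "poly P 0 = f 0" using poly_antiderivative by blast
  let ?d = "\<lambda>v. f v - poly P (of_real v)"
  have d: "(?d has_vector_derivative (f' v - poly Q (of_real v))) (at v within A)" for v A
  proof (intro has_vector_derivative_diff has_vector_derivative_at_within[OF f(1)])
    have "(poly P has_field_derivative poly (pderiv P) (of_real v)) (at (of_real v))" by (rule poly_DERIV)
    from field_vector_diff_chain_at[OF has_vector_derivative_of_real[OF DERIV_ident] this]
    have "((\<lambda>v. poly P (of_real v)) has_vector_derivative poly Q (of_real v)) (at v)"
      by (simp add: o_def P)
    thus "((\<lambda>v. poly P (of_real v)) has_vector_derivative poly Q (of_real v)) (at v within A)"
      by (rule has_vector_derivative_at_within)
  qed
  have "norm (?d v) \<le> \<epsilon>" if v: "v \<in> {0..1}" for v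
  proof -
    have "((\<lambda>v. f' v - poly Q (of_real v)) has_integral (?d v - ?d 0)) {0..v}"
      by (rule fundamental_theorem_of_calculus) (use v d in auto)
    hence "norm (?d v - ?d 0) \<le> \<epsilon> * measure lborel {0..v}"
      by (rule has_integral_bound_real[where S = "{}", rotated 2])
         (use assms(2) v cont_diff_bd_bound[OF Q] in auto)
    also have "\<dots> \<le> \<epsilon> * 1" using v assms(2) by (intro mult_left_mono) auto
    finally show ?thesis using P by simp
  qed
  hence "cont_diff_bd (Suc n) \<epsilon> ?d" unfolding cont_diff_bd.simps(2)
    by (intro conjI exI[of _ "\<lambda>v. f' v - poly Q (of_real v)"] ballI) (use Q d in simp_all)
  thus ?case by blast
qed

section \<open>Mellin integrals with logarithmic weight on the unit interval\<close>

lemma power_le_fact_exp: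
  assumes "(t::real) \<ge> 0"
  shows "t ^ k \<le> fact k * exp t"
proof -
  have "(\<Sum>n\<in>{k}. t ^ n /\<^sub>R fact n) \<le> (\<Sum>n. t ^ n /\<^sub>R fact n)"
    using assms by (intro sum_le_suminf summable_exp_generic) auto
  hence "t ^ k / fact k \<le> exp t" by (simp add: exp_def divide_inverse mult.commute)
  thus ?thesis by (simp add: field_simps)
qed

text \<open>One term of the exponential series at -(ln v)/2 gives (- ln v)^k <= 2^k k! / sqrt v. The
  spare factor sqrt v lets the kernel below tend to 0 at v = 0.\<close>

lemma ln_power_mult_le:
  assumes "0 < v" "v \<le> 1"
  shows "(- ln v) ^ k * v \<le> 2 ^ k * fact k * sqrt v"
proof -
  have "(- ln v / 2) ^ k \<le> fact k * exp (- ln v / 2)"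
    using assms by (intro power_le_fact_exp) auto
  also have "exp (- ln v / 2) = 1 / sqrt v"
  proof -
    have "exp (ln v / 2) = sqrt v" using assms exp_ln[of "sqrt v"] by (simp only: ln_sqrt[OF less_imp_le[OF assms(1)], symmetric]) simp
    thus ?thesis by (simp add: exp_minus inverse_eq_divide minus_divide_left[symmetric])
  qed
  finally have "2 ^ k * (- ln v / 2) ^ k \<le> 2 ^ k * (fact k * (1 / sqrt v))"
    by (rule mult_left_mono) simp
  also have "2 ^ k * (- ln v / 2) ^ k = (- ln v) ^ k"
    by (simp only: power_mult_distrib[symmetric]) simp
  finally have "(- ln v) ^ k \<le> 2 ^ k * fact k / sqrt v" by simp
  hence "(- ln v) ^ k * v \<le> 2 ^ k * fact k / sqrt v * v" using assms by (intro mult_right_mono) auto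
  also have "\<dots> = 2 ^ k * fact k * sqrt v" using assms by (simp add: field_simps real_sqrt_mult_self)
  finally show ?thesis .
qed

text \<open>In the variable v = 1/u, with w = N - rho, this is the weight against which monomials in
  v are integrated. Throughout Re w >= 2 is assumed, so that the kernel is continuous on the closed
  interval and all integrals are proper.\<close>

definition mellin01_kernel :: "nat \<Rightarrow> complex \<Rightarrow> real \<Rightarrow> complex" where
  "mellin01_kernel k w v = of_real ((- ln v) ^ k) * of_real v powr (w - 1)"

lemma mellin01_kernel_0 [simp]: "mellin01_kernel k w 0 = 0" by (simp add: mellin01_kernel_def)

lemma norm_mellin01_kernel_le:
  assumes "Re w \<ge> 2" "v \<in> {0..1}"
  shows "norm (mellin01_kernel k w v) \<le> 2 ^ k * fact k * sqrt v"
proof (cases "v = 0")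
  case False
  hence v: "0 < v" "v \<le> 1" using assms by auto
  have "norm (mellin01_kernel k w v) = (- ln v) ^ k * v powr (Re w - 1)"
    using v by (simp add: mellin01_kernel_def norm_mult norm_powr_real_powr norm_power)
  also have "\<dots> \<le> (- ln v) ^ k * v powr 1"
    using v assms by (intro mult_left_mono powr_mono') auto
  also have "\<dots> \<le> 2 ^ k * fact k * sqrt v" using ln_power_mult_le[OF v] v by simp
  finally show ?thesis .
qed auto

lemma continuous_on_mellin01_kernel:
  assumes "Re w \<ge> 2"
  shows "continuous_on {0..1} (mellin01_kernel k w)"
proof (subst continuous_on_eq_continuous_within, intro ballI)
  fix v :: real assume v: "v \<in> {0..1}"
  show "continuous (at v within {0..1}) (mellin01_kernel k w)"
  proof (cases "v = 0")
    case True
    have "(mellin01_kernel k w \<longlongrightarrow> 0) (at 0 within {0..1})"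
    proof (rule Lim_null_comparison)
      show "\<forall>\<^sub>F v in at 0 within {0..1}. norm (mellin01_kernel k w v) \<le> 2 ^ k * fact k * sqrt v"
        using norm_mellin01_kernel_le[OF assms] by (auto simp: eventually_at_filter)
      have "((\<lambda>v::real. 2 ^ k * fact k * sqrt v) \<longlongrightarrow> 2 ^ k * fact k * sqrt 0) (at 0)"
        by (intro tendsto_intros)
      thus "((\<lambda>v::real. 2 ^ k * fact k * sqrt v) \<longlongrightarrow> 0) (at 0 within {0..1})"
        by (simp add: tendsto_within_subset[where S = UNIV])
    qed
    thus ?thesis using True by (simp add: continuous_within)
  next
    case False
    hence "v > 0" using v by auto
    have "continuous_on {0<..} (mellin01_kernel k w)"
      unfolding mellin01_kernel_def by (intro continuous_intros) (auto simp: complex_nonpos_Reals_iff)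
    hence "isCont (mellin01_kernel k w) v" using \<open>v > 0\<close> by (auto simp: continuous_on_eq_continuous_at)
    thus ?thesis by (rule continuous_at_imp_continuous_at_within)
  qed
qed

definition mellin01 :: "nat \<Rightarrow> complex \<Rightarrow> (real \<Rightarrow> complex) \<Rightarrow> complex" where
  "mellin01 k w H = integral {0..1} (\<lambda>v. mellin01_kernel k w v * H v)"

lemma mellin01_integrable:
  "Re w \<ge> 2 \<Longrightarrow> continuous_on {0..1} H \<Longrightarrow> (\<lambda>v. mellin01_kernel k w v * H v) integrable_on {0..1}"
  by (intro integrable_continuous_real continuous_intros continuous_on_mellin01_kernel)

lemma norm_mellin01_le:
  assumes "Re w \<ge> 2" "continuous_on {0..1} H" "\<And>v. v \<in> {0..1} \<Longrightarrow> norm (H v) \<le> \<epsilon>"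
  shows "norm (mellin01 k w H) \<le> 2 ^ k * fact k * \<epsilon>"
proof -
  have "norm (mellin01 k w H) \<le> 2 ^ k * fact k * \<epsilon> * (1 - 0)"
    unfolding mellin01_def
  proof (rule integral_bound)
    show "continuous_on {0..1} (\<lambda>v. mellin01_kernel k w v * H v)"
      by (intro continuous_intros continuous_on_mellin01_kernel assms)
    fix v :: real assume v: "v \<in> {0..1}"
    have "norm (mellin01_kernel k w v) \<le> 2 ^ k * fact k * sqrt v" by (rule norm_mellin01_kernel_le[OF assms(1) v])
    also have "\<dots> \<le> 2 ^ k * fact k * 1" using v by (intro mult_left_mono) auto
    finally show "norm (mellin01_kernel k w v * H v) \<le> 2 ^ k * fact k * \<epsilon>"
      unfolding norm_mult using assms(3)[OF v] by (intro mult_mono) auto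
  qed auto
  thus ?thesis by simp
qed

text \<open>The integrated function is (- ln v)^(k+1) v^w H(v). It vanishes at 0 because of v^w and
  at 1 because of the logarithm, so there are no boundary terms whatever the values of H.\<close>

lemma mellin01_by_parts:
  assumes w: "Re w \<ge> 2"
    and H: "\<And>v. v \<in> {0..1} \<Longrightarrow> (H has_vector_derivative H' v) (at v within {0..1})"
    and H': "continuous_on {0..1} H'"
  shows "w * mellin01 (Suc k) w H = of_nat (Suc k) * mellin01 k w H - mellin01 (Suc k) (w + 1) H'"
proof -
  have cH: "continuous_on {0..1} H" using H by (intro continuous_on_vector_derivative) auto
  have w1: "Re (w + 1) \<ge> 2" using w by simp
  define \<Phi> where "\<Phi> = (\<lambda>v. mellin01_kernel (Suc k) (w + 1) v * H v)"
  define \<phi> where "\<phi> = (\<lambda>v. (w * (mellin01_kernel (Suc k) w v * H v) - of_nat (Suc k) * (mellin01_kernel k w v * H v)) +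
      mellin01_kernel (Suc k) (w + 1) v * H' v)"
  have "(\<phi> has_integral (\<Phi> 1 - \<Phi> 0)) {0..1}"
  proof (rule fundamental_theorem_of_calculus_interior)
    show "continuous_on {0..1} \<Phi>"
      unfolding \<Phi>_def by (intro continuous_intros continuous_on_mellin01_kernel w1 cH)
    fix v :: real assume v: "v \<in> {0<..<1}"
    have H1: "(H has_vector_derivative H' v) (at v)"
      using H[of v] v at_within_Icc_at[of 0 v 1] by simp
    have "((\<lambda>v. (- ln v) ^ Suc k) has_real_derivative (1 + real k) * (- (1 / v) * (- ln v) ^ k)) (at v)"
      by (rule DERIV_power_Suc) (use v in \<open>auto intro!: derivative_eq_intros\<close>)
    hence d1: "((\<lambda>v. complex_of_real ((- ln v) ^ Suc k)) has_vector_derivative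
       of_real ((1 + real k) * (- (1 / v) * (- ln v) ^ k))) (at v)"
      by (rule has_vector_derivative_of_real)
    have "((\<lambda>z. z powr w) has_field_derivative w * of_real v powr (w - 1)) (at (complex_of_real v))"
      using v by (intro has_field_derivative_powr) (auto simp: complex_nonpos_Reals_iff)
    from field_vector_diff_chain_at[OF has_vector_derivative_of_real[OF DERIV_ident] this]
    have d2: "((\<lambda>v. complex_of_real v powr w) has_vector_derivative w * of_real v powr (w - 1)) (at v)"
      by (simp add: o_def)
    have pw: "complex_of_real v powr w = of_real v * of_real v powr (w - 1)"
      using v powr_add[of "complex_of_real v" 1 "w - 1"] by simp
    have "(\<Phi> has_vector_derivative
       (of_real ((- ln v) ^ Suc k) * of_real v powr w) * H' v +
       (of_real ((- ln v) ^ Suc k) * (w * of_real v powr (w - 1)) +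
        of_real ((1 + real k) * (- (1 / v) * (- ln v) ^ k)) * of_real v powr w) * H v) (at v)"
      unfolding \<Phi>_def mellin01_kernel_def
      using has_vector_derivative_mult[OF has_vector_derivative_mult[OF d1 d2] H1] by simp
    moreover have "(of_real ((- ln v) ^ Suc k) * of_real v powr w) * H' v +
       (of_real ((- ln v) ^ Suc k) * (w * of_real v powr (w - 1)) +
        of_real ((1 + real k) * (- (1 / v) * (- ln v) ^ k)) * of_real v powr w) * H v = \<phi> v"
    proof -
      have "of_real ((1 + real k) * (- (1 / v) * (- ln v) ^ k)) * complex_of_real v powr w =
        - (of_nat (Suc k) * mellin01_kernel k w v)"
        unfolding pw mellin01_kernel_def using v by simp
      thus ?thesis unfolding \<phi>_def mellin01_kernel_def by (simp add: algebra_simps)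
    qed
    ultimately show "(\<Phi> has_vector_derivative \<phi> v) (at v)" by simp
  qed auto
  hence "(\<phi> has_integral 0) {0..1}" by (simp add: \<Phi>_def mellin01_kernel_def)
  moreover have "(\<phi> has_integral (w * mellin01 (Suc k) w H - of_nat (Suc k) * mellin01 k w H + mellin01 (Suc k) (w + 1) H')) {0..1}"
    unfolding \<phi>_def mellin01_def
    by (intro has_integral_add has_integral_diff has_integral_mult_right integrable_integral mellin01_integrable w w1 cH H')
  ultimately have "w * mellin01 (Suc k) w H - of_nat (Suc k) * mellin01 k w H + mellin01 (Suc k) (w + 1) H' = 0"
    using has_integral_unique by blast
  thus ?thesis by (simp add: algebra_simps)
qed

lemma mellin01_one:
  assumes w: "Re w \<ge> 2"
  shows "mellin01 k w (\<lambda>_. 1) = fact k / w ^ Suc k"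
proof (induction k)
  have w0: "w \<noteq> 0" using w by auto
  case 0
  have "((\<lambda>v. of_real v powr (w - 1)) has_integral (of_real 1 powr w / w - of_real 0 powr w / w)) {0..1::real}"
  proof (rule fundamental_theorem_of_calculus_interior)
    have "continuous_on {0..1} (\<lambda>v. mellin01_kernel 0 (w + 1) v / w)"
      using w0 w by (intro continuous_intros continuous_on_mellin01_kernel) auto
    thus "continuous_on {0..1::real} (\<lambda>v. of_real v powr w / w)" by (simp add: mellin01_kernel_def)
    fix v :: real assume v: "v \<in> {0<..<1}"
    have "((\<lambda>z. z powr w) has_field_derivative w * of_real v powr (w - 1)) (at (complex_of_real v))"
      using v by (intro has_field_derivative_powr) (auto simp: complex_nonpos_Reals_iff)
    hence "((\<lambda>z. z powr w / w) has_field_derivative of_real v powr (w - 1)) (at (complex_of_real v))"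
      using DERIV_cdivide[of "\<lambda>z. z powr w" "w * of_real v powr (w - 1)" "of_real v" UNIV w] w0 by simp
    from field_vector_diff_chain_at[OF has_vector_derivative_of_real[OF DERIV_ident] this]
    show "((\<lambda>v. complex_of_real v powr w / w) has_vector_derivative of_real v powr (w - 1)) (at v)"
      by (simp add: o_def)
  qed auto
  thus ?case unfolding mellin01_def mellin01_kernel_def by (simp add: integral_unique)
next
  case (Suc k)
  have w0: "w \<noteq> 0" using w by auto
  have "w * mellin01 (Suc k) w (\<lambda>_. 1) = of_nat (Suc k) * mellin01 k w (\<lambda>_. 1) - mellin01 (Suc k) (w + 1) (\<lambda>_. 0)"
    by (rule mellin01_by_parts[OF w]) auto
  also have "mellin01 (Suc k) (w + 1) (\<lambda>_. 0) = 0" by (simp add: mellin01_def)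
  finally have "mellin01 (Suc k) w (\<lambda>_. 1) = of_nat (Suc k) * (fact k / w ^ Suc k) / w"
    using Suc w0 by (simp add: field_simps del: of_nat_Suc)
  thus ?case by (simp add: field_simps)
qed

text \<open>A factor v^j only shifts w by j. At w = N - rho the value is (-1)^k times the k-th
  derivative of 1/(s - rho) at s = N + j, the quantity that partial fractions produce.\<close>

lemma mellin01_monomial:
  assumes w: "Re w \<ge> 2"
  shows "mellin01 k w (\<lambda>v. of_real v ^ j) = fact k / (w + of_nat j) ^ Suc k"
proof -
  have "mellin01_kernel k w v * of_real v ^ j = mellin01_kernel k (w + of_nat j) v * 1" for v
  proof (cases "v = 0")
    case False
    have "complex_of_real v powr (w + of_nat j - 1) = of_real v powr ((w - 1) + of_nat j)"
      by (simp add: algebra_simps)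
    also have "\<dots> = of_real v powr (w - 1) * of_real v ^ j"
      using False by (simp add: powr_add powr_nat')
    finally show ?thesis by (simp add: mellin01_kernel_def)
  qed (use w in \<open>auto\<close>)
  hence "mellin01 k w (\<lambda>v. of_real v ^ j) = mellin01 k (w + of_nat j) (\<lambda>_. 1)" by (simp add: mellin01_def)
  also have "\<dots> = fact k / (w + of_nat j) ^ Suc k" by (rule mellin01_one) (use w in auto)
  finally show ?thesis .
qed

text \<open>Each integration by parts gains a factor 1 / |w|. It costs either one logarithm or one
  derivative of H, so p <= k rounds are available. The term with H' sits at w + 1, and |w + 1| >=
  |w| here.\<close>

lemma mellin01_decay:
  assumes "p \<le> k"
  shows "\<exists>C\<ge>0. \<forall>w H \<epsilon>. Re w \<ge> 2 \<longrightarrow> cont_diff_bd p \<epsilon> H \<longrightarrow> norm (mellin01 k w H) \<le> C * \<epsilon> / norm w ^ p"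
  using assms
proof (induction p arbitrary: k)
  case 0
  show ?case
    by (rule exI[of _ "2 ^ k * fact k"]) (auto intro!: norm_mellin01_le)
next
  case (Suc p)
  then obtain k' where k': "k = Suc k'" "p \<le> k'" by (cases k) auto
  obtain C1 where C1: "C1 \<ge> 0" "\<And>w H \<epsilon>. Re w \<ge> 2 \<Longrightarrow> cont_diff_bd p \<epsilon> H \<Longrightarrow> norm (mellin01 k' w H) \<le> C1 * \<epsilon> / norm w ^ p"
    using Suc.IH[OF k'(2)] by blast
  obtain C2 where C2: "C2 \<ge> 0" "\<And>w H \<epsilon>. Re w \<ge> 2 \<Longrightarrow> cont_diff_bd p \<epsilon> H \<Longrightarrow> norm (mellin01 k w H) \<le> C2 * \<epsilon> / norm w ^ p"
    using Suc.IH[of k] Suc.prems by auto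
  show ?case
  proof (intro exI[of _ "of_nat k * C1 + C2"] conjI allI impI)
    fix w H \<epsilon> assume w: "Re w \<ge> 2" and H: "cont_diff_bd (Suc p) \<epsilon> H"
    obtain H' where H': "\<And>v. v \<in> {0..1} \<Longrightarrow> (H has_vector_derivative H' v) (at v within {0..1})" "cont_diff_bd p \<epsilon> H'"
      using H unfolding cont_diff_bd.simps(2) by blast
    have e0: "\<epsilon> \<ge> 0" by (rule cont_diff_bd_nonneg[OF H])
    have w0: "norm w > 0" "norm (w + 1) \<ge> norm w"
    proof -
      show "norm w > 0" using w by auto
      have "norm w ^ 2 \<le> norm (w + 1) ^ 2"
        unfolding cmod_power2 using w by (simp add: power2_eq_square algebra_simps)
      thus "norm (w + 1) \<ge> norm w" by (rule power2_le_imp_le) auto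
    qed
    have "norm w * norm (mellin01 k w H) = norm (of_nat k * mellin01 k' w H - mellin01 k (w + 1) H')"
      using mellin01_by_parts[OF w H'(1) cont_diff_bd_continuous[OF H'(2)], of k'] unfolding k'
      by (metis norm_mult)
    also have "\<dots> \<le> norm (of_nat k * mellin01 k' w H) + norm (mellin01 k (w + 1) H')"
      by (rule norm_triangle_ineq4)
    also have "\<dots> \<le> of_nat k * (C1 * \<epsilon> / norm w ^ p) + C2 * \<epsilon> / norm w ^ p"
    proof (intro add_mono)
      show "norm (of_nat k * mellin01 k' w H) \<le> of_nat k * (C1 * \<epsilon> / norm w ^ p)"
        unfolding norm_mult norm_of_nat
        by (rule mult_left_mono[OF C1(2)[OF w cont_diff_bd_Suc_imp[OF H]]]) simp
      have "norm (mellin01 k (w + 1) H') \<le> C2 * \<epsilon> / norm (w + 1) ^ p" by (rule C2(2)) (use w H' in auto)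
      also have "\<dots> \<le> C2 * \<epsilon> / norm w ^ p"
        using w0 C2 e0 by (intro divide_left_mono power_mono mult_pos_pos zero_less_power) auto
      finally show "norm (mellin01 k (w + 1) H') \<le> C2 * \<epsilon> / norm w ^ p" .
    qed
    finally show "norm (mellin01 k w H) \<le> (of_nat k * C1 + C2) * \<epsilon> / norm w ^ Suc p"
      using w0 by (simp add: field_simps)
  qed (use C1 C2 in auto)
qed

section \<open>The explicit formula by polynomial approximation\<close>

lemma infsum_norm_bound:
  fixes f :: "'a \<Rightarrow> 'b :: banach" and g :: "'a \<Rightarrow> real"
  assumes g: "g summable_on A" and le: "\<And>x. x \<in> A \<Longrightarrow> norm (f x) \<le> g x"
  shows "(\<lambda>x. norm (f x)) summable_on A" "f summable_on A" "norm (infsum f A) \<le> infsum g A"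
proof -
  show s: "(\<lambda>x. norm (f x)) summable_on A"
    by (rule summable_on_comparison_test[OF g]) (use le in auto)
  thus "f summable_on A" by (rule abs_summable_summable)
  have "norm (infsum f A) \<le> infsum (\<lambda>x. norm (f x)) A" by (rule norm_infsum_bound[OF s])
  also have "\<dots> \<le> infsum g A" by (rule infsum_mono[OF s g le])
  finally show "norm (infsum f A) \<le> infsum g A" .
qed

lemma has_sum_finite_sum:
  fixes f :: "'i \<Rightarrow> 'a \<Rightarrow> 'b :: topological_comm_monoid_add"
  assumes "finite I" "\<And>i. i \<in> I \<Longrightarrow> (f i has_sum s i) A"
  shows "((\<lambda>x. \<Sum>i\<in>I. f i x) has_sum (\<Sum>i\<in>I. s i)) A"
  using assms by (induction I rule: finite_induct) (auto intro: has_sum_add has_sum_0)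

section \<open>Transport of test functions to the unit interval\<close>

definition mellin :: "(real \<Rightarrow> complex) \<Rightarrow> complex \<Rightarrow> complex" where
  "mellin g \<rho> = integral {0<..} (\<lambda>u. g u * of_real u powr \<rho> / of_real u)"

lemma compact_support_absolutely_integrable:
  fixes f :: "real \<Rightarrow> complex"
  assumes cont: "continuous_on {0<..} f" and c: "0 \<le> c" "c < a"
    and supp: "\<And>u. 0 < u \<Longrightarrow> u < a \<or> b < u \<Longrightarrow> f u = 0"
  shows "f absolutely_integrable_on {c<..}"
    and "integral {c<..} f = integral {a..b} f"
proof -
  have eq: "(\<lambda>u. if u \<in> {c<..} then f u else 0) = (\<lambda>u. if u \<in> {a..b} then f u else 0)"
    using supp c by (auto simp: fun_eq_iff)
  have "f absolutely_integrable_on {a..b}"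
    by (intro absolutely_integrable_continuous_real continuous_on_subset[OF cont]) (use c in auto)
  thus "f absolutely_integrable_on {c<..}"
    by (subst (asm) absolutely_integrable_restrict_UNIV[symmetric],
        subst absolutely_integrable_restrict_UNIV[symmetric]) (simp only: eq)
  show "integral {c<..} f = integral {a..b} f"
    by (subst (1 2) integral_restrict_UNIV[symmetric]) (simp only: eq)
qed

text \<open>The substitution \<open>v = 1 / u\<close> for \<open>g(u) = (ln u) ^ k * u powr - N * H(1 / u)\<close>.\<close>

definition pull_back :: "nat \<Rightarrow> nat \<Rightarrow> (real \<Rightarrow> complex) \<Rightarrow> real \<Rightarrow> complex" where
  "pull_back N k g v = (if 0 < v \<and> v < 1
     then of_real (1 / v) ^ N * of_real (1 / (- ln v)) ^ k * g (1 / v) else 0)"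

text \<open>Support in [a,b] with a > 1 becomes support in [1/b, 1/a], away from both v = 0 and v =
  1 where the prefactor is singular. The extension by zero is therefore as smooth as g; the line is
  covered by open sets on which one of the two descriptions holds.\<close>

lemma cont_diff_pull_back:
  assumes g: "cont_diff n {0<..} g" and a: "1 < a" and b: "0 < b" and supp: "\<And>u. u < a \<or> b < u \<Longrightarrow> g u = 0"
  shows "cont_diff n UNIV (pull_back N k g)"
proof -
  have "cont_diff n {0<..<1} (\<lambda>v. of_real (1 / v) ^ N * of_real (1 / (- ln v)) ^ k * g (1 / v))"
    by (intro cont_diff_mult cont_diff_power cont_diff_recip_ln cont_diff_subset[OF cont_diff_recip] cont_diff_subset[OF cont_diff_compose_recip[OF g]])
       auto
  hence 1: "cont_diff n {0<..<1} (pull_back N k g)"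
    by (rule cont_diff_cong[rotated 2]) (auto simp: pull_back_def)
  have "cont_diff n ({..<1/b} \<union> {1/a<..}) (\<lambda>_. 0)" by (rule cont_diff_const) auto
  hence 2: "cont_diff n ({..<1/b} \<union> {1/a<..}) (pull_back N k g)"
    by (rule cont_diff_cong[rotated 2]) (use a b supp in \<open>auto simp: pull_back_def field_simps\<close>)
  have ab: "1 / b > 0" "1 / a < 1" using a b by auto
  have "x \<in> {0<..<1} \<union> ({..<1/b} \<union> {1/a<..})" for x
  proof (cases "x \<le> 0")
    case True
    hence "x < 1 / b" using ab by linarith
    thus ?thesis by simp
  next
    case False
    hence "x \<in> {0<..<1} \<or> 1 / a < x" using ab by (simp only: greaterThanLessThan_iff) linarith
    thus ?thesis by blast
  qed
  hence "UNIV = {0<..<1} \<union> ({..<1/b} \<union> {1/a<..})" by blast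
  thus ?thesis using cont_diff_Un[OF 1 2] by (simp add: open_Un)
qed

text \<open>The prefactors of \<open>pull_back\<close> cancel v^N and the logarithms of the kernel.
  What is left is the substitution v = 1/u with Jacobian 1/v^2, and the result depends on neither k
  nor N.\<close>

lemma mellin01_pull_back:
  assumes g: "continuous_on {0<..} g" and a: "1 < a" and supp: "\<And>u. u < a \<or> b < u \<Longrightarrow> g u = 0"
  shows "mellin01 k (of_nat N - \<rho>) (pull_back N k g) = mellin g \<rho>"
proof -
  define f where "f = (\<lambda>u. g u * of_real u powr \<rho> / of_real u)"
  have cf: "continuous_on {0<..} f"
    unfolding f_def by (intro continuous_intros g) (auto simp: complex_nonpos_Reals_iff)
  have f0: "f u = 0" if "u < a \<or> b < u" for u using supp[OF that] by (simp add: f_def)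
  have ai: "f absolutely_integrable_on {1<..}"
    by (rule compact_support_absolutely_integrable(1)[OF cf _ a]) (use f0 in auto)
  have int: "integral {1<..} f = integral {0<..} f"
    using compact_support_absolutely_integrable(2)[OF cf _ a, of b]
      compact_support_absolutely_integrable(2)[OF cf, of 0 a b] f0 a by simp
  have img: "(\<lambda>v::real. 1 / v) ` {0<..<1} = {1<..}"
  proof (intro equalityI subsetI)
    fix u :: real assume "u \<in> {1<..}"
    thus "u \<in> (\<lambda>v. 1 / v) ` {0<..<1}" by (intro image_eqI[of _ _ "1 / u"]) auto
  qed auto
  have "(\<lambda>v. \<bar>- ((1 / v)\<^sup>2)\<bar> *\<^sub>R f (1 / v)) absolutely_integrable_on {0<..<1} \<and>
      integral {0<..<1} (\<lambda>v. \<bar>- ((1 / v)\<^sup>2)\<bar> *\<^sub>R f (1 / v)) = integral {1<..} f"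
  proof (subst has_absolute_integral_change_of_variables_real)
    fix v :: real assume "v \<in> {0<..<1}"
    thus "((\<lambda>v. 1 / v) has_field_derivative - ((1 / v)\<^sup>2)) (at v within {0<..<1})"
      by (auto intro!: derivative_eq_intros simp: power2_eq_square)
  qed (use ai img in \<open>auto simp: inj_on_def\<close>)
  hence 1: "integral {0<..<1} (\<lambda>v. \<bar>- ((1 / v)\<^sup>2)\<bar> *\<^sub>R f (1 / v)) = mellin g \<rho>"
    using int by (simp add: mellin_def f_def)
  have pt: "mellin01_kernel k (of_nat N - \<rho>) v * pull_back N k g v = \<bar>- ((1 / v)\<^sup>2)\<bar> *\<^sub>R f (1 / v)"
    if v: "v \<in> {0<..<1}" for v
  proof -
    have l: "ln v \<noteq> 0" "v > 0" "v < 1" using v by auto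
    have "complex_of_real v powr (of_nat N - \<rho> - 1) = of_real v ^ N * of_real v powr (- \<rho>) / of_real v"
      using l powr_diff[of "complex_of_real v" "of_nat N - \<rho>" 1] powr_add[of "complex_of_real v" "of_nat N" "- \<rho>"]
      by (simp add: powr_nat')
    moreover have "complex_of_real (1 / v) powr \<rho> = of_real v powr (- \<rho>)"
    proof -
      have "Ln (complex_of_real (1 / v)) = - Ln (of_real v)"
        using l Ln_of_real[of "1 / v"] Ln_of_real[of v] ln_div[of 1 v] by (simp del: of_real_divide)
      thus ?thesis using l by (simp add: powr_def)
    qed
    moreover have "(- ln v) ^ k * (1 / (- ln v)) ^ k = 1"
      using l by (simp only: power_mult_distrib[symmetric]) simp
    hence "complex_of_real ((- ln v) ^ k) * of_real (1 / (- ln v)) ^ k = 1"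
      by (simp only: of_real_power[symmetric] of_real_mult[symmetric]) simp
    moreover have "v ^ N * (1 / v) ^ N = 1"
      using l by (simp only: power_mult_distrib[symmetric]) simp
    hence "complex_of_real v ^ N * of_real (1 / v) ^ N = 1"
      by (simp only: of_real_power[symmetric] of_real_mult[symmetric]) simp
    moreover have "A * (B * X / Y) * (D * E * G) = (A * E) * (B * D) * (X / Y * G)"
      for A B X Y D E G :: complex by (simp add: field_simps)
    ultimately have "mellin01_kernel k (of_nat N - \<rho>) v * pull_back N k g v =
        1 * 1 * (of_real v powr (- \<rho>) / of_real v * g (1 / v))"
      unfolding mellin01_kernel_def pull_back_def using l by (simp only: if_True simp_thms)
    moreover have "\<bar>- ((1 / v)\<^sup>2)\<bar> *\<^sub>R f (1 / v) = of_real v powr (- \<rho>) / of_real v * g (1 / v)"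
      using l \<open>complex_of_real (1 / v) powr \<rho> = of_real v powr (- \<rho>)\<close>
      by (simp add: f_def scaleR_conv_of_real power2_eq_square field_simps)
    ultimately show ?thesis by simp
  qed
  have "mellin01 k (of_nat N - \<rho>) (pull_back N k g) =
      integral {0<..<1} (\<lambda>v. mellin01_kernel k (of_nat N - \<rho>) v * pull_back N k g v)"
    unfolding mellin01_def by (rule integral_open_interval_real)
  also have "\<dots> = mellin g \<rho>" unfolding 1[symmetric] by (rule integral_cong) (rule pt)
  finally show ?thesis .
qed

text \<open>The two functionals agree on the test functions \<open>(ln u) ^ k * u powr -(N + j)\<close>;
  in the variable \<open>v = 1 / u\<close> these are the monomials, which are dense.\<close>

theorem explicit_formula_from_moments:
  fixes lam :: "nat \<Rightarrow> complex" and wt :: "complex \<Rightarrow> complex" and N k p :: nat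
  assumes k: "p \<le> k" "k \<ge> 1"
    and s1: "(\<lambda>n. norm (lam n) * ln (real n) ^ k / real n ^ N) summable_on {1..}"
    and Z: "\<And>\<rho>. \<rho> \<in> Z \<Longrightarrow> Re \<rho> + 2 \<le> real N"
    and s2: "(\<lambda>\<rho>. norm (wt \<rho>) / norm (of_nat N - \<rho>) ^ p) summable_on Z"
    and ident: "\<And>j. (\<Sum>\<^sub>\<infinity>n\<in>{1..}. lam n * of_real (ln (real n)) ^ k / of_nat n ^ (N + j)) =
        (\<Sum>\<^sub>\<infinity>\<rho>\<in>Z. wt \<rho> * (fact k / (of_nat (N + j) - \<rho>) ^ Suc k))"
    and g: "\<And>n. cont_diff n {0<..} g" and a: "1 < a" and supp: "\<And>u. u < a \<or> b < u \<Longrightarrow> g u = 0"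
  shows "(\<lambda>\<rho>. norm (wt \<rho> * mellin g \<rho>)) summable_on Z"
    and "(\<Sum>\<^sub>\<infinity>n\<in>{1..}. lam n * g (real n)) = (\<Sum>\<^sub>\<infinity>\<rho>\<in>Z. wt \<rho> * mellin g \<rho>)"
proof -
  define b' where "b' = max b 1"
  have b': "b' > 0" "\<And>u. u < a \<or> b' < u \<Longrightarrow> g u = 0" using supp by (auto simp: b'_def)
  define c where "c = (\<lambda>n. lam n * of_real (ln (real n)) ^ k / of_nat n ^ N)"
  define A where "A = (\<lambda>H n. c n * H (1 / real n))"
  define B where "B = (\<lambda>H \<rho>. wt \<rho> * mellin01 k (of_nat N - \<rho>) H)"
  define SA where "SA = (\<Sum>\<^sub>\<infinity>n\<in>{1..}. norm (c n))"
  define SB where "SB = (\<Sum>\<^sub>\<infinity>\<rho>\<in>Z. norm (wt \<rho>) / norm (of_nat N - \<rho>) ^ p)"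
  have s1': "(\<lambda>n. norm (c n)) summable_on {1..}"
    by (rule summable_on_cong[THEN iffD1, OF _ s1])
       (auto simp: c_def norm_mult norm_divide norm_power)
  obtain C where C: "C \<ge> 0"
    "\<And>w H \<epsilon>. Re w \<ge> 2 \<Longrightarrow> cont_diff_bd p \<epsilon> H \<Longrightarrow> norm (mellin01 k w H) \<le> C * \<epsilon> / norm w ^ p"
    using mellin01_decay[OF k(1)] by blast
  \<comment> \<open>\<open>A\<close> and \<open>B\<close> are the two sides as functionals of H.
    This bound and the next one make both continuous in the C^p norm, for \<open>B\<close> by
    combining the decay of \<open>mellin01\<close> with the summability of the zeros.\<close>
  have A_bd: "(A H summable_on {1..}) \<and> norm (infsum (A H) {1..}) \<le> \<epsilon> * SA" if "cont_diff_bd p \<epsilon> H" for \<epsilon> H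
  proof -
    have s: "(\<lambda>n. \<epsilon> * norm (c n)) summable_on {1..}" by (intro summable_on_cmult_right s1')
    have le: "norm (A H n) \<le> \<epsilon> * norm (c n)" if n: "n \<in> {1..}" for n
    proof -
      have "norm (c n) * norm (H (1 / real n)) \<le> norm (c n) * \<epsilon>"
        by (intro mult_left_mono cont_diff_bd_bound[OF \<open>cont_diff_bd p \<epsilon> H\<close>]) (use n in auto)
      thus ?thesis by (simp add: A_def norm_mult mult.commute)
    qed
    have "A H summable_on {1..}" "norm (infsum (A H) {1..}) \<le> (\<Sum>\<^sub>\<infinity>n\<in>{1..}. \<epsilon> * norm (c n))"
      using infsum_norm_bound(2,3)[OF s le] by blast+
    thus ?thesis by (simp add: SA_def infsum_cmult_right')
  qed
  have B_bd: "((\<lambda>\<rho>. norm (B H \<rho>)) summable_on Z) \<and> (B H summable_on Z) \<and> norm (infsum (B H) Z) \<le> C * \<epsilon> * SB"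
    if "cont_diff_bd p \<epsilon> H" for \<epsilon> H
  proof -
    have s: "(\<lambda>\<rho>. C * \<epsilon> * (norm (wt \<rho>) / norm (of_nat N - \<rho>) ^ p)) summable_on Z"
      by (intro summable_on_cmult_right s2)
    have le: "norm (B H \<rho>) \<le> C * \<epsilon> * (norm (wt \<rho>) / norm (of_nat N - \<rho>) ^ p)" if \<rho>: "\<rho> \<in> Z" for \<rho>
    proof -
      have "norm (mellin01 k (of_nat N - \<rho>) H) \<le> C * \<epsilon> / norm (of_nat N - \<rho>) ^ p"
        by (rule C(2)[OF _ \<open>cont_diff_bd p \<epsilon> H\<close>]) (use Z[OF \<rho>] in simp)
      from mult_left_mono[OF this, of "norm (wt \<rho>)"] show ?thesis
        by (simp add: B_def norm_mult mult_ac)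
    qed
    show ?thesis using infsum_norm_bound[OF s le] unfolding SB_def infsum_cmult_right' by blast
  qed
  have mono: "infsum (A (\<lambda>v. of_real v ^ j)) {1..} = infsum (B (\<lambda>v. of_real v ^ j)) Z" for j
  proof -
    have "infsum (A (\<lambda>v. of_real v ^ j)) {1..} =
        (\<Sum>\<^sub>\<infinity>n\<in>{1..}. lam n * of_real (ln (real n)) ^ k / of_nat n ^ (N + j))"
      by (rule infsum_cong) (simp add: A_def c_def power_add power_divide)
    also have "\<dots> = infsum (B (\<lambda>v. of_real v ^ j)) Z"
      unfolding ident
    proof (rule infsum_cong)
      fix \<rho> assume \<rho>: "\<rho> \<in> Z"
      have "mellin01 k (of_nat N - \<rho>) (\<lambda>v. of_real v ^ j) = fact k / (of_nat N - \<rho> + of_nat j) ^ Suc k"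
        by (rule mellin01_monomial) (use Z[OF \<rho>] in simp)
      moreover have "of_nat N - \<rho> + of_nat j = of_nat (N + j) - \<rho>" by simp
      ultimately show "wt \<rho> * (fact k / (of_nat (N + j) - \<rho>) ^ Suc k) = B (\<lambda>v. of_real v ^ j) \<rho>"
        by (simp only: B_def)
    qed
    finally show ?thesis .
  qed
  have cont_diff_of_real: "cont_diff n UNIV (\<lambda>v. complex_of_real v)" for n
  proof (cases n)
    case (Suc m)
    show ?thesis unfolding Suc
      by (rule cont_diff_SucI[where f' = "\<lambda>_. 1"])
         (use has_vector_derivative_of_real[OF DERIV_ident] in \<open>auto intro: cont_diff_const\<close>)
  qed (auto intro!: continuous_intros)
  have summ_mono: "A (\<lambda>v. of_real v ^ j) summable_on {1..}" "B (\<lambda>v. of_real v ^ j) summable_on Z" for j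
  proof -
    obtain M where "cont_diff_bd p M (\<lambda>v. of_real v ^ j)"
      using cont_diff_imp_bd[OF cont_diff_power[OF _ cont_diff_of_real]] by blast
    thus "A (\<lambda>v. of_real v ^ j) summable_on {1..}" "B (\<lambda>v. of_real v ^ j) summable_on Z"
      using A_bd B_bd by blast+
  qed
  have poly: "\<exists>s. (A (\<lambda>v. poly P (of_real v)) has_sum s) {1..} \<and> (B (\<lambda>v. poly P (of_real v)) has_sum s) Z" for P
  proof -
    let ?I = "{..degree P}" and ?q = "coeff P"
    define s where "s = (\<lambda>j. ?q j * infsum (A (\<lambda>v. of_real v ^ j)) {1..})"
    have h1: "((\<lambda>n. \<Sum>j\<in>?I. ?q j * A (\<lambda>v. of_real v ^ j) n) has_sum (\<Sum>j\<in>?I. s j)) {1..}"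
      unfolding s_def by (intro has_sum_finite_sum has_sum_cmult_right has_sum_infsum summ_mono) auto
    have hA: "(\<lambda>n. \<Sum>j\<in>?I. ?q j * A (\<lambda>v. of_real v ^ j) n) = A (\<lambda>v. poly P (of_real v))"
      by (simp add: A_def poly_altdef sum_distrib_left mult_ac)
    have h2: "((\<lambda>n. \<Sum>j\<in>?I. ?q j * B (\<lambda>v. of_real v ^ j) n) has_sum (\<Sum>j\<in>?I. s j)) Z"
      unfolding s_def mono by (intro has_sum_finite_sum has_sum_cmult_right has_sum_infsum summ_mono) auto
    have hB: "(\<Sum>j\<in>?I. ?q j * B (\<lambda>v. of_real v ^ j) \<rho>) = B (\<lambda>v. poly P (of_real v)) \<rho>" if \<rho>: "\<rho> \<in> Z" for \<rho>
    proof -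
      have w: "Re (of_nat N - \<rho>) \<ge> 2" using Z[OF \<rho>] by simp
      have "mellin01 k (of_nat N - \<rho>) (\<lambda>v. poly P (of_real v)) =
         integral {0..1} (\<lambda>v. \<Sum>j\<in>?I. ?q j * (mellin01_kernel k (of_nat N - \<rho>) v * of_real v ^ j))"
        unfolding mellin01_def poly_altdef by (simp add: sum_distrib_left mult_ac)
      also have "\<dots> = (\<Sum>j\<in>?I. integral {0..1} (\<lambda>v. ?q j * (mellin01_kernel k (of_nat N - \<rho>) v * of_real v ^ j)))"
        by (intro integral_sum integrable_on_mult_right mellin01_integrable w continuous_intros) auto
      also have "\<dots> = (\<Sum>j\<in>?I. ?q j * mellin01 k (of_nat N - \<rho>) (\<lambda>v. of_real v ^ j))"
        by (simp add: mellin01_def)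
      finally show ?thesis by (simp add: B_def sum_distrib_left mult_ac)
    qed
    have "(A (\<lambda>v. poly P (of_real v)) has_sum (\<Sum>j\<in>?I. s j)) {1..}" using h1 unfolding hA .
    moreover have "(B (\<lambda>v. poly P (of_real v)) has_sum (\<Sum>j\<in>?I. s j)) Z"
      by (rule has_sum_cong[THEN iffD1, OF hB h2])
    ultimately show ?thesis by blast
  qed
  define H where "H = pull_back N k g"
  have H: "cont_diff n UNIV H" for n unfolding H_def by (rule cont_diff_pull_back[OF g a b'])
  obtain M where M: "cont_diff_bd p M H" using cont_diff_imp_bd[OF H] by blast
  note sA = A_bd[OF M] and sB = B_bd[OF M]
  \<comment> \<open>Both functionals have the same value on P, so only the remainder H - P
    contributes, and it is small in the C^p norm.\<close>
  have close: "norm (infsum (A H) {1..} - infsum (B H) Z) \<le> \<epsilon> * (SA + C * SB)" if \<epsilon>: "\<epsilon> > 0" for \<epsilon>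
  proof -
    obtain P where P: "cont_diff_bd p \<epsilon> (\<lambda>v. H v - poly P (of_real v))" using cont_diff_bd_poly_approx[OF H \<epsilon>] by blast
    let ?R = "\<lambda>v. H v - poly P (of_real v)"
    obtain s where s: "(A (\<lambda>v. poly P (of_real v)) has_sum s) {1..}" "(B (\<lambda>v. poly P (of_real v)) has_sum s) Z"
      using poly by blast
    note rA = A_bd[OF P] and rB = B_bd[OF P]
    have "((\<lambda>n. A ?R n + A (\<lambda>v. poly P (of_real v)) n) has_sum (infsum (A ?R) {1..} + s)) {1..}"
      by (intro has_sum_add has_sum_infsum s) (use rA in blast)
    moreover have "(\<lambda>n. A ?R n + A (\<lambda>v. poly P (of_real v)) n) = A H" by (simp add: A_def algebra_simps)
    ultimately have 1: "infsum (A H) {1..} = infsum (A ?R) {1..} + s" by (simp add: infsumI)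
    have h2: "((\<lambda>n. B ?R n + B (\<lambda>v. poly P (of_real v)) n) has_sum (infsum (B ?R) Z + s)) Z"
      by (intro has_sum_add has_sum_infsum s) (use rB in blast)
    have hB: "B ?R \<rho> + B (\<lambda>v. poly P (of_real v)) \<rho> = B H \<rho>" if \<rho>: "\<rho> \<in> Z" for \<rho>
    proof -
      have w: "Re (of_nat N - \<rho>) \<ge> 2" using Z[OF \<rho>] by simp
      have c1: "continuous_on {0..1} ?R" by (rule cont_diff_bd_continuous[OF P])
      have c2: "continuous_on {0..1} (\<lambda>v. poly P (complex_of_real v))" by (intro continuous_intros)
      have "mellin01 k (of_nat N - \<rho>) ?R + mellin01 k (of_nat N - \<rho>) (\<lambda>v. poly P (of_real v)) = mellin01 k (of_nat N - \<rho>) H"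
        unfolding mellin01_def
        by (subst integral_add[symmetric, OF mellin01_integrable[OF w c1] mellin01_integrable[OF w c2]])
           (simp add: algebra_simps)
      thus ?thesis by (simp add: B_def distrib_left[symmetric])
    qed
    have 2: "infsum (B H) Z = infsum (B ?R) Z + s"
      by (rule infsumI, rule has_sum_cong[THEN iffD1, OF hB h2])
    have "norm (infsum (A H) {1..} - infsum (B H) Z) \<le> norm (infsum (A ?R) {1..}) + norm (infsum (B ?R) Z)"
      unfolding 1 2 using norm_triangle_ineq4[of "infsum (A ?R) {1..}" "infsum (B ?R) Z"] by simp
    also have "\<dots> \<le> \<epsilon> * SA + C * \<epsilon> * SB" using rA rB by (intro add_mono) auto
    finally show ?thesis by (simp add: algebra_simps)
  qed
  have "SA \<ge> 0" "SB \<ge> 0" unfolding SA_def SB_def by (auto intro!: infsum_nonneg)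
  hence T: "SA + C * SB \<ge> 0" using C by simp
  have "norm (infsum (A H) {1..} - infsum (B H) Z) \<le> 0"
  proof (rule field_le_epsilon)
    fix e :: real assume e: "e > 0"
    have "norm (infsum (A H) {1..} - infsum (B H) Z) \<le> e / (SA + C * SB + 1) * (SA + C * SB)"
      by (rule close) (use e T in auto)
    also have "\<dots> \<le> e" using e T by (simp add: field_simps)
    finally show "norm (infsum (A H) {1..} - infsum (B H) Z) \<le> 0 + e" by simp
  qed
  hence AB: "infsum (A H) {1..} = infsum (B H) Z" by simp
  have cg: "continuous_on {0<..} g" using g[of 0] by simp
  have BH: "B H = (\<lambda>\<rho>. wt \<rho> * mellin g \<rho>)"
    unfolding B_def H_def by (rule ext) (simp only: mellin01_pull_back[OF cg a supp])
  \<comment> \<open>n = 1 is the point v = 1, where \<open>pull_back\<close> takes its default value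
    0; this agrees with g 1 = 0, because the support starts beyond 1.\<close>
  have AH: "A H n = lam n * g (real n)" if n: "n \<in> {1..}" for n
  proof (cases "n = 1")
    case True
    thus ?thesis using supp[of 1] a by (simp add: A_def H_def pull_back_def)
  next
    case False
    hence "real n > 1" using n by auto
    thus ?thesis by (simp add: A_def H_def pull_back_def c_def ln_div field_simps)
  qed
  show "(\<lambda>\<rho>. norm (wt \<rho> * mellin g \<rho>)) summable_on Z" using sB by (simp add: BH)
  have "(\<Sum>\<^sub>\<infinity>n\<in>{1..}. lam n * g (real n)) = infsum (A H) {1..}" by (rule infsum_cong) (simp add: AH)
  also have "\<dots> = infsum (B H) Z" by (rule AB)
  finally show "(\<Sum>\<^sub>\<infinity>n\<in>{1..}. lam n * g (real n)) = (\<Sum>\<^sub>\<infinity>\<rho>\<in>Z. wt \<rho> * mellin g \<rho>)"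
    unfolding BH .
qed

section \<open>Dirichlet series and the coefficients of log L\<close>

definition abs_conv_beyond :: "(nat \<Rightarrow> complex) \<Rightarrow> real \<Rightarrow> bool" where
  "abs_conv_beyond c \<sigma>0 \<longleftrightarrow> (\<forall>\<sigma>>\<sigma>0. summable (\<lambda>n. norm (c (Suc n)) / real (Suc n) powr \<sigma>))"

lemma norm_dirichlet_term:
  "norm (c (Suc n) / of_nat (Suc n) powr s) = norm (c (Suc n)) / real (Suc n) powr Re s"
  by (simp add: norm_divide norm_powr_real_powr del: of_nat_Suc)

lemma abs_conv_beyond_summable:
  assumes "abs_conv_beyond c \<sigma>0" "\<sigma>0 < Re s"
  shows "summable (\<lambda>n. norm (c (Suc n) / of_nat (Suc n) powr s))"
  using assms unfolding norm_dirichlet_term abs_conv_beyond_def by blast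

lemma abs_conv_beyondI:
  assumes "\<And>s. \<sigma>0 < Re s \<Longrightarrow> summable (\<lambda>n. norm (c (Suc n) / of_nat (Suc n) powr s))"
  shows "abs_conv_beyond c \<sigma>0"
  unfolding abs_conv_beyond_def
proof (intro allI impI)
  fix \<sigma> assume "\<sigma> > \<sigma>0"
  thus "summable (\<lambda>n. norm (c (Suc n)) / real (Suc n) powr \<sigma>)"
    using assms[of "of_real \<sigma>"] unfolding norm_dirichlet_term by simp
qed

lemma abs_conv_beyond_mono: "abs_conv_beyond c \<sigma>0 \<Longrightarrow> \<sigma>0 \<le> \<sigma>1 \<Longrightarrow> abs_conv_beyond c \<sigma>1"
  unfolding abs_conv_beyond_def by auto

lemma abs_conv_beyond_of_bound:
  assumes "\<And>n. n \<ge> 1 \<Longrightarrow> norm (c n) \<le> C * real n powr \<theta>"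
  shows "abs_conv_beyond c (1 + \<theta>)"
  unfolding abs_conv_beyond_def
proof (intro allI impI)
  fix \<sigma> assume \<sigma>: "\<sigma> > 1 + \<theta>"
  have "summable (\<lambda>n. real n powr (\<theta> - \<sigma>))" using \<sigma> by (subst summable_real_powr_iff) auto
  hence "summable (\<lambda>n. C * real (Suc n) powr (\<theta> - \<sigma>))"
    by (intro summable_mult) (subst summable_Suc_iff)
  thus "summable (\<lambda>n. norm (c (Suc n)) / real (Suc n) powr \<sigma>)"
  proof (rule summable_comparison_test'[of _ 0])
    fix n :: nat
    have "norm (c (Suc n)) / real (Suc n) powr \<sigma> \<le> C * real (Suc n) powr \<theta> / real (Suc n) powr \<sigma>"
      by (intro divide_right_mono assms) auto
    thus "norm (norm (c (Suc n)) / real (Suc n) powr \<sigma>) \<le> C * real (Suc n) powr (\<theta> - \<sigma>)"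
      by (simp add: powr_diff)
  qed
qed

text \<open>The half plane is open: with delta half the distance to its edge, ln n <= n^delta /
  delta is absorbed by moving delta to the left.\<close>

lemma abs_conv_beyond_ln:
  assumes "abs_conv_beyond c \<sigma>0"
  shows "abs_conv_beyond (\<lambda>n. - of_real (ln (real n)) * c n) \<sigma>0"
  unfolding abs_conv_beyond_def
proof (intro allI impI)
  fix \<sigma> assume \<sigma>: "\<sigma> > \<sigma>0"
  define \<delta> where "\<delta> = (\<sigma> - \<sigma>0) / 2"
  have \<delta>: "\<delta> > 0" "\<sigma> - \<delta> > \<sigma>0" using \<sigma> by (auto simp: \<delta>_def field_simps)
  have "summable (\<lambda>n. (1 / \<delta>) * (norm (c (Suc n)) / real (Suc n) powr (\<sigma> - \<delta>)))"
    using assms \<delta> unfolding abs_conv_beyond_def by (intro summable_mult) auto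
  thus "summable (\<lambda>n. norm (- of_real (ln (real (Suc n))) * c (Suc n)) / real (Suc n) powr \<sigma>)"
  proof (rule summable_comparison_test'[of _ 0])
    fix n :: nat
    let ?m = "real (Suc n)"
    have l: "0 \<le> ln ?m" "ln ?m \<le> ?m powr \<delta> / \<delta>" using \<delta> by (auto intro!: ln_powr_bound)
    have "ln ?m * norm (c (Suc n)) / ?m powr \<sigma> \<le> (?m powr \<delta> / \<delta>) * norm (c (Suc n)) / ?m powr \<sigma>"
      by (intro divide_right_mono mult_right_mono l) auto
    also have "\<dots> = (1 / \<delta>) * (norm (c (Suc n)) / ?m powr (\<sigma> - \<delta>))"
      by (simp add: powr_diff field_simps)
    finally show "norm (norm (- of_real (ln ?m) * c (Suc n)) / ?m powr \<sigma>) \<le>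
        (1 / \<delta>) * (norm (c (Suc n)) / ?m powr (\<sigma> - \<delta>))"
      using l by (simp add: norm_mult)
  qed
qed

lemma dirichlet_series_has_field_derivative:
  assumes c: "abs_conv_beyond c \<sigma>0" and s: "\<sigma>0 < Re s"
  shows "(dirichlet_series c has_field_derivative
     dirichlet_series (\<lambda>n. - of_real (ln (real n)) * c n) s) (at s)"
proof -
  define S where "S = {s. Re s > \<sigma>0}"
  have S: "open S" "s \<in> S" using s by (auto simp: S_def open_halfspace_Re_gt)
  define f where "f = (\<lambda>n s. c (Suc n) / of_nat (Suc n) powr s)"
  define f' where "f' = (\<lambda>n s. (- of_real (ln (real (Suc n))) * c (Suc n)) / of_nat (Suc n) powr s)"
  have "\<exists>g g'. \<forall>x\<in>S. ((\<lambda>n. f n x) sums g x) \<and> ((\<lambda>n. f' n x) sums g' x) \<and> (g has_field_derivative g' x) (at x)"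
  proof (rule series_and_derivative_comparison_local[OF S(1)])
    fix n and x :: complex assume "x \<in> S"
    have "((\<lambda>s. of_nat (Suc n) powr (- s)) has_field_derivative
       Ln (of_nat (Suc n)) * of_nat (Suc n) powr (- x) * (- 1)) (at x)"
      by (rule DERIV_chain2[OF has_field_derivative_powr_right])
         (auto intro!: derivative_eq_intros simp del: of_nat_Suc)
    hence "((\<lambda>s. c (Suc n) * of_nat (Suc n) powr (- s)) has_field_derivative
       c (Suc n) * (Ln (of_nat (Suc n)) * of_nat (Suc n) powr (- x) * (- 1))) (at x)"
      by (rule DERIV_cmult)
    moreover have "Ln (of_nat (Suc n)) = complex_of_real (ln (real (Suc n)))"
      using Ln_of_real[of "real (Suc n)"] by simp
    ultimately show "(f n has_field_derivative f' n x) (at x)"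
      unfolding f_def f'_def by (simp add: powr_minus divide_inverse mult_ac del: of_nat_Suc)
  next
    fix x assume "x \<in> S"
    define d where "d = (Re x - \<sigma>0) / 2"
    have d: "d > 0" "Re x - d > \<sigma>0" using \<open>x \<in> S\<close> by (auto simp: d_def S_def field_simps)
    have "norm (f n y) \<le> norm (c (Suc n)) / real (Suc n) powr (Re x - d)" if "y \<in> ball x d \<inter> S" for n y
    proof -
      have "\<bar>Re (x - y)\<bar> \<le> norm (x - y)" by (rule abs_Re_le_cmod)
      also have "\<dots> < d" using that by (simp add: dist_norm)
      finally have "Re x - d \<le> Re y" by simp
      hence "real (Suc n) powr (Re x - d) \<le> real (Suc n) powr Re y" by (intro powr_mono) auto
      thus ?thesis unfolding f_def norm_dirichlet_term
        by (intro divide_left_mono mult_pos_pos) auto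
    qed
    moreover have "summable (\<lambda>n. norm (c (Suc n)) / real (Suc n) powr (Re x - d))"
      using c d unfolding abs_conv_beyond_def by blast
    ultimately show "\<exists>d h. 0 < d \<and> summable h \<and> (\<forall>\<^sub>F n in sequentially. \<forall>y\<in>ball x d \<inter> S. norm (f n y) \<le> h n)"
      using d(1) by (intro exI[of _ d] exI[of _ "\<lambda>n. norm (c (Suc n)) / real (Suc n) powr (Re x - d)"]) auto
  qed
  then obtain g g' where g: "\<And>x. x \<in> S \<Longrightarrow> (\<lambda>n. f n x) sums g x"
    "\<And>x. x \<in> S \<Longrightarrow> (\<lambda>n. f' n x) sums g' x" "\<And>x. x \<in> S \<Longrightarrow> (g has_field_derivative g' x) (at x)" by blast
  have eq: "g x = dirichlet_series c x" if "x \<in> S" for x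
    using sums_unique[OF g(1)[OF that]] by (simp add: f_def dirichlet_series_def)
  have eq': "g' s = dirichlet_series (\<lambda>n. - of_real (ln (real n)) * c n) s"
    using sums_unique[OF g(2)[OF S(2)]] by (simp add: f'_def dirichlet_series_def)
  show ?thesis
    by (rule has_field_derivative_transform_within_open[OF g(3)[OF S(2), unfolded eq'] S eq])
qed

lemma dirichlet_series_holomorphic:
  "abs_conv_beyond c \<sigma>0 \<Longrightarrow> dirichlet_series c holomorphic_on {s. Re s > \<sigma>0}"
  unfolding holomorphic_on_open[OF open_halfspace_Re_gt]
  using dirichlet_series_has_field_derivative by blast

lemma abs_conv_beyond_ln_power:
  assumes "abs_conv_beyond c \<sigma>0"
  shows "abs_conv_beyond (\<lambda>n. (- of_real (ln (real n))) ^ k * c n) \<sigma>0"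
proof (induction k)
  case (Suc k)
  show ?case using abs_conv_beyond_ln[OF Suc] by (simp add: mult_ac)
qed (use assms in simp)

lemma higher_deriv_dirichlet_series:
  assumes c: "abs_conv_beyond c \<sigma>0" and s: "\<sigma>0 < Re s"
  shows "(deriv ^^ k) (dirichlet_series c) s = dirichlet_series (\<lambda>n. (- of_real (ln (real n))) ^ k * c n) s"
  using s
proof (induction k arbitrary: s)
  case (Suc k)
  have "(deriv ^^ Suc k) (dirichlet_series c) s = deriv ((deriv ^^ k) (dirichlet_series c)) s" by simp
  also have "\<dots> = deriv (dirichlet_series (\<lambda>n. (- of_real (ln (real n))) ^ k * c n)) s"
  proof (rule deriv_cong_ev[OF _ refl])
    have "\<forall>\<^sub>F w in nhds s. w \<in> {s. Re s > \<sigma>0}"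
      using Suc.prems by (intro eventually_nhds_in_open open_halfspace_Re_gt) auto
    thus "\<forall>\<^sub>F w in nhds s. (deriv ^^ k) (dirichlet_series c) w =
        dirichlet_series (\<lambda>n. (- of_real (ln (real n))) ^ k * c n) w"
      by eventually_elim (use Suc.IH in auto)
  qed
  also have "\<dots> = dirichlet_series (\<lambda>n. - of_real (ln (real n)) * ((- of_real (ln (real n))) ^ k * c n)) s"
    by (intro DERIV_imp_deriv dirichlet_series_has_field_derivative[OF abs_conv_beyond_ln_power[OF c]] Suc.prems)
  finally show ?case by (simp add: mult_ac)
qed simp

text \<open>After multiplication by n^x the n-th term is constant. A later term m carries (n/m)^(x -
  sigma), at most (n/(n+1))^(x - sigma), times a term of a convergent series, so the tail dies as x
  grows. Uniqueness of coefficients follows by induction on n.\<close>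

lemma dirichlet_series_leading:
  assumes c: "abs_conv_beyond c \<sigma>0" and n: "n \<ge> 1" and z: "\<And>m. 1 \<le> m \<Longrightarrow> m < n \<Longrightarrow> c m = 0"
  shows "((\<lambda>x::real. of_nat n powr of_real x * dirichlet_series c (of_real x)) \<longlongrightarrow> c n) at_top"
proof -
  define \<sigma> where "\<sigma> = \<sigma>0 + 1"
  define S where "S = (\<Sum>k. norm (c (Suc k)) / real (Suc k) powr \<sigma>)"
  have sm: "summable (\<lambda>k. norm (c (Suc k)) / real (Suc k) powr \<sigma>)"
    using c unfolding abs_conv_beyond_def \<sigma>_def by simp
  have key: "norm (of_nat n powr of_real x * dirichlet_series c (of_real x) - c n) \<le>
      real n powr \<sigma> * S * (real n / real (Suc n)) powr (x - \<sigma>)" if x: "x \<ge> \<sigma>" for x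
  proof -
    define t where "t = (\<lambda>k. of_nat n powr of_real x * (c (Suc k) / of_nat (Suc k) powr of_real x))"
    have smx: "summable (\<lambda>k. norm (c (Suc k) / of_nat (Suc k) powr of_real x))"
      by (rule abs_conv_beyond_summable[OF c]) (use x in \<open>simp add: \<sigma>_def\<close>)
    have st: "summable t" unfolding t_def
      by (intro summable_mult summable_norm_cancel[OF smx])
    have "of_nat n powr of_real x * dirichlet_series c (of_real x) = (\<Sum>k. t k)"
      unfolding dirichlet_series_def t_def by (rule suminf_mult[symmetric, OF summable_norm_cancel[OF smx]])
    also have "\<dots> = (\<Sum>k. t (k + n)) + (\<Sum>k<n. t k)" by (rule suminf_split_initial_segment[OF st])
    also have "(\<Sum>k<n. t k) = (\<Sum>k<n. if k = n - 1 then c n else 0)"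
    proof (rule sum.cong)
      fix k assume k: "k \<in> {..<n}"
      show "t k = (if k = n - 1 then c n else 0)"
        using n k z[of "Suc k"] by (cases "k = n - 1") (auto simp: t_def)
    qed auto
    also have "\<dots> = c n" using n by simp
    finally have eq: "of_nat n powr of_real x * dirichlet_series c (of_real x) - c n = (\<Sum>k. t (k + n))" by simp
    have bd: "norm (t (k + n)) \<le> real n powr \<sigma> * (real n / real (Suc n)) powr (x - \<sigma>) *
        (norm (c (Suc (k + n))) / real (Suc (k + n)) powr \<sigma>)" for k
    proof -
      let ?m = "real (Suc (k + n))"
      have "norm (t (k + n)) = real n powr x * (norm (c (Suc (k + n))) / ?m powr x)"
        unfolding t_def norm_mult norm_dirichlet_term by (simp add: norm_powr_real_powr)
      also have "\<dots> = real n powr \<sigma> * (norm (c (Suc (k + n))) / ?m powr \<sigma>) * (real n / ?m) powr (x - \<sigma>)"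
        using n by (simp add: powr_divide powr_diff field_simps)
      also have "\<dots> \<le> real n powr \<sigma> * (norm (c (Suc (k + n))) / ?m powr \<sigma>) * (real n / real (Suc n)) powr (x - \<sigma>)"
        using x by (intro mult_left_mono powr_mono2 divide_left_mono mult_nonneg_nonneg) auto
      finally show ?thesis by (simp add: mult_ac)
    qed
    have smn: "summable (\<lambda>k. real n powr \<sigma> * (real n / real (Suc n)) powr (x - \<sigma>) *
        (norm (c (Suc (k + n))) / real (Suc (k + n)) powr \<sigma>))"
      by (rule summable_mult) (rule summable_ignore_initial_segment[OF sm])
    have "norm (\<Sum>k. t (k + n)) \<le> (\<Sum>k. real n powr \<sigma> * (real n / real (Suc n)) powr (x - \<sigma>) *
        (norm (c (Suc (k + n))) / real (Suc (k + n)) powr \<sigma>))"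
      by (rule norm_suminf_le[OF bd smn])
    also have "\<dots> = real n powr \<sigma> * (real n / real (Suc n)) powr (x - \<sigma>) *
        (\<Sum>k. norm (c (Suc (k + n))) / real (Suc (k + n)) powr \<sigma>)"
      by (rule suminf_mult) (rule summable_ignore_initial_segment[OF sm])
    also have "\<dots> \<le> real n powr \<sigma> * (real n / real (Suc n)) powr (x - \<sigma>) * S"
      unfolding S_def suminf_split_initial_segment[OF sm, of n]
      by (intro mult_left_mono) (auto intro!: sum_nonneg)
    finally show ?thesis unfolding eq by (simp add: mult_ac)
  qed
  have "((\<lambda>x. of_nat n powr of_real x * dirichlet_series c (of_real x) - c n) \<longlongrightarrow> 0) at_top"
  proof (rule Lim_null_comparison)
    show "\<forall>\<^sub>F x in at_top. norm (of_nat n powr of_real x * dirichlet_series c (of_real x) - c n) \<le>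
      real n powr \<sigma> * S * (real n / real (Suc n)) powr (x - \<sigma>)"
      using key by (auto intro: eventually_mono[OF eventually_ge_at_top[of \<sigma>]])
    have "((\<lambda>x. (real n / real (Suc n)) powr (x - \<sigma>)) \<longlongrightarrow> 0) at_top"
    proof -
      have q: "0 < real n / real (Suc n)" "real n / real (Suc n) < 1" using n by auto
      hence l: "ln (real n / real (Suc n)) < 0" by simp
      have "filterlim (\<lambda>x. ln (real n / real (Suc n)) * (- \<sigma> + x)) at_bot at_top"
        by (rule filterlim_tendsto_neg_mult_at_bot[OF tendsto_const l
              filterlim_tendsto_add_at_top[OF tendsto_const filterlim_ident]])
      from filterlim_compose[OF exp_at_bot this] show ?thesis
        using q n by (simp add: powr_def mult.commute)
    qed
    thus "((\<lambda>x. real n powr \<sigma> * S * (real n / real (Suc n)) powr (x - \<sigma>)) \<longlongrightarrow> 0) at_top"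
      by (rule tendsto_mult_right_zero)
  qed
  thus ?thesis by (rule LIM_zero_cancel)
qed

lemma dirichlet_series_limit_1:
  assumes c: "abs_conv_beyond c \<sigma>0"
  shows "((\<lambda>x::real. dirichlet_series c (of_real x)) \<longlongrightarrow> c 1) at_top"
  using dirichlet_series_leading[OF c, of 1] by simp

lemma dirichlet_series_eq_0_imp:
  assumes c: "abs_conv_beyond c \<sigma>0" and z: "\<And>s. Re s > \<sigma>0 \<Longrightarrow> dirichlet_series c s = 0" and n: "n \<ge> 1"
  shows "c n = 0"
  using n
proof (induction n rule: less_induct)
  case (less n)
  have "((\<lambda>x::real. of_nat n powr of_real x * dirichlet_series c (of_real x)) \<longlongrightarrow> c n) at_top"
    by (rule dirichlet_series_leading[OF c less.prems less.IH]) auto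
  moreover have "((\<lambda>x::real. of_nat n powr of_real x * dirichlet_series c (of_real x)) \<longlongrightarrow> 0) at_top"
    by (rule tendsto_eventually, rule eventually_mono[OF eventually_gt_at_top[of \<sigma>0]]) (use z in simp)
  ultimately show ?case using tendsto_unique trivial_limit_at_top_linorder by blast
qed

lemma dirichlet_series_has_sum:
  assumes "abs_conv_beyond c \<sigma>0" "\<sigma>0 < Re s"
  shows "(\<lambda>n. norm (c n / of_nat n powr s)) summable_on {1..}"
    and "((\<lambda>n. c n / of_nat n powr s) has_sum dirichlet_series c s) {1..}"
proof -
  have b: "bij_betw Suc UNIV {1..}"
    by (rule bij_betw_byWitness[where f' = "\<lambda>n. n - 1"]) auto
  have sm: "summable (\<lambda>n. norm (c (Suc n) / of_nat (Suc n) powr s))" by (rule abs_conv_beyond_summable[OF assms])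
  hence "(\<lambda>n. norm (c (Suc n) / of_nat (Suc n) powr s)) summable_on UNIV"
    by (subst summable_on_UNIV_nonneg_real_iff) auto
  thus "(\<lambda>n. norm (c n / of_nat n powr s)) summable_on {1..}"
    using summable_on_reindex_bij_betw[OF b, of "\<lambda>n. norm (c n / of_nat n powr s)"] by simp
  have "((\<lambda>n. c (Suc n) / of_nat (Suc n) powr s) has_sum dirichlet_series c s) UNIV"
    unfolding dirichlet_series_def
    by (rule norm_summable_imp_has_sum[OF sm summable_sums[OF summable_norm_cancel[OF sm]]])
  thus "((\<lambda>n. c n / of_nat n powr s) has_sum dirichlet_series c s) {1..}"
    using has_sum_reindex_bij_betw[OF b, of "\<lambda>n. c n / of_nat n powr s"] by simp
qed

section \<open>Dirichlet convolution and Euler factors\<close>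

definition dirichlet_conv :: "(nat \<Rightarrow> complex) \<Rightarrow> (nat \<Rightarrow> complex) \<Rightarrow> nat \<Rightarrow> complex" where
  "dirichlet_conv a b n = (\<Sum>d | d dvd n. a d * b (n div d))"

text \<open>The double series over pairs of positive integers converges absolutely and may be
  regrouped by the product: pairs (n, d) with d dividing n correspond bijectively to (d, n div
  d).\<close>

lemma dirichlet_series_mult:
  assumes a: "abs_conv_beyond a \<sigma>0" and b: "abs_conv_beyond b \<sigma>0"
  shows "abs_conv_beyond (dirichlet_conv a b) \<sigma>0"
    and "\<sigma>0 < Re s \<Longrightarrow> dirichlet_series a s * dirichlet_series b s = dirichlet_series (dirichlet_conv a b) s"
proof -
  have main: "(\<lambda>n. norm (dirichlet_conv a b n / of_nat n powr s)) summable_on {1..} \<and>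
     dirichlet_series a s * dirichlet_series b s = (\<Sum>\<^sub>\<infinity>n\<in>{1..}. dirichlet_conv a b n / of_nat n powr s)"
    if s: "\<sigma>0 < Re s" for s
  proof -
    define f where "f = (\<lambda>n. a n / of_nat n powr s)"
    define g where "g = (\<lambda>n. b n / of_nat n powr s)"
    have f: "(\<lambda>n. norm (f n)) summable_on {1..}" "(f has_sum dirichlet_series a s) {1..}"
      using dirichlet_series_has_sum[OF a s] by (auto simp: f_def)
    have g: "(\<lambda>n. norm (g n)) summable_on {1..}" "(g has_sum dirichlet_series b s) {1..}"
      using dirichlet_series_has_sum[OF b s] by (auto simp: g_def)
    define F where "F = (\<lambda>(x, y). f x * g y)"
    have sF: "(\<lambda>p. norm (F p)) summable_on ({1..} \<times> {1..})"
    proof (rule Infinite_Sum.abs_summable_on_Sigma_iff[THEN iffD2], intro conjI ballI)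
      show "(\<lambda>y. norm (F (x, y))) summable_on {1..}" for x
        using summable_on_cmult_right[OF g(1), of "norm (f x)"] by (simp add: F_def norm_mult)
      have eq: "(\<Sum>\<^sub>\<infinity>y\<in>{1..}. norm (F (x, y))) = norm (f x) * (\<Sum>\<^sub>\<infinity>y\<in>{1..}. norm (g y))" for x
        by (simp add: F_def norm_mult infsum_cmult_right')
      have "(\<lambda>x. norm (norm (f x) * (\<Sum>\<^sub>\<infinity>y\<in>{1..}. norm (g y)))) summable_on {1..}"
        using summable_on_cmult_left[OF f(1), of "\<Sum>\<^sub>\<infinity>y\<in>{1..}. norm (g y)"]
        by (simp add: infsum_nonneg abs_mult)
      thus "(\<lambda>x. norm (\<Sum>\<^sub>\<infinity>y\<in>{1..}. norm (F (x, y)))) summable_on {1..}" unfolding eq .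
    qed
    have prod: "dirichlet_series a s * dirichlet_series b s = infsum F ({1..} \<times> {1..})"
    proof -
      have "infsum F ({1..} \<times> {1..}) = (\<Sum>\<^sub>\<infinity>x\<in>{1..}. \<Sum>\<^sub>\<infinity>y\<in>{1..}. F (x, y))"
        by (rule infsum_Sigma_banach[symmetric, OF abs_summable_summable[OF sF]])
      also have "\<dots> = infsum f {1..} * infsum g {1..}"
        by (simp add: F_def infsum_cmult_right' infsum_cmult_left')
      finally show ?thesis using infsumI[OF f(2)] infsumI[OF g(2)] by simp
    qed
    define T :: "(nat \<times> nat) set" where "T = (SIGMA n:{1..}. {d. d dvd n})"
    define G where "G = (\<lambda>(n::nat, d). f d * g (n div d))"
    have bij: "bij_betw (\<lambda>(n, d). (d, n div d)) T ({1..} \<times> {1..})"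
      by (rule bij_betw_byWitness[where f' = "\<lambda>(x, y). (x * y, x)"])
         (auto simp: T_def Suc_le_eq intro!: Nat.gr0I elim!: dvdE)
    have GF: "G p = F ((\<lambda>(n, d). (d, n div d)) p)" for p
      by (auto simp: G_def F_def split: prod.splits)
    have sG: "(\<lambda>p. norm (G p)) summable_on T"
      unfolding GF using summable_on_reindex_bij_betw[OF bij, of "\<lambda>p. norm (F p)"] sF by simp
    have iG: "infsum G T = infsum F ({1..} \<times> {1..})"
      unfolding GF by (rule infsum_reindex_bij_betw[OF bij])
    have inner: "(\<Sum>\<^sub>\<infinity>d\<in>{d. d dvd n}. G (n, d)) = dirichlet_conv a b n / of_nat n powr s" if n: "n \<in> {1..}" for n
    proof -
      have fin: "finite {d. d dvd n}" using n by auto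
      have "G (n, d) = a d * b (n div d) / of_nat n powr s" if d: "d dvd n" for d
      proof -
        obtain e where e: "n = d * e" using d by (elim dvdE)
        have de: "d > 0" "e > 0" using n e by (auto intro!: Nat.gr0I)
        have "complex_of_nat n powr s = of_nat d powr s * of_nat e powr s"
          using powr_times_real[of "of_nat d" "of_nat e" s] by (simp add: e)
        thus ?thesis using de by (simp add: G_def f_def g_def e)
      qed
      thus ?thesis unfolding dirichlet_conv_def using fin by (simp add: sum_divide_distrib)
    qed
    have "infsum G T = (\<Sum>\<^sub>\<infinity>n\<in>{1..}. \<Sum>\<^sub>\<infinity>d\<in>{d. d dvd n}. G (n, d))"
      unfolding T_def by (rule infsum_Sigma_banach[symmetric]) (use abs_summable_summable[OF sG] in \<open>simp add: T_def\<close>)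
    also have "\<dots> = (\<Sum>\<^sub>\<infinity>n\<in>{1..}. dirichlet_conv a b n / of_nat n powr s)"
      by (rule infsum_cong) (rule inner)
    finally have 1: "dirichlet_series a s * dirichlet_series b s = (\<Sum>\<^sub>\<infinity>n\<in>{1..}. dirichlet_conv a b n / of_nat n powr s)"
      using prod iG by simp
    have s1: "(\<lambda>n. \<Sum>\<^sub>\<infinity>d\<in>{d. d dvd n}. norm (G (n, d))) summable_on {1..}"
      by (rule summable_on_Sigma_banach) (use sG in \<open>simp add: T_def case_prod_unfold\<close>)
    have "(\<lambda>n. norm (dirichlet_conv a b n / of_nat n powr s)) summable_on {1..}"
    proof (rule summable_on_comparison_test[OF s1])
      fix n :: nat assume n: "n \<in> {1..}"
      have fin: "finite {d. d dvd n}" using n by auto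
      show "norm (dirichlet_conv a b n / of_nat n powr s) \<le> (\<Sum>\<^sub>\<infinity>d\<in>{d. d dvd n}. norm (G (n, d)))"
        unfolding inner[OF n, symmetric] using fin by (simp add: norm_sum)
    qed auto
    thus ?thesis using 1 by blast
  qed
  show da: "abs_conv_beyond (dirichlet_conv a b) \<sigma>0"
  proof (rule abs_conv_beyondI)
    fix s assume s: "\<sigma>0 < Re s"
    have b: "bij_betw Suc UNIV {1..}"
      by (rule bij_betw_byWitness[where f' = "\<lambda>n. n - 1"]) auto
    have "(\<lambda>n. norm (dirichlet_conv a b (Suc n) / of_nat (Suc n) powr s)) summable_on UNIV"
      using summable_on_reindex_bij_betw[OF b, of "\<lambda>n. norm (dirichlet_conv a b n / of_nat n powr s)"] main[OF s] by simp
    thus "summable (\<lambda>n. norm (dirichlet_conv a b (Suc n) / of_nat (Suc n) powr s))"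
      by (rule summable_on_imp_summable)
  qed
  show "dirichlet_series a s * dirichlet_series b s = dirichlet_series (dirichlet_conv a b) s" if s: "\<sigma>0 < Re s"
    using main[OF s] infsumI[OF dirichlet_series_has_sum(2)[OF da s]] by simp
qed

lemma dirichlet_conv_prime_power:
  assumes p: "prime (p::nat)"
  shows "dirichlet_conv f g (p ^ k) = (\<Sum>i\<le>k. f (p ^ i) * g (p ^ (k - i)))"
proof -
  have set: "{d. d dvd p ^ k} = (\<lambda>i. p ^ i) ` {..k}"
    using divides_primepow_nat[OF p] by auto
  have p1: "p > 1" using p by (rule prime_gt_1_nat)
  have inj: "inj_on (\<lambda>i. p ^ i) {..k}" using p1 by (auto simp: inj_on_def)
  have "dirichlet_conv f g (p ^ k) = (\<Sum>i\<le>k. f (p ^ i) * g (p ^ k div p ^ i))"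
    unfolding dirichlet_conv_def set by (subst sum.reindex[OF inj]) simp
  also have "\<dots> = (\<Sum>i\<le>k. f (p ^ i) * g (p ^ (k - i)))"
    using p1 by (intro sum.cong refl) (simp add: power_diff)
  finally show ?thesis .
qed

text \<open>Both sides agree as functions near 0, so F (1 - cX) = 1 holds for formal power series
  and yields q (m+1) = c q m. The point X = 0 is exempt from the hypothesis because a local factor
  is only known at X = p^-s; it is supplied by \<open>q 0 = 1\<close>.\<close>

lemma geometric_coeffs:
  fixes q :: "nat \<Rightarrow> complex"
  assumes q0: "q 0 = 1" and r: "r > 0" and sm: "summable (\<lambda>m. norm (q m) * r ^ m)"
    and eq: "\<And>X. X \<noteq> 0 \<Longrightarrow> norm X < r \<Longrightarrow> (\<Sum>m. q m * X ^ m) = 1 / (1 - c * X)"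
  shows "q m = c ^ m"
proof -
  define F where "F = Abs_fps q"
  define G where "G = 1 - fps_const c * fps_X"
  have "conv_radius q \<ge> norm (complex_of_real r)"
    by (rule conv_radius_geI, rule summable_norm_cancel)
       (use sm r in \<open>simp add: norm_mult norm_power\<close>)
  hence rad: "fps_conv_radius F \<ge> ereal r" using r by (simp add: F_def fps_conv_radius_def)
  have radG: "fps_conv_radius (fps_const c * fps_X) = \<infinity>" "fps_conv_radius G = \<infinity>"
  proof -
    show 1: "fps_conv_radius (fps_const c * fps_X) = \<infinity>"
      using fps_conv_radius_mult[of "fps_const c" "fps_X"] by simp
    show "fps_conv_radius G = \<infinity>"
      using fps_conv_radius_diff[of 1 "fps_const c * fps_X"] 1 by (simp add: G_def)
  qed
  \<comment> \<open>Within radius 1 / (|c| + 1) the denominator 1 - cX cannot vanish, so that the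
    division by it can be undone.\<close>
  define r' where "r' = min r (1 / (norm c + 1))"
  have n1: "norm c + 1 > 0" using norm_ge_zero[of c] by linarith
  have r': "r' > 0" "r' \<le> r" using r n1 by (auto simp: r'_def)
  have ev: "eval_fps (F * G) X = eval_fps 1 X" if X: "X \<in> ball 0 r'" for X
  proof -
    have Xr: "norm X < r" "norm X < 1 / (norm c + 1)" using X by (auto simp: r'_def)
    have XF: "ereal (norm X) < fps_conv_radius F" using Xr rad by (meson ereal_less_eq(3) less_ereal.simps(1) less_le_trans)
    have e1: "eval_fps (F * G) X = eval_fps F X * eval_fps G X"
      by (rule eval_fps_mult[OF XF]) (simp add: radG)
    have e2: "eval_fps G X = 1 - c * X"
      unfolding G_def by (subst eval_fps_diff) (simp_all add: radG eval_fps_mult)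
    have e3: "eval_fps F X = 1 / (1 - c * X)"
    proof (cases "X = 0")
      case True
      thus ?thesis by (simp add: eval_fps_at_0 F_def q0)
    next
      case False
      thus ?thesis using eq[OF False Xr(1)] by (simp add: eval_fps_def F_def)
    qed
    have "norm (c * X) \<le> norm c * (1 / (norm c + 1))"
      unfolding norm_mult using Xr by (intro mult_left_mono) auto
    also have "\<dots> < 1" using n1 by (simp add: field_simps)
    finally have "1 - c * X \<noteq> 0" by auto
    thus ?thesis using e1 e2 e3 by simp
  qed
  have "F * G = 1"
  proof (rule eval_fps_eqD)
    have "fps_conv_radius (F * G) \<ge> ereal r"
      using fps_conv_radius_mult[of F G] rad radG by (simp add: min_def split: if_splits)
    thus "fps_conv_radius (F * G) > 0" using r by (meson ereal_less(2) less_le_trans)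
    have "\<forall>\<^sub>F X in nhds 0. X \<in> ball 0 r'" using r' by (intro eventually_nhds_in_open) auto
    thus "\<forall>\<^sub>F X in nhds 0. eval_fps (F * G) X = eval_fps 1 X" by eventually_elim (rule ev)
  qed auto
  hence FG: "F = 1 + fps_const c * fps_X * F" by (simp add: G_def algebra_simps)
  show ?thesis
  proof (induction m)
    case (Suc m)
    have "q (Suc m) = fps_nth (1 + fps_const c * fps_X * F) (Suc m)"
      using FG by (metis F_def fps_nth_Abs_fps)
    also have "\<dots> = c * q m" by (simp add: F_def mult.assoc)
    finally show ?case using Suc by simp
  qed (simp add: q0)
qed

lemma selberg_class_abs_conv:
  assumes "selberg_class a"
  shows "abs_conv_beyond a 1"
  using assms unfolding selberg_class_def by (intro abs_conv_beyondI) auto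

text \<open>The exponent theta < 1/2 gives absolute convergence of the logarithm beyond 1 + theta <
  3/2, while the exponential identity is available for Re s > 1. Letting s tend to infinity along
  the reals, and using that 1 is no prime power, gives a 1 = exp (b 1) = 1.\<close>

lemma selberg_class_log:
  assumes "selberg_class a"
  obtains b where "abs_conv_beyond b (3/2)" "b 1 = 0" "\<And>n. b n \<noteq> 0 \<Longrightarrow> primepow n"
    "\<And>s. Re s > 1 \<Longrightarrow> exp (dirichlet_series b s) = dirichlet_series a s" "a 1 = 1"
proof -
  have "\<exists>b \<theta>. \<theta> < 1/2 \<and>
        (\<forall>n. b n \<noteq> 0 \<longrightarrow> (\<exists>p k. prime p \<and> k \<ge> 1 \<and> n = p ^ k)) \<and>
        (\<exists>C. \<forall>n\<ge>1. norm (b n) \<le> C * real n powr \<theta>) \<and>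
        (\<forall>s. 1 < Re s \<longrightarrow> summable (\<lambda>n. b (Suc n) / of_nat (Suc n) powr s) \<and>
              exp (dirichlet_series b s) = dirichlet_series a s)"
    using assms unfolding selberg_class_def by (elim conjE)
  then obtain b \<theta> where b: "\<theta> < 1/2" "\<And>n. b n \<noteq> 0 \<Longrightarrow> \<exists>p k. prime p \<and> k \<ge> 1 \<and> n = p ^ k"
    "\<exists>C. \<forall>n\<ge>1. norm (b n) \<le> C * real n powr \<theta>"
    "\<And>s. Re s > 1 \<Longrightarrow> exp (dirichlet_series b s) = dirichlet_series a s"
    by blast
  from b(3) obtain C where C: "\<And>n. n \<ge> 1 \<Longrightarrow> norm (b n) \<le> C * real n powr \<theta>" by blast
  have pp: "primepow n" if "b n \<noteq> 0" for n
    using b(2)[OF that] unfolding primepow_def by (auto simp: Suc_le_eq)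
  have db: "abs_conv_beyond b (3/2)" by (rule abs_conv_beyond_mono[OF abs_conv_beyond_of_bound[OF C]]) (use b(1) in auto)
  have b1: "b 1 = 0" using pp[of 1] by (auto dest: primepow_gt_Suc_0)
  have "((\<lambda>x::real. exp (dirichlet_series b (of_real x))) \<longlongrightarrow> exp (b 1)) at_top"
    by (intro tendsto_exp dirichlet_series_limit_1[OF db])
  moreover have "\<forall>\<^sub>F x::real in at_top. exp (dirichlet_series b (of_real x)) = dirichlet_series a (of_real x)"
    by (rule eventually_mono[OF eventually_gt_at_top[of 1]]) (use b(4) in auto)
  ultimately have "((\<lambda>x::real. dirichlet_series a (of_real x)) \<longlongrightarrow> exp (b 1)) at_top"
    by (rule Lim_transform_eventually)
  hence "a 1 = exp (b 1)"
    using dirichlet_series_limit_1[OF selberg_class_abs_conv[OF assms]] tendsto_unique trivial_limit_at_top_linorder by blast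
  thus thesis using that[OF db b1 pp b(4)] b1 by simp
qed

text \<open>Taking logarithmic derivatives in \<open>L = exp B\<close> and comparing coefficients.\<close>

lemma log_coeff_convolution:
  assumes a: "abs_conv_beyond a \<sigma>0" and b: "abs_conv_beyond b \<sigma>0"
    and exp: "\<And>s. Re s > \<sigma>0 \<Longrightarrow> exp (dirichlet_series b s) = dirichlet_series a s"
    and n: "n \<ge> 1"
  shows "of_real (ln (real n)) * a n = dirichlet_conv (\<lambda>n. of_real (ln (real n)) * b n) a n"
proof -
  let ?a' = "\<lambda>n. - of_real (ln (real n)) * a n" and ?b' = "\<lambda>n. - of_real (ln (real n)) * b n"
  define c where "c = (\<lambda>n. ?a' n + (- 1) * dirichlet_conv ?b' a n)"
  have d: "abs_conv_beyond ?a' \<sigma>0" "abs_conv_beyond (dirichlet_conv ?b' a) \<sigma>0"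
    by (intro abs_conv_beyond_ln a dirichlet_series_mult(1) b)+
  have eq: "dirichlet_series ?a' s = dirichlet_series (dirichlet_conv ?b' a) s" if s: "Re s > \<sigma>0" for s
  proof -
    have "((\<lambda>s. exp (dirichlet_series b s)) has_field_derivative
        exp (dirichlet_series b s) * dirichlet_series ?b' s) (at s)"
      by (rule DERIV_fun_exp[OF dirichlet_series_has_field_derivative[OF b s]])
    hence "(dirichlet_series a has_field_derivative
        exp (dirichlet_series b s) * dirichlet_series ?b' s) (at s)"
      by (rule has_field_derivative_transform_within_open[OF _ open_halfspace_Re_gt[of \<sigma>0]])
         (use s exp in auto)
    hence "dirichlet_series ?a' s = dirichlet_series a s * dirichlet_series ?b' s"
      using DERIV_unique[OF dirichlet_series_has_field_derivative[OF a s]] exp[OF s] by simp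
    thus ?thesis using dirichlet_series_mult(2)[OF abs_conv_beyond_ln[OF b] a s] by (simp add: mult.commute)
  qed
  have "abs_conv_beyond c \<sigma>0 \<and> (\<forall>s. Re s > \<sigma>0 \<longrightarrow> dirichlet_series c s = 0)"
  proof -
    have "summable (\<lambda>n. norm (c (Suc n) / of_nat (Suc n) powr s)) \<and> dirichlet_series c s = 0"
      if s: "Re s > \<sigma>0" for s
    proof -
      let ?f = "\<lambda>n. ?a' (Suc n) / of_nat (Suc n) powr s" and ?g = "\<lambda>n. dirichlet_conv ?b' a (Suc n) / of_nat (Suc n) powr s"
      have sm: "summable (\<lambda>n. norm (?f n))" "summable (\<lambda>n. norm (?g n))"
        by (rule abs_conv_beyond_summable[OF d(1) s], rule abs_conv_beyond_summable[OF d(2) s])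
      have fg: "c (Suc n) / of_nat (Suc n) powr s = ?f n - ?g n" for n
        unfolding c_def by (simp only: add_divide_distrib) simp
      have "summable (\<lambda>n. norm (?f n - ?g n))"
        by (rule summable_comparison_test'[OF summable_add[OF sm], of 0])
           (simp only: norm_ge_zero real_norm_def abs_of_nonneg, rule norm_triangle_ineq4)
      moreover have "(\<Sum>n. ?f n - ?g n) = dirichlet_series ?a' s - dirichlet_series (dirichlet_conv ?b' a) s"
        unfolding dirichlet_series_def
        by (rule suminf_diff[symmetric, OF summable_norm_cancel[OF sm(1)] summable_norm_cancel[OF sm(2)]])
      ultimately show ?thesis unfolding dirichlet_series_def fg using eq[OF s] by (simp add: dirichlet_series_def)
    qed
    thus ?thesis by (auto intro: abs_conv_beyondI)
  qed
  hence "c n = 0" using dirichlet_series_eq_0_imp n by blast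
  hence "?a' n = dirichlet_conv ?b' a n" by (simp add: c_def)
  moreover have "dirichlet_conv ?b' a n = - dirichlet_conv (\<lambda>n. of_real (ln (real n)) * b n) a n"
    by (simp add: dirichlet_conv_def sum_negf)
  ultimately show ?thesis by simp
qed

text \<open>Here rank one enters: it forces a (p^m) = c^m. The convolution identity at prime powers
  then gives j b (p^j) = c^j, so b (p^k) ln (p^k) = (ln p) c^k, which is the von Mangoldt weight
  times a.\<close>

theorem rank_one_log_coeffs:
  assumes a: "selberg_class a" and er: "euler_rank a 1"
    and b: "abs_conv_beyond b (3/2)" "b 1 = 0" "\<And>n. b n \<noteq> 0 \<Longrightarrow> primepow n"
    "\<And>s. Re s > 1 \<Longrightarrow> exp (dirichlet_series b s) = dirichlet_series a s" "a 1 = 1"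
    and n: "n \<ge> 1"
  shows "b n * of_real (ln (real n)) = mangoldt n * a n"
proof (cases "primepow n")
  case False
  thus ?thesis using b(3)[of n] by (auto simp: mangoldt_def)
next
  case True
  then obtain p k where p: "prime p" "k > 0" "n = p ^ k" by (auto simp: primepow_def)
  have p1: "p > 1" using p(1) by (rule prime_gt_1_nat)
  hence lp: "ln (real p) > 0" by simp
  have da: "abs_conv_beyond a 1" by (rule selberg_class_abs_conv[OF a])
  obtain c where c: "\<And>s. 1 < Re s \<Longrightarrow> (\<Sum>m. a (p ^ m) * (of_nat p powr (- s)) ^ m) = 1 / (1 - c * of_nat p powr (- s))"
  proof -
    from er obtain c where "\<forall>p. prime p \<longrightarrow> (\<forall>s. 1 < Re s \<longrightarrow>
        (\<Sum>m. a (p ^ m) * (of_nat p powr (- s)) ^ m) =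
          1 / (1 - (\<Sum>l=1..1. c p l * (of_nat p powr (- s)) ^ l)))"
      unfolding euler_rank_def by blast
    thus thesis using p(1) that[of "c p 1"] by simp
  qed
  \<comment> \<open>The radius 1/p^2 is the one secured by absolute convergence at s = 2. Any
    nonzero X below it is p^-s for s = - Ln X / ln p, which lies in Re s > 1.\<close>
  have geo: "a (p ^ m) = c ^ m" for m
  proof (rule geometric_coeffs[where r = "1 / real p ^ 2"])
    show "a (p ^ 0) = 1" using b(5) by simp
    show "1 / real p ^ 2 > 0" using p1 by simp
    have "(\<lambda>n. norm (a n / of_nat n powr 2)) summable_on {1..}"
      by (rule dirichlet_series_has_sum(1)[OF da]) simp
    hence "(\<lambda>n. norm (a n / of_nat n powr 2)) summable_on range (\<lambda>m. p ^ m)"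
      by (rule summable_on_subset_banach) (use p1 in auto)
    hence "((\<lambda>n. norm (a n / of_nat n powr 2)) \<circ> (\<lambda>m. p ^ m)) summable_on UNIV"
      by (subst (asm) summable_on_reindex) (use p1 in \<open>auto simp: inj_on_def\<close>)
    hence "summable (\<lambda>m. norm (a (p ^ m) / of_nat (p ^ m) powr 2))"
      unfolding o_def by (rule summable_on_imp_summable)
    moreover have "norm (a (p ^ m) / of_nat (p ^ m) powr 2) = norm (a (p ^ m)) * (1 / real p ^ 2) ^ m" for m
    proof -
      have "complex_of_nat (p ^ m) powr 2 = of_nat (p ^ m) ^ 2"
        using powr_nat'[of "of_nat (p ^ m)" 2] p1 by simp
      thus ?thesis by (simp add: norm_divide norm_power power_divide power_mult[symmetric] mult.commute)
    qed
    ultimately show "summable (\<lambda>m. norm (a (p ^ m)) * (1 / real p ^ 2) ^ m)" by simp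
    fix X :: complex assume X: "X \<noteq> 0" "norm X < 1 / real p ^ 2"
    define s where "s = - Ln X / of_real (ln (real p))"
    have Xs: "of_nat p powr (- s) = X"
      using X p1 lp Ln_of_real[of "real p"] by (simp add: s_def powr_def)
    have "ln (norm X) < ln (1 / real p ^ 2)" using X p1 by (subst ln_less_cancel_iff) auto
    also have "\<dots> = - 2 * ln (real p)" using p1 by (simp add: ln_div ln_realpow)
    finally have "Re s > 1" using lp X
      by (simp add: s_def field_simps)
    from c[OF this] show "(\<Sum>m. a (p ^ m) * X ^ m) = 1 / (1 - c * X)" by (simp add: Xs)
  qed
  have conv: "of_real (ln (real (p ^ m))) * a (p ^ m) = (\<Sum>i\<le>m. (of_real (ln (real (p ^ i))) * b (p ^ i)) * a (p ^ (m - i)))" for m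
  proof -
    have "of_real (ln (real (p ^ m))) * a (p ^ m) = dirichlet_conv (\<lambda>n. of_real (ln (real n)) * b n) a (p ^ m)"
      by (rule log_coeff_convolution[OF abs_conv_beyond_mono[OF da] b(1)]) (use b(4) p1 in auto)
    also have "\<dots> = (\<Sum>i\<le>m. (of_real (ln (real (p ^ i))) * b (p ^ i)) * a (p ^ (m - i)))"
      by (rule dirichlet_conv_prime_power[OF p(1)])
    finally show ?thesis .
  qed
  \<comment> \<open>By strong induction the terms 1 <= i < j of the convolution are each c^j, in
    total (j - 1) c^j out of j c^j; what remains for i = j is c^j.\<close>
  have bj: "of_nat j * b (p ^ j) = c ^ j" if "j \<ge> 1" for j
    using that
  proof (induction j rule: less_induct)
    case (less j)
    have "of_real (ln (real p)) * (of_nat j * c ^ j) = of_real (ln (real p)) * (\<Sum>i\<le>j. of_nat i * b (p ^ i) * c ^ (j - i))"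
      using conv[of j] p1 by (simp add: geo ln_realpow sum_distrib_left mult_ac)
    hence "of_nat j * c ^ j = (\<Sum>i\<le>j. of_nat i * b (p ^ i) * c ^ (j - i))" using lp by simp
    also have "\<dots> = (\<Sum>i\<in>{1..<j}. of_nat i * b (p ^ i) * c ^ (j - i)) + of_nat j * b (p ^ j)"
    proof -
      have "{..j} = insert 0 (insert j {1..<j})" using less.prems by auto
      thus ?thesis using less.prems by (simp add: add.commute)
    qed
    also have "(\<Sum>i\<in>{1..<j}. of_nat i * b (p ^ i) * c ^ (j - i)) = (\<Sum>i\<in>{1..<j}. c ^ j)"
      by (intro sum.cong refl) (use less.IH in \<open>simp add: power_add[symmetric]\<close>)
    also have "\<dots> = of_nat (j - 1) * c ^ j" by simp
    finally show ?case using less.prems by (simp add: of_nat_diff algebra_simps)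
  qed
  have "b n * of_real (ln (real n)) = of_real (ln (real p)) * (of_nat k * b (p ^ k))"
    using p p1 by (simp add: ln_realpow mult_ac)
  also have "\<dots> = of_real (ln (real p)) * a n" using bj[of k] p geo by simp
  finally show ?thesis using p by simp
qed

text \<open>The divisor sum of the von Mangoldt function is ln, so Z' = Z B' for Z the zeta series
  and B the candidate logarithm. Hence Z exp(-B) is constant on the half plane, and its limit at
  infinity is 1. At n = 1 the quotient 0 / 0 is 0, as it should be.\<close>

lemma zeta_log:
  defines "b \<equiv> (\<lambda>n. mangoldt n / complex_of_real (ln (real n)))"
  shows "\<And>n. b n \<noteq> 0 \<Longrightarrow> \<exists>p k. prime p \<and> k \<ge> 1 \<and> n = p ^ k"
    and "\<And>n. n \<ge> 1 \<Longrightarrow> norm (b n) \<le> 1 * real n powr 0"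
    and "abs_conv_beyond b 1" and "abs_conv_beyond (\<lambda>_. 1) 1"
    and "\<And>s. 1 < Re s \<Longrightarrow> exp (dirichlet_series b s) = dirichlet_series (\<lambda>_. 1) s"
proof -
  show "\<exists>p k. prime p \<and> k \<ge> 1 \<and> n = p ^ k" if "b n \<noteq> 0" for n
    using that by (auto simp: b_def mangoldt_def primepow_def Suc_le_eq split: if_splits)
  show bd: "norm (b n) \<le> 1 * real n powr 0" if n: "n \<ge> 1" for n
  proof (cases "n = 1")
    case False
    hence "ln (real n) > 0" using n by simp
    thus ?thesis using mangoldt_le[of n] n by (simp add: b_def norm_divide)
  qed (simp add: b_def)
  show db: "abs_conv_beyond b 1" using abs_conv_beyond_of_bound[OF bd] by simp
  show d1: "abs_conv_beyond (\<lambda>_. 1) 1" using abs_conv_beyond_of_bound[of "\<lambda>_. 1" 1 0] by simp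
  let ?b' = "\<lambda>n. - of_real (ln (real n)) * b n"
  let ?Z = "dirichlet_series (\<lambda>_. 1)" and ?B = "dirichlet_series b"
  have co: "dirichlet_conv ?b' (\<lambda>_. 1) n = - of_real (ln (real n)) * 1" if n: "n \<ge> 1" for n
  proof -
    have "?b' d = - mangoldt d" for d
      by (cases "d = 0 \<or> d = 1") (auto simp: b_def)
    hence "dirichlet_conv ?b' (\<lambda>_. 1) n = - (\<Sum>d | d dvd n. mangoldt d)" by (simp add: dirichlet_conv_def sum_negf)
    thus ?thesis using mangoldt_sum[of n, where 'a = complex] n by simp
  qed
  have Z': "dirichlet_series (\<lambda>n. - of_real (ln (real n)) * 1) s = ?Z s * dirichlet_series ?b' s" if s: "1 < Re s" for s
  proof -
    have "dirichlet_series (\<lambda>n. - of_real (ln (real n)) * 1) s = dirichlet_series (dirichlet_conv ?b' (\<lambda>_. 1)) s"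
      unfolding dirichlet_series_def by (rule suminf_cong, subst co) simp_all
    thus ?thesis using dirichlet_series_mult(2)[OF abs_conv_beyond_ln[OF db] d1 s] by (simp add: mult.commute)
  qed
  define h where "h = (\<lambda>s. ?Z s * exp (- ?B s))"
  have "\<exists>c. \<forall>s\<in>{s. Re s > 1}. h s = c"
  proof (rule has_field_derivative_zero_constant)
    show "convex {s::complex. Re s > 1}" by (rule convex_halfspace_Re_gt)
    fix s :: complex assume "s \<in> {s. Re s > 1}"
    hence s: "1 < Re s" by simp
    have "(h has_field_derivative dirichlet_series (\<lambda>n. - of_real (ln (real n)) * 1) s * exp (- ?B s) +
        (exp (- ?B s) * (- dirichlet_series ?b' s)) * ?Z s) (at s)"
      unfolding h_def
      by (intro DERIV_mult DERIV_fun_exp DERIV_minus dirichlet_series_has_field_derivative[OF d1 s]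
            dirichlet_series_has_field_derivative[OF db s])
    thus "(h has_field_derivative 0) (at s within {s. Re s > 1})"
      unfolding Z'[OF s] by (simp add: mult_ac has_field_derivative_at_within)
  qed
  then obtain c where c: "\<And>s. Re s > 1 \<Longrightarrow> h s = c" by auto
  have "((\<lambda>x::real. h (of_real x)) \<longlongrightarrow> 1 * exp (- b 1)) at_top"
    unfolding h_def by (intro tendsto_mult tendsto_exp tendsto_minus dirichlet_series_limit_1[OF db] dirichlet_series_limit_1[OF d1])
  moreover have "((\<lambda>x::real. h (of_real x)) \<longlongrightarrow> c) at_top"
    by (rule tendsto_eventually, rule eventually_mono[OF eventually_gt_at_top[of 1]]) (use c in auto)
  ultimately have "c = 1 * exp (- b 1)" using tendsto_unique trivial_limit_at_top_linorder by blast
  hence c1: "c = 1" by (simp add: b_def)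
  show "exp (?B s) = ?Z s" if s: "1 < Re s" for s
    using c[OF s] unfolding h_def c1 by (simp add: exp_minus field_simps)
qed

section \<open>The theta function and the continuation of zeta\<close>

lemma integral_series_uniform:
  fixes f :: "nat \<Rightarrow> real \<Rightarrow> real"
  assumes cont: "\<And>n. continuous_on {a..b} (f n)" and M: "summable M"
    and bd: "\<And>n x. x \<in> {a..b} \<Longrightarrow> norm (f n x) \<le> M n"
  shows "continuous_on {a..b} (\<lambda>x. \<Sum>n. f n x)"
    and "(\<lambda>n. integral {a..b} (f n)) sums integral {a..b} (\<lambda>x. \<Sum>n. f n x)"
proof -
  have u: "uniform_limit {a..b} (\<lambda>n x. \<Sum>i<n. f i x) (\<lambda>x. \<Sum>i. f i x) sequentially"
    by (rule Weierstrass_m_test[OF bd M])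
  have c: "continuous_on {a..b} (\<lambda>x. \<Sum>i<n. f i x)" for n by (intro continuous_intros cont)
  show "continuous_on {a..b} (\<lambda>x. \<Sum>n. f n x)"
    by (rule uniform_limit_theorem[OF _ u]) (use c in auto)
  obtain I J where IJ: "\<And>n. ((\<lambda>x. \<Sum>i<n. f i x) has_integral I n) {a..b}"
    "((\<lambda>x. \<Sum>i. f i x) has_integral J) {a..b}" "I \<longlonglongrightarrow> J"
    using uniform_limit_integral[OF u c sequentially_bot] by blast
  have "I n = (\<Sum>i<n. integral {a..b} (f i))" for n
  proof -
    have "((\<lambda>x. \<Sum>i<n. f i x) has_integral (\<Sum>i<n. integral {a..b} (f i))) {a..b}"
      by (intro has_integral_sum integrable_integral integrable_continuous_real cont) auto
    thus ?thesis using IJ(1)[of n] has_integral_unique by blast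
  qed
  hence "I = (\<lambda>n. \<Sum>i<n. integral {a..b} (f i))" by (rule ext)
  thus "(\<lambda>n. integral {a..b} (f n)) sums integral {a..b} (\<lambda>x. \<Sum>n. f n x)"
    using IJ(2,3) unfolding sums_def by (simp add: integral_unique)
qed

definition poisson_kernel :: "real \<Rightarrow> real \<Rightarrow> real" where
  "poisson_kernel r x = 1 + 2 * (\<Sum>k. r ^ Suc k * cos (2 * pi * real (Suc k) * x))"

text \<open>The kernel is the real part of (1 + z)/(1 - z) at z = r e^(2 pi i x). The denominator |1
  - z|^2 is written so that positivity, and a lower bound for x away from the integers, can be read
  off.\<close>

lemma poisson_kernel_eq:
  assumes r: "0 \<le> r" "r < 1"
  shows "poisson_kernel r x = (1 - r\<^sup>2) / ((1 - r)\<^sup>2 + 2 * r * (1 - cos (2 * pi * x)))"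
proof -
  define z where "z = of_real r * cis (2 * pi * x)"
  have nz: "norm z < 1" using r by (simp add: z_def norm_mult)
  have ne: "1 - z \<noteq> 0" using nz by auto
  have pw: "Re (z ^ k) = r ^ k * cos (2 * pi * real k * x)" for k
  proof -
    have "z ^ k = of_real (r ^ k) * cis (real k * (2 * pi * x))"
      by (simp only: z_def power_mult_distrib Complex.DeMoivre of_real_power)
    thus ?thesis by (simp add: mult_ac)
  qed
  have "(\<lambda>k. z ^ Suc k) sums (z * (1 / (1 - z)))"
    unfolding power_Suc by (intro sums_mult geometric_sums nz)
  from sums_Re[OF this] have "(\<lambda>k. Re (z ^ Suc k)) sums Re (z / (1 - z))" by (simp del: power_Suc)
  hence "(\<Sum>k. r ^ Suc k * cos (2 * pi * real (Suc k) * x)) = Re (z / (1 - z))"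
    unfolding pw by (rule sums_unique[symmetric])
  hence "poisson_kernel r x = 1 + 2 * Re (z / (1 - z))" by (simp only: poisson_kernel_def)
  also have "\<dots> = Re (1 + 2 * (z / (1 - z)))"
  proof -
    have "Re (1 + 2 * w) = 1 + 2 * Re w" for w by simp
    thus ?thesis by presburger
  qed
  also have "1 + 2 * (z / (1 - z)) = (1 + z) / (1 - z)" using ne by (simp add: field_simps)
  also have "(1 + z) / (1 - z) = (1 + z) * cnj (1 - z) / ((1 - z) * cnj (1 - z))"
    by (rule nonzero_mult_divide_mult_cancel_right[symmetric]) (use ne in \<open>simp only: complex_cnj_zero_iff not_False_eq_True\<close>)
  also have "(1 - z) * cnj (1 - z) = of_real ((norm (1 - z))\<^sup>2)" by (rule complex_norm_square[symmetric])
  also have "Re ((1 + z) * cnj (1 - z) / of_real ((norm (1 - z))\<^sup>2)) = Re ((1 + z) * cnj (1 - z)) / (norm (1 - z))\<^sup>2"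
    by (rule Re_divide_of_real)
  also have "Re ((1 + z) * cnj (1 - z)) = 1 - (norm z)\<^sup>2"
    by (simp add: cmod_power2) (simp add: power2_eq_square algebra_simps)
  also have "(norm z)\<^sup>2 = r\<^sup>2" using r by (simp add: z_def norm_mult)
  also have "(norm (1 - z))\<^sup>2 = (1 - r)\<^sup>2 + 2 * r * (1 - cos (2 * pi * x))"
  proof -
    have "(norm (1 - z))\<^sup>2 = (1 - r * cos (2 * pi * x))\<^sup>2 + (r * sin (2 * pi * x))\<^sup>2"
      by (simp add: cmod_power2 z_def)
    also have "\<dots> = 1 - 2 * r * cos (2 * pi * x) + r\<^sup>2 * ((cos (2 * pi * x))\<^sup>2 + (sin (2 * pi * x))\<^sup>2)"
    proof -
      have "(1 - r * C)\<^sup>2 + (r * S)\<^sup>2 = 1 - 2 * r * C + r\<^sup>2 * (C\<^sup>2 + S\<^sup>2)" for C S :: real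
        by (simp add: power2_eq_square algebra_simps)
      thus ?thesis .
    qed
    also have "\<dots> = (1 - r)\<^sup>2 + 2 * r * (1 - cos (2 * pi * x))"
      by (simp only: sin_cos_squared_add2) (simp add: power2_eq_square algebra_simps)
    finally show ?thesis .
  qed
  finally show ?thesis .
qed

lemma integral_mult_poisson_kernel:
  assumes G: "continuous_on {0..1} G" and r: "0 \<le> r" "r < 1"
  shows "integral {0..1} (\<lambda>x. G x * poisson_kernel r x) =
     integral {0..1} G + 2 * (\<Sum>k. r ^ Suc k * integral {0..1} (\<lambda>x. G x * cos (2 * pi * real (Suc k) * x)))"
    and "continuous_on {0..1} (poisson_kernel r)"
proof -
  have "bounded (G ` {0..1})" by (intro compact_imp_bounded compact_continuous_image G) auto
  then obtain B where "\<forall>x\<in>{0..1}. norm (G x) \<le> B" by (auto simp: bounded_iff)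
  hence B: "\<And>x. x \<in> {0..1} \<Longrightarrow> norm (G x) \<le> B" by blast
  have B0: "B \<ge> 0" using B[of 0] norm_ge_zero[of "G 0"] by (simp del: norm_ge_zero)
  let ?c = "\<lambda>k x. r ^ Suc k * cos (2 * pi * real (Suc k) * x)"
  have gs: "summable (\<lambda>k. r ^ Suc k)" unfolding power_Suc using r by (intro summable_mult summable_geometric) auto
  have cb: "norm (?c k x) \<le> r ^ Suc k" for k x
    using r mult_left_mono[OF abs_cos_le_one, of "r ^ Suc k" "2 * pi * real (Suc k) * x"]
    by (simp add: abs_mult del: power_Suc)
  have cc: "continuous_on {0..1} (?c k)" for k by (intro continuous_intros)
  have P: "continuous_on {0..1} (\<lambda>x. \<Sum>k. ?c k x)"
    by (rule integral_series_uniform(1)[OF cc gs cb])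
  thus cp: "continuous_on {0..1} (poisson_kernel r)"
    unfolding poisson_kernel_def by (intro continuous_intros)
  have cg: "continuous_on {0..1} (\<lambda>x. G x * ?c k x)" for k by (intro continuous_intros G)
  have bg: "norm (G x * ?c k x) \<le> B * r ^ Suc k" if "x \<in> {0..1}" for k x
    unfolding norm_mult[of "G x"] by (intro mult_mono B that cb) (use B0 in auto)
  have su: "(\<lambda>k. integral {0..1} (\<lambda>x. G x * ?c k x)) sums integral {0..1} (\<lambda>x. \<Sum>k. G x * ?c k x)"
    by (rule integral_series_uniform(2)[OF cg summable_mult[OF gs] bg])
  have sc: "summable (\<lambda>k. ?c k x)" for x
    by (rule summable_comparison_test'[OF gs, of 0]) (rule cb)
  have e1: "(\<Sum>k. G x * ?c k x) = G x * (\<Sum>k. ?c k x)" for x by (rule suminf_mult[OF sc])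
  have e2: "integral {0..1} (\<lambda>x. G x * ?c k x) = r ^ Suc k * integral {0..1} (\<lambda>x. G x * cos (2 * pi * real (Suc k) * x))" for k
    by (subst integral_mult_right[symmetric]) (simp add: mult_ac)
  have "integral {0..1} (\<lambda>x. G x * poisson_kernel r x) = integral {0..1} (\<lambda>x. G x + 2 * (G x * (\<Sum>k. ?c k x)))"
    by (simp add: poisson_kernel_def algebra_simps)
  also have "\<dots> = integral {0..1} G + integral {0..1} (\<lambda>x. 2 * (G x * (\<Sum>k. ?c k x)))"
    by (intro integral_add integrable_continuous_real continuous_intros G P)
  also have "integral {0..1} (\<lambda>x. 2 * (G x * (\<Sum>k. ?c k x))) = 2 * integral {0..1} (\<lambda>x. G x * (\<Sum>k. ?c k x))"
    by (rule integral_mult_right)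
  also have "integral {0..1} (\<lambda>x. G x * (\<Sum>k. ?c k x)) = (\<Sum>k. r ^ Suc k * integral {0..1} (\<lambda>x. G x * cos (2 * pi * real (Suc k) * x)))"
    using sums_unique[OF su] unfolding e1 e2 by simp
  finally show "integral {0..1} (\<lambda>x. G x * poisson_kernel r x) =
     integral {0..1} G + 2 * (\<Sum>k. r ^ Suc k * integral {0..1} (\<lambda>x. G x * cos (2 * pi * real (Suc k) * x)))" .
qed

lemma integral_cos_period:
  "integral {0..1} (\<lambda>x. cos (2 * pi * real (Suc k) * x)) = 0"
proof -
  let ?a = "2 * pi * real (Suc k)"
  have a: "?a \<noteq> 0" by simp
  have "((\<lambda>x. cos (?a * x)) has_integral (sin (?a * 1) / ?a - sin (?a * 0) / ?a)) {0..1}"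
  proof (rule fundamental_theorem_of_calculus)
    fix x :: real
    have "((\<lambda>x. sin (?a * x) / ?a) has_real_derivative (cos (?a * x) * ?a) / ?a) (at x within {0..1})"
      by (intro DERIV_cdivide) (auto intro!: derivative_eq_intros)
    thus "((\<lambda>x. sin (?a * x) / ?a) has_vector_derivative cos (?a * x)) (at x within {0..1})"
      using a by (simp add: has_real_derivative_iff_has_vector_derivative)
  qed simp
  moreover have "sin (?a * 1) = 0" using sin_npi[of "2 * Suc k"] by (simp add: mult_ac)
  ultimately show ?thesis by (simp add: integral_unique)
qed

lemma integral_shift_real:
  fixes f :: "real \<Rightarrow> real"
  shows "integral {a..b} (\<lambda>x. f (x + c)) = integral {a + c..b + c} f"
  using integral_shift_Icc_real[of a b f c] by (simp add: o_def add.commute)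

text \<open>Abel summation: \<open>G 0\<close> is the limit of the Poisson integrals as \<open>r\<close> tends to 1.\<close>

lemma fourier_series_at_0:
  assumes G: "continuous_on {0..1} G" and per: "G 1 = G 0"
    and c: "\<And>k. c k = integral {0..1} (\<lambda>x. G x * cos (2 * pi * real (Suc k) * x))"
    and sm: "summable (\<lambda>k. \<bar>c k\<bar>)"
  shows "G 0 = integral {0..1} G + 2 * (\<Sum>k. c k)"
proof -
  define S where "S = (\<lambda>r. integral {0..1} G + 2 * (\<Sum>k. r ^ Suc k * c k))"
  define I where "I = (\<lambda>r. integral {0..1} (\<lambda>x. G x * poisson_kernel r x))"
  have IS: "I r = S r" if "0 \<le> r" "r < 1" for r
    unfolding I_def S_def c using integral_mult_poisson_kernel(1)[OF G that] by simp
  have "continuous_on {0..1} (\<lambda>r. \<Sum>k. r ^ Suc k * c k)"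
  proof (rule integral_series_uniform(1)[OF _ sm])
    fix k :: nat and r :: real assume r: "r \<in> {0..1}"
    have "r ^ Suc k \<le> 1" using r by (intro power_le_one) auto
    thus "norm (r ^ Suc k * c k) \<le> \<bar>c k\<bar>"
      using r by (simp add: abs_mult mult_left_le_one_le del: power_Suc)
  qed (intro continuous_intros)
  hence cS: "continuous_on {0..1} S" unfolding S_def by (intro continuous_intros)
  have S1: "(S \<longlongrightarrow> S 1) (at 1 within {0..1})" using cS by (simp add: continuous_on)
  have "(\<lambda>n. 1 - inverse (real (Suc n))) \<longlonglongrightarrow> 1 - 0" by (intro tendsto_intros LIMSEQ_inverse_real_of_nat)
  hence flt: "filterlim (\<lambda>n. 1 - inverse (real (Suc n))) (at 1 within {0..1}) sequentially"
    by (auto simp: filterlim_at field_simps)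
  have "(\<lambda>n. S (1 - inverse (real (Suc n)))) \<longlonglongrightarrow> S 1" by (rule filterlim_compose[OF S1 flt])
  moreover have "(\<lambda>n. I (1 - inverse (real (Suc n)))) \<longlonglongrightarrow> G 0"
  proof (rule LIMSEQ_I)
    fix e :: real assume e: "e > 0"
    have "bounded ((\<lambda>x. G x - G 0) ` {0..1})"
      by (intro compact_imp_bounded compact_continuous_image continuous_intros G) auto
    then obtain M where "\<forall>x\<in>{0..1}. \<bar>G x - G 0\<bar> \<le> M" by (auto simp: bounded_iff)
    hence M: "\<bar>G x - G 0\<bar> \<le> M" if "x \<in> {0..1}" for x using that by blast
    have M0: "M \<ge> 0" using M[of 0] by simp
    have Ge: "\<exists>d>0. \<forall>x\<in>{0..1}. dist x y < d \<longrightarrow> dist (G x) (G y) < e / 2" if "y \<in> {0..1}" for y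
      using G that half_gt_zero[OF e] unfolding continuous_on_iff by blast
    obtain d0 where d0: "d0 > 0" "\<And>x. x \<in> {0..1} \<Longrightarrow> dist x 0 < d0 \<Longrightarrow> dist (G x) (G 0) < e / 2"
      using Ge[of 0] by auto
    obtain d1 where d1: "d1 > 0" "\<And>x. x \<in> {0..1} \<Longrightarrow> dist x 1 < d1 \<Longrightarrow> dist (G x) (G 1) < e / 2"
      using Ge[of 1] by auto
    \<comment> \<open>The kernel concentrates at both ends of the period; G is close to G 0 near 0
      by continuity and near 1 because G 1 = G 0. The bound 1/4 keeps 2 pi d in the range where cos
      decreases.\<close>
    define d where "d = min (1/4) (min d0 d1)"
    have d: "0 < d" "d \<le> 1/4" "d \<le> d0" "d \<le> d1" using d0 d1 by (auto simp: d_def)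
    define q where "q = 1 - cos (2 * pi * d)"
    have q: "q > 0"
    proof -
      have "cos (2 * pi * d) < cos 0" using d pi_gt_zero by (intro cos_monotone_0_pi) (auto simp: field_simps)
      thus ?thesis by (simp add: q_def)
    qed
    have near: "\<bar>G x - G 0\<bar> \<le> e / 2" if "x \<in> {0..1}" "x < d \<or> 1 - d < x" for x
      using d0(2)[of x] d1(2)[of x] that d per by (auto simp: dist_real_def)
    have far: "1 - cos (2 * pi * x) \<ge> q" if "d \<le> x" "x \<le> 1 - d" for x
    proof (cases "x \<le> 1/2")
      case True
      have "cos (2 * pi * x) \<le> cos (2 * pi * d)"
        using True that d pi_gt_zero by (intro cos_monotone_0_pi_le) auto
      thus ?thesis by (simp add: q_def)
    next
      case False
      have "cos (2 * pi * (1 - x)) \<le> cos (2 * pi * d)"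
        using False that d pi_gt_zero by (intro cos_monotone_0_pi_le) auto
      moreover have "cos (2 * pi * (1 - x)) = cos (2 * pi * x)"
        using cos_2pi_minus[of "2 * pi * x"] by (simp add: algebra_simps)
      ultimately show ?thesis by (simp add: q_def)
    qed
    \<comment> \<open>Near the ends the nonnegative kernel of mean 1 contributes at most e/2. In the
      middle 2r >= 1 makes its denominator at least q, so it is at most (1 - r^2)/q, which tends to
      0 with r to 1.\<close>
    have key: "\<bar>I r - G 0\<bar> \<le> e / 2 + M * ((1 - r\<^sup>2) / q)" if r: "1/2 \<le> r" "r < 1" for r
    proof -
      have r0: "0 \<le> r" using r by simp
      have rr: "1 - r\<^sup>2 \<ge> 0" using r by (simp add: power_le_one)
      note PK = poisson_kernel_eq[OF r0 r(2)]
      have P0: "poisson_kernel r x \<ge> 0" for x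
        unfolding PK using rr r by (intro divide_nonneg_nonneg add_nonneg_nonneg mult_nonneg_nonneg) auto
      have cP: "continuous_on {0..1} (poisson_kernel r)" by (rule integral_mult_poisson_kernel(2)[OF G r0 r(2)])
      have P1: "integral {0..1} (poisson_kernel r) = 1"
        using integral_mult_poisson_kernel(1)[of "\<lambda>_. 1", OF _ r0 r(2)] by (simp add: integral_cos_period del: of_nat_Suc)
      have pt: "\<bar>(G x - G 0) * poisson_kernel r x\<bar> \<le> e / 2 * poisson_kernel r x + M * ((1 - r\<^sup>2) / q)"
        if x: "x \<in> {0..1}" for x
      proof (cases "x < d \<or> 1 - d < x")
        case True
        have "\<bar>G x - G 0\<bar> * poisson_kernel r x \<le> e / 2 * poisson_kernel r x"
          by (intro mult_right_mono near x True P0)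
        moreover have "M * ((1 - r\<^sup>2) / q) \<ge> 0" using M0 rr q by simp
        ultimately show ?thesis using P0[of x] by (simp add: abs_mult)
      next
        case False
        hence "q \<le> 1 - cos (2 * pi * x)" by (intro far) auto
        also have "\<dots> \<le> 2 * r * (1 - cos (2 * pi * x))"
          using r mult_right_mono[of 1 "2 * r" "1 - cos (2 * pi * x)"] by simp
        also have "\<dots> \<le> (1 - r)\<^sup>2 + 2 * r * (1 - cos (2 * pi * x))" by simp
        finally have "poisson_kernel r x \<le> (1 - r\<^sup>2) / q"
          unfolding PK using q rr by (intro divide_left_mono mult_pos_pos) auto
        hence "\<bar>G x - G 0\<bar> * poisson_kernel r x \<le> M * ((1 - r\<^sup>2) / q)"
          by (intro mult_mono M x M0 P0)
        moreover have "e / 2 * poisson_kernel r x \<ge> 0" using e P0[of x] by simp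
        ultimately show ?thesis using P0[of x] by (simp add: abs_mult)
      qed
      have "I r - G 0 = integral {0..1} (\<lambda>x. G x * poisson_kernel r x) - integral {0..1} (\<lambda>x. G 0 * poisson_kernel r x)"
        by (simp add: I_def P1)
      also have "\<dots> = integral {0..1} (\<lambda>x. (G x - G 0) * poisson_kernel r x)"
        by (subst integral_diff[symmetric]) (auto intro!: integrable_continuous_real continuous_intros G cP simp: algebra_simps)
      also have "\<bar>\<dots>\<bar> \<le> integral {0..1} (\<lambda>x. e / 2 * poisson_kernel r x + M * ((1 - r\<^sup>2) / q))"
      proof -
        have "norm (integral {0..1} (\<lambda>x. (G x - G 0) * poisson_kernel r x)) \<le>
            integral {0..1} (\<lambda>x. e / 2 * poisson_kernel r x + M * ((1 - r\<^sup>2) / q))"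
        proof (rule integral_norm_bound_integral)
          show "norm ((G x - G 0) * poisson_kernel r x) \<le> e / 2 * poisson_kernel r x + M * ((1 - r\<^sup>2) / q)"
            if "x \<in> {0..1}" for x unfolding real_norm_def by (rule pt[OF that])
        qed (intro integrable_continuous_real continuous_intros G cP)+
        thus ?thesis by (simp only: real_norm_def)
      qed
      also have "\<dots> = e / 2 + M * ((1 - r\<^sup>2) / q)"
        by (subst integral_add) (auto intro!: integrable_continuous_real continuous_intros cP simp: P1)
      finally show ?thesis .
    qed
    have "(\<lambda>n. M * ((1 - (1 - inverse (real (Suc n)))\<^sup>2) / q)) \<longlonglongrightarrow> M * ((1 - (1 - 0)\<^sup>2) / q)"
      using q by (intro tendsto_intros LIMSEQ_inverse_real_of_nat) auto
    hence "\<forall>\<^sub>F n in sequentially. M * ((1 - (1 - inverse (real (Suc n)))\<^sup>2) / q) < e / 2"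
      by (rule order_tendstoD) (use e in auto)
    then obtain N where N: "\<And>n. n \<ge> N \<Longrightarrow> M * ((1 - (1 - inverse (real (Suc n)))\<^sup>2) / q) < e / 2"
      unfolding eventually_sequentially by blast
    show "\<exists>N. \<forall>n\<ge>N. norm (I (1 - inverse (real (Suc n))) - G 0) < e"
    proof (intro exI allI impI)
      \<comment> \<open>n >= 1 puts r = 1 - 1/(n+1) into [1/2, 1), the range of
        \<open>key\<close>.\<close>
      fix n assume n: "n \<ge> max N 1"
      have "\<bar>I (1 - inverse (real (Suc n))) - G 0\<bar> \<le> e / 2 + M * ((1 - (1 - inverse (real (Suc n)))\<^sup>2) / q)"
        by (rule key) (use n in \<open>auto simp: field_simps\<close>)
      moreover have "M * ((1 - (1 - inverse (real (Suc n)))\<^sup>2) / q) < e / 2" by (rule N) (use n in simp)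
      ultimately show "norm (I (1 - inverse (real (Suc n))) - G 0) < e" unfolding real_norm_def by linarith
    qed
  qed
  moreover have "I (1 - inverse (real (Suc n))) = S (1 - inverse (real (Suc n)))" for n
    by (rule IS) (auto simp: field_simps)
  ultimately have "S 1 = G 0" using LIMSEQ_unique by simp
  thus ?thesis by (simp add: S_def)
qed

text \<open>Real part of the characteristic function of the standard normal law, rescaled by c =
  sqrt (2 pi t): then (c x)^2 / 2 = pi t x^2, and the frequency u = 2 pi k / c turns exp (- u^2 / 2)
  into exp (- pi k^2 / t).\<close>

lemma gaussian_cos_transform:
  assumes t: "t > 0"
  shows "has_bochner_integral lborel (\<lambda>x. exp (- pi * t * x\<^sup>2) * cos (2 * pi * k * x)) (exp (- pi * k\<^sup>2 / t) / sqrt t)"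
proof -
  define c where "c = sqrt (2 * pi * t)"
  have c: "c > 0" "c\<^sup>2 = 2 * pi * t" using t by (auto simp: c_def)
  define u where "u = 2 * pi * k / c"
  have uc: "u * c = 2 * pi * k" using c by (simp add: u_def)
  have u2: "u\<^sup>2 / 2 = pi * k\<^sup>2 / t" using c t by (simp add: u_def power_divide power2_eq_square field_simps)
  interpret prob_space std_normal_distribution
    unfolding real_distribution_def by (rule prob_space_normal_density) simp
  have int1: "integrable std_normal_distribution (\<lambda>x. cos (u * x))"
    by (rule integrable_const_bound[of _ 1]) auto
  have "Re (char std_normal_distribution u) = (\<integral>x. Re (iexp (u * x)) \<partial>std_normal_distribution)"
    unfolding char_def
    by (subst integral_Re[symmetric]) (auto intro!: integrable_const_bound[of _ 1])
  also have "\<dots> = (\<integral>x. cos (u * x) \<partial>std_normal_distribution)" by (simp add: Re_exp)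
  finally have "(\<integral>x. cos (u * x) \<partial>std_normal_distribution) = exp (- (u\<^sup>2) / 2)"
    unfolding char_std_normal_distribution by simp
  hence hb: "has_bochner_integral lborel (\<lambda>x. std_normal_density x * cos (u * x)) (exp (- (u\<^sup>2) / 2))"
    using int1 by (subst (asm) integral_density) (auto simp: has_bochner_integral_iff integrable_density)
  have "has_bochner_integral lborel (\<lambda>x. std_normal_density (0 + c * x) * cos (u * (0 + c * x))) (exp (- (u\<^sup>2) / 2) /\<^sub>R \<bar>c\<bar>)"
    using hb c by (subst (asm) lborel_has_bochner_integral_real_affine_iff[of c _ _ 0]) auto
  hence "has_bochner_integral lborel (\<lambda>x. sqrt (2 * pi) * (std_normal_density (0 + c * x) * cos (u * (0 + c * x))))
      (sqrt (2 * pi) * (exp (- (u\<^sup>2) / 2) /\<^sub>R \<bar>c\<bar>))"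
    by (rule has_bochner_integral_mult_right) 
  moreover have "sqrt (2 * pi) * (std_normal_density (0 + c * x) * cos (u * (0 + c * x))) =
      exp (- pi * t * x\<^sup>2) * cos (2 * pi * k * x)" for x
    using c uc by (simp add: std_normal_density_def power_mult_distrib mult.assoc[symmetric])
  moreover have "sqrt (2 * pi) * (exp (- (u\<^sup>2) / 2) /\<^sub>R \<bar>c\<bar>) = exp (- pi * k\<^sup>2 / t) / sqrt t"
    using u2 t by (simp add: c_def real_sqrt_mult field_simps)
  ultimately show ?thesis by simp
qed

text \<open>Jacobi's theta series over all integers is 1 + 2 \<open>omega\<close>.\<close>

definition omega :: "real \<Rightarrow> real" where
  "omega t = (\<Sum>n. exp (- pi * t * (real (Suc n))\<^sup>2))"

lemma summable_exp_square:
  assumes "c > 0"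
  shows "summable (\<lambda>n. exp (- c * (real n)\<^sup>2))"
proof (rule summable_comparison_test'[where N = 0])
  show "summable (\<lambda>n. exp (- c) ^ n)" using assms by (intro summable_geometric) auto
  fix n :: nat
  have "real n \<le> (real n)\<^sup>2" by (simp add: power2_eq_square le_square flip: of_nat_mult)
  hence "c * real n \<le> c * (real n)\<^sup>2" using assms by (intro mult_left_mono) auto
  hence "exp (- c * (real n)\<^sup>2) \<le> exp (real n * - c)" by (simp add: mult.commute)
  thus "norm (exp (- c * (real n)\<^sup>2)) \<le> exp (- c) ^ n" unfolding exp_of_nat_mult by simp
qed

text \<open>The Gaussian is made periodic. Unfolding shows that the cosine coefficients of the
  periodization \<open>G\<close> are values of the Gaussian's own transform, and the Fourier series
  of \<open>G\<close> at 0 compares the theta series at t and at 1/t.\<close>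

theorem omega_functional_equation:
  assumes t: "t > 0"
  shows "1 + 2 * omega (1 / t) = sqrt t * (1 + 2 * omega t)"
proof -
  define f where "f = (\<lambda>x. exp (- pi * t * x\<^sup>2))"
  have pt: "pi * t > 0" using t by simp
  define M where "M = (\<lambda>n. exp (- (pi * t) * (real n)\<^sup>2))"
  have sM: "summable M" unfolding M_def by (rule summable_exp_square[OF pt])
  have fb: "f x \<le> M n" if "\<bar>x\<bar> \<ge> real n" for x n
  proof -
    have "(real n)\<^sup>2 \<le> x\<^sup>2" using that by (metis abs_of_nat abs_le_square_iff)
    thus ?thesis using pt t by (simp add: f_def M_def)
  qed
  \<comment> \<open>Pairing the shifts n and -(n+1) lets an index in nat run once through all
    integers. For x in [0,1] both arguments have absolute value at least n, hence the bound 2 M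
    n.\<close>
  define g where "g = (\<lambda>n x. f (x + real n) + f (x - 1 - real n))"
  define G where "G = (\<lambda>x. \<Sum>n. g n x)"
  have gb: "norm (g n x) \<le> 2 * M n" if "x \<in> {0..1}" for n x
    using fb[of n "x + real n"] fb[of n "x - 1 - real n"] that by (simp add: g_def f_def)
  have gc: "continuous_on {0..1} (g n)" for n unfolding g_def f_def by (intro continuous_intros)
  have sM2: "summable (\<lambda>n. 2 * M n)" by (intro summable_mult sM)
  have Gc: "continuous_on {0..1} G" unfolding G_def by (rule integral_series_uniform(1)[OF gc sM2 gb])
  have coeff: "integral {0..1} (\<lambda>x. G x * cos (2 * pi * real k * x)) = exp (- pi * (real k)\<^sup>2 / t) / sqrt t" for k
  proof -
    define F where "F = (\<lambda>x. f x * cos (2 * pi * real k * x))"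
    have Fc: "continuous_on A F" for A unfolding F_def f_def by (intro continuous_intros)
    have hb: "has_bochner_integral lborel F (exp (- pi * (real k)\<^sup>2 / t) / sqrt t)"
      unfolding F_def f_def by (rule gaussian_cos_transform[OF t])
    have cosb: "norm (g n x * cos (2 * pi * real k * x)) \<le> 2 * M n" if "x \<in> {0..1}" for n x
      using mult_mono[OF gb[OF that, of n] abs_cos_le_one[of "2 * pi * real k * x"]] sM by (simp add: abs_mult M_def)
    have su: "(\<lambda>n. integral {0..1} (\<lambda>x. g n x * cos (2 * pi * real k * x))) sums
        integral {0..1} (\<lambda>x. \<Sum>n. g n x * cos (2 * pi * real k * x))"
      by (rule integral_series_uniform(2)[OF _ sM2 cosb]) (intro continuous_intros gc)
    have sg: "summable (\<lambda>n. g n x)" if "x \<in> {0..1}" for x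
      by (rule summable_comparison_test'[OF sM2, of 0]) (rule gb[OF that])
    have "integral {0..1} (\<lambda>x. \<Sum>n. g n x * cos (2 * pi * real k * x)) = integral {0..1} (\<lambda>x. G x * cos (2 * pi * real k * x))"
      by (rule integral_cong) (simp add: G_def suminf_mult2[OF sg])
    with su have su': "(\<lambda>n. integral {0..1} (\<lambda>x. g n x * cos (2 * pi * real k * x))) sums
        integral {0..1} (\<lambda>x. G x * cos (2 * pi * real k * x))" by simp
    \<comment> \<open>By periodicity of the cosine the n-th term is the integral over [n, n+1] and
      [-(n+1), -n], so that partial sums are integrals over [-N, N].\<close>
    have piece: "integral {0..1} (\<lambda>x. g n x * cos (2 * pi * real k * x)) =
        integral {real n..real (Suc n)} F + integral {- real (Suc n)..- real n} F" for n
    proof -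
      have per1: "cos (2 * pi * real k * (x + real n)) = cos (2 * pi * real k * x)" for x
      proof -
        have "2 * pi * real k * (x + real n) = 2 * pi * real k * x + 2 * real (k * n) * pi"
          by (simp add: algebra_simps)
        thus ?thesis by (simp only: cos_add cos_2npi sin_2npi; simp)
      qed
      have per2: "cos (2 * pi * real k * (x - 1 - real n)) = cos (2 * pi * real k * x)" for x
      proof -
        have "2 * pi * real k * (x - 1 - real n) = 2 * pi * real k * x - 2 * real (k * Suc n) * pi"
          by (simp add: algebra_simps)
        thus ?thesis by (simp only: cos_diff cos_2npi sin_2npi; simp)
      qed
      have i1: "integral {0..1} (\<lambda>x. F (x + real n)) = integral {real n..real (Suc n)} F"
        using integral_shift_real[of 0 1 F "real n"] by (simp add: add.commute)
      have i2: "integral {0..1} (\<lambda>x. F (x + (- 1 - real n))) = integral {- real (Suc n)..- real n} F"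
        using integral_shift_real[of 0 1 F "- 1 - real n"] by (simp add: algebra_simps)
      have "integral {0..1} (\<lambda>x. g n x * cos (2 * pi * real k * x)) =
         integral {0..1} (\<lambda>x. F (x + real n) + F (x + (- 1 - real n)))"
      proof (rule integral_cong)
        fix x :: real
        have e: "x + (- 1 - real n) = x - 1 - real n" by simp
        show "g n x * cos (2 * pi * real k * x) = F (x + real n) + F (x + (- 1 - real n))"
          unfolding F_def e per1 per2 g_def by (rule distrib_right)
      qed
      also have "\<dots> = integral {0..1} (\<lambda>x. F (x + real n)) + integral {0..1} (\<lambda>x. F (x + (- 1 - real n)))"
        by (intro integral_add integrable_continuous_real continuous_on_compose2[OF Fc] continuous_intros) auto
      finally show ?thesis using i1 i2 by simp
    qed
    have part: "(\<Sum>n<N. integral {real n..real (Suc n)} F + integral {- real (Suc n)..- real n} F) = integral {- real N..real N} F" for N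
    proof (induction N)
      case (Suc N)
      have io: "F integrable_on {a..b}" for a b by (intro integrable_continuous_real Fc)
      have "integral {- real (Suc N)..real (Suc N)} F = integral {- real (Suc N)..- real N} F + integral {- real N..real (Suc N)} F"
        by (rule Henstock_Kurzweil_Integration.integral_combine[symmetric]) (auto intro: io)
      also have "integral {- real N..real (Suc N)} F = integral {- real N..real N} F + integral {real N..real (Suc N)} F"
        by (rule Henstock_Kurzweil_Integration.integral_combine[symmetric]) (auto intro: io)
      finally show ?case using Suc by simp
    qed simp
    have lim: "(\<lambda>N. integral {- real N..real N} F) \<longlonglongrightarrow> exp (- pi * (real k)\<^sup>2 / t) / sqrt t"
    proof -
      have iF: "integrable lborel F" using hb by (simp add: has_bochner_integral_iff)
      have "(\<lambda>N. \<integral>x. indicator {- real N..real N} x *\<^sub>R F x \<partial>lborel) \<longlonglongrightarrow> (\<integral>x. F x \<partial>lborel)"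
      proof (rule integral_dominated_convergence[where w = "\<lambda>x. norm (F x)"])
        show "AE x in lborel. (\<lambda>N. indicator {- real N..real N} x *\<^sub>R F x) \<longlonglongrightarrow> F x"
        proof (rule AE_I2, rule tendsto_eventually)
          fix x :: real
          obtain N0 :: nat where "\<bar>x\<bar> \<le> real N0" using real_arch_simple by blast
          thus "\<forall>\<^sub>F N in sequentially. indicator {- real N..real N} x *\<^sub>R F x = F x"
            by (intro eventually_sequentiallyI[of N0]) (auto simp: indicator_def)
        qed
      qed (use iF in \<open>auto simp: indicator_def\<close>)
      moreover have "(\<integral>x. indicator {- real N..real N} x *\<^sub>R F x \<partial>lborel) = integral {- real N..real N} F" for N
        using set_borel_integral_eq_integral(2)[of "{- real N..real N}" F] borel_integrable_atLeastAtMost'[OF Fc, of "- real N" "real N"]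
        by (simp add: set_lebesgue_integral_def)
      ultimately show ?thesis using hb by (simp add: has_bochner_integral_iff)
    qed
    show ?thesis using su' lim unfolding sums_def piece part using LIMSEQ_unique by blast
  qed
  have G0: "G 0 = 1 + 2 * omega t" and G1: "G 1 = G 0"
  proof -
    have f0: "(\<lambda>n. f (real n)) = M" by (auto simp: f_def M_def)
    have sf: "summable (\<lambda>n. f (real n))" using sM by (simp add: f0)
    hence sf1: "summable (\<lambda>n. f (real (Suc n)))" by (subst summable_Suc_iff)
    have fe: "f (- x) = f x" for x by (simp add: f_def)
    have g0: "g n 0 = f (real n) + f (real (Suc n))" for n
      using fe[of "real (Suc n)"] by (simp add: g_def algebra_simps)
    have g1: "g n 1 = f (real (Suc n)) + f (real n)" for n
      using fe[of "real n"] by (simp add: g_def algebra_simps)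
    show "G 1 = G 0" unfolding G_def g0 g1 by (simp add: add.commute)
    have "G 0 = (\<Sum>n. f (real n)) + (\<Sum>n. f (real (Suc n)))"
      unfolding G_def g0 by (rule suminf_add[symmetric, OF sf sf1])
    also have "(\<Sum>n. f (real n)) = (\<Sum>n. f (real (Suc n))) + f 0"
      using suminf_split_head[OF sf] by simp
    finally show "G 0 = 1 + 2 * omega t" by (simp add: omega_def f_def)
  qed
  define c where "c = (\<lambda>k. exp (- pi * (real (Suc k))\<^sup>2 / t) / sqrt t)"
  have "summable (\<lambda>n. exp (- (pi / t) * (real n)\<^sup>2))" using t by (intro summable_exp_square) simp
  hence "summable (\<lambda>n. exp (- (pi / t) * (real (Suc n))\<^sup>2))" by (subst summable_Suc_iff)
  hence se: "summable (\<lambda>n. exp (- pi * (1 / t) * (real (Suc n))\<^sup>2))" by simp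
  have ce: "c = (\<lambda>n. exp (- pi * (1 / t) * (real (Suc n))\<^sup>2) / sqrt t)" by (simp add: c_def)
  have sc: "summable (\<lambda>k. \<bar>c k\<bar>)" unfolding ce using summable_divide[OF se, of "sqrt t"] t by simp
  have "G 0 = integral {0..1} G + 2 * (\<Sum>k. c k)"
    by (rule fourier_series_at_0[OF Gc G1 _ sc]) (simp only: coeff c_def)
  also have "integral {0..1} G = 1 / sqrt t" using coeff[of 0] by simp
  also have "(\<Sum>k. c k) = omega (1 / t) / sqrt t" unfolding ce omega_def by (rule suminf_divide[OF se])
  finally have "1 + 2 * omega t = (1 + 2 * omega (1 / t)) / sqrt t" unfolding G0 using t by (simp add: field_simps)
  thus ?thesis using t by (simp add: field_simps)
qed

text \<open>From n + 1 <= (n + 1)^2 the Gaussian series is dominated by a geometric one of ratio exp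
  (- pi t) <= 1/2. The factor exp (- 2t) is kept so that exp (- t) survives after a power of t has
  been absorbed.\<close>

lemma omega_term_le:
  assumes "t \<ge> 1"
  shows "exp (- pi * t * (real (Suc n))\<^sup>2) \<le> exp (- 2 * t) * (1/2) ^ n"
proof -
  have pt: "pi * t \<ge> 2 * t" using assms pi_ge_two by (intro mult_right_mono) auto
  have "real (Suc n) \<le> (real (Suc n))\<^sup>2" by (simp add: power2_eq_square)
  hence "pi * t * real (Suc n) \<le> pi * t * (real (Suc n))\<^sup>2" using assms by (intro mult_left_mono) auto
  hence "exp (- pi * t * (real (Suc n))\<^sup>2) \<le> exp (- (pi * t) + real n * - (pi * t))"
    by (simp add: algebra_simps)
  also have "\<dots> = exp (- (pi * t)) * exp (- (pi * t)) ^ n" by (simp only: exp_add exp_of_nat_mult)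
  also have "\<dots> \<le> exp (- 2 * t) * (1/2) ^ n"
  proof (intro mult_mono power_mono)
    have "1 \<le> pi * t" using pt assms by linarith
    hence "exp (- (pi * t)) \<le> exp (- 1)" by simp
    also have "\<dots> \<le> 1/2" using exp_ge_add_one_self[of 1] by (simp add: exp_minus field_simps)
    finally show "exp (- (pi * t)) \<le> 1/2" .
  qed (use pt in auto)
  finally show ?thesis .
qed

lemma summable_omega:
  assumes "t > 0"
  shows "summable (\<lambda>n. exp (- pi * t * (real (Suc n))\<^sup>2))"
proof -
  have "summable (\<lambda>n. exp (- (pi * t) * (real n)\<^sup>2))" using assms by (intro summable_exp_square) simp
  hence "summable (\<lambda>n. exp (- (pi * t) * (real (Suc n))\<^sup>2))" by (subst summable_Suc_iff)
  thus ?thesis by simp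
qed

lemma omega_nonneg: "t > 0 \<Longrightarrow> omega t \<ge> 0"
  unfolding omega_def by (rule suminf_nonneg[OF summable_omega]) auto

lemma omega_le:
  assumes "t \<ge> 1"
  shows "omega t \<le> 2 * exp (- 2 * t)"
proof -
  have g: "summable (\<lambda>n. exp (- 2 * t) * (1/2::real) ^ n)" by (intro summable_mult summable_geometric) auto
  have "omega t \<le> (\<Sum>n. exp (- 2 * t) * (1/2) ^ n)"
    unfolding omega_def by (rule suminf_le[OF omega_term_le[OF assms] summable_omega g]) (use assms in auto)
  also have "\<dots> = exp (- 2 * t) * 2"
    by (subst suminf_mult) (auto simp: suminf_geometric)
  finally show ?thesis by simp
qed

lemma continuous_on_omega: "continuous_on {0<..} omega"
proof (subst continuous_on_eq_continuous_at, simp, intro ballI)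
  fix x :: real assume x: "x \<in> {0<..}"
  have "continuous_on {x/2..2*x} omega"
    unfolding omega_def
  proof (rule integral_series_uniform(1))
    show "summable (\<lambda>n. exp (- pi * (x/2) * (real (Suc n))\<^sup>2))" by (rule summable_omega) (use x in simp)
    fix n t assume t: "t \<in> {x/2..2*x}"
    have "pi * (x/2) * (real (Suc n))\<^sup>2 \<le> pi * t * (real (Suc n))\<^sup>2"
      using t by (intro mult_right_mono mult_left_mono) auto
    thus "norm (exp (- pi * t * (real (Suc n))\<^sup>2)) \<le> exp (- pi * (x/2) * (real (Suc n))\<^sup>2)"
      by (simp del: of_nat_Suc)
  qed (intro continuous_intros)
  moreover have "x \<in> interior {x/2..2*x}" using x by simp
  ultimately show "isCont omega x" by (rule continuous_on_interior)
qed

text \<open>Only the half line from 1 on is integrated, where \<open>omega\<close> decays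
  exponentially, so the function is entire in z. The measure is dt and not dt/t, which shifts the
  arguments in \<open>Xi\<close>; writing t^z as an exponential makes the dependence on z evidently
  holomorphic.\<close>

definition omega_mellin :: "complex \<Rightarrow> complex" where
  "omega_mellin z = integral {1..} (\<lambda>t. of_real (omega t) * exp (z * of_real (ln t)))"

text \<open>The power t^m is absorbed by m! e^t. The factorial is the price, and it is what
  determines the growth of \<open>omega_mellin\<close> in z.\<close>

lemma omega_kernel_bound:
  assumes t: "t \<ge> 1" and z: "\<bar>Re z\<bar> \<le> real m"
  shows "norm (of_real (omega t) * exp (z * of_real (ln t))) \<le> 2 * fact m * exp (- t)"
proof -
  have "norm (of_real (omega t) * exp (z * of_real (ln t))) = omega t * exp (Re z * ln t)"
    using omega_nonneg[of t] t by (simp add: norm_mult)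
  also have "exp (Re z * ln t) \<le> exp (real m * ln t)"
    using t z by (simp add: mult_right_mono)
  also have "exp (real m * ln t) = t ^ m" using t by (simp add: exp_of_nat_mult)
  also have "t ^ m \<le> fact m * exp t" using t by (intro power_le_fact_exp) auto
  also have "omega t * (fact m * exp t) \<le> 2 * exp (- 2 * t) * (fact m * exp t)"
    using omega_le[OF t] by (intro mult_right_mono) auto
  also have "\<dots> = 2 * fact m * exp (- t)" by (simp add: exp_minus field_simps flip: exp_add)
  finally show ?thesis using omega_nonneg[of t] t by (simp add: mult_left_mono)
qed

lemma continuous_on_omega_kernel:
  assumes "A \<subseteq> {0<..}"
  shows "continuous_on A (\<lambda>t. of_real (omega t) * exp (z * of_real (ln t)) :: complex)"
  by (intro continuous_intros continuous_on_subset[OF continuous_on_omega assms]) (use assms in auto)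

lemma omega_kernel_tail:
  assumes c: "c \<ge> 1" and z: "\<bar>Re z\<bar> \<le> real m"
  shows "(\<lambda>t. of_real (omega t) * exp (z * of_real (ln t))) absolutely_integrable_on {c..}"
    and "norm (integral {c..} (\<lambda>t. of_real (omega t) * exp (z * of_real (ln t)))) \<le> 2 * fact m * exp (- c)"
proof -
  have hi: "((\<lambda>t. 2 * fact m * exp (- t)) has_integral 2 * fact m * exp (- c)) {c..}"
    using has_integral_mult_right[OF has_integral_exp_minus_to_infinity[of 1 c], of "2 * fact m"] by simp
  show ai: "(\<lambda>t. of_real (omega t) * exp (z * of_real (ln t))) absolutely_integrable_on {c..}"
  proof (rule measurable_bounded_by_integrable_imp_absolutely_integrable)
    show "(\<lambda>t. of_real (omega t) * exp (z * of_real (ln t)) :: complex) \<in> borel_measurable (lebesgue_on {c..})"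
      by (intro continuous_imp_measurable_on_sets_lebesgue continuous_on_omega_kernel) (use c in auto)
    show "(\<lambda>t. 2 * fact m * exp (- t)) integrable_on {c..}" using hi by blast
    show "norm (of_real (omega t) * exp (z * of_real (ln t)) :: complex) \<le> 2 * fact m * exp (- t)" if "t \<in> {c..}" for t
      using omega_kernel_bound[OF _ z, of t] that c by auto
  qed auto
  have "norm (integral {c..} (\<lambda>t. of_real (omega t) * exp (z * of_real (ln t)))) \<le> integral {c..} (\<lambda>t. 2 * fact m * exp (- t))"
  proof (rule integral_norm_bound_integral)
    show "norm (of_real (omega t) * exp (z * of_real (ln t)) :: complex) \<le> 2 * fact m * exp (- t)" if "t \<in> {c..}" for t
      using omega_kernel_bound[OF _ z, of t] that c by auto
  qed (use ai hi set_lebesgue_integral_eq_integral(1) in blast)+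
  thus "norm (integral {c..} (\<lambda>t. of_real (omega t) * exp (z * of_real (ln t)))) \<le> 2 * fact m * exp (- c)"
    using integral_unique[OF hi] by simp
qed

lemma abs_Re_le_ceiling: "\<bar>Re z\<bar> \<le> real (nat \<lceil>norm z\<rceil>)"
  using abs_Re_le_cmod[of z] real_nat_ceiling_ge[of "norm z"] by linarith

text \<open>A locally uniform limit of integrals over [1, n+1], each holomorphic by differentiation
  under the integral. On a disc of radius 1 the real part stays below one m, so the tail bound is
  uniform there.\<close>

lemma omega_mellin_holomorphic: "omega_mellin holomorphic_on UNIV"
proof (rule holomorphic_uniform_sequence)
  let ?k = "\<lambda>z t. of_real (omega t) * exp (z * of_real (ln t)) :: complex"
  define f where "f = (\<lambda>n z. integral (cbox 1 (real (Suc n))) (?k z))"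
  show "f n holomorphic_on UNIV" for n
    unfolding f_def
  proof (rule leibniz_rule_holomorphic)
    show "((\<lambda>x. ?k x t) has_field_derivative of_real (omega t) * (exp (x * of_real (ln t)) * of_real (ln t))) (at x within UNIV)" for x t
      by (auto intro!: derivative_eq_intros)
    show "?k x integrable_on cbox 1 (real (Suc n))" for x
      by (intro integrable_continuous continuous_on_omega_kernel) auto
    have om: "continuous_on (UNIV \<times> cbox 1 (real (Suc n))) (\<lambda>p::complex \<times> real. omega (snd p))"
      by (rule continuous_on_compose2[OF continuous_on_omega]) (auto intro!: continuous_intros)
    show "continuous_on (UNIV \<times> cbox 1 (real (Suc n))) (\<lambda>(x, t). of_real (omega t) * (exp (x * of_real (ln t)) * of_real (ln t)) :: complex)"
      unfolding case_prod_unfold by (intro continuous_intros om) auto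
  qed auto
  fix z :: complex
  define m where "m = nat \<lceil>norm z + 1\<rceil>"
  have "uniform_limit (cball z 1) f omega_mellin sequentially"
  proof (rule uniform_limitI)
    fix e :: real assume e: "e > 0"
    have "(\<lambda>n. 2 * fact m * exp (- real (Suc n))) \<longlonglongrightarrow> 2 * fact m * 0"
    proof (intro tendsto_mult tendsto_const)
      have "filterlim (\<lambda>n. - real (Suc n)) at_bot sequentially"
        by (subst filterlim_uminus_at_bot) (simp only: minus_minus filterlim_compose[OF filterlim_real_sequentially filterlim_Suc])
      thus "(\<lambda>n. exp (- real (Suc n))) \<longlonglongrightarrow> 0" by (rule filterlim_compose[OF exp_at_bot])
    qed
    hence "\<forall>\<^sub>F n in sequentially. 2 * fact m * exp (- real (Suc n)) < e" by (rule order_tendstoD) (use e in auto)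
    thus "\<forall>\<^sub>F n in sequentially. \<forall>w\<in>cball z 1. dist (f n w) (omega_mellin w) < e"
    proof eventually_elim
      case (elim n)
      show ?case
      proof
        fix w assume w: "w \<in> cball z 1"
        have "norm w \<le> norm z + 1" using w norm_triangle_ineq[of z "w - z"] by (simp add: dist_norm norm_minus_commute)
        hence wm: "\<bar>Re w\<bar> \<le> real m"
          using abs_Re_le_cmod[of w] real_nat_ceiling_ge[of "norm z + 1"] unfolding m_def by linarith
        let ?N = "real (Suc n)"
        have i2: "(?k w has_integral integral {?N..} (?k w)) {?N..}"
          using omega_kernel_tail(1)[OF _ wm, of ?N] set_lebesgue_integral_eq_integral(1) by (intro integrable_integral) auto
        have i1: "(?k w has_integral f n w) {1..?N}"
          unfolding f_def cbox_interval by (intro integrable_integral integrable_continuous_real continuous_on_omega_kernel) auto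
        have "(?k w has_integral (f n w + integral {?N..} (?k w))) ({1..?N} \<union> {?N..})"
          by (rule has_integral_Un[OF i1 i2]) (auto intro: negligible_subset[of "{?N}"])
        moreover have "{1..?N} \<union> {?N..} = {1..}" by auto
        ultimately have "omega_mellin w = f n w + integral {?N..} (?k w)"
          unfolding omega_mellin_def by (simp only: integral_unique)
        hence "dist (f n w) (omega_mellin w) = norm (integral {?N..} (?k w))" by (simp add: dist_norm)
        also have "\<dots> \<le> 2 * fact m * exp (- ?N)" by (rule omega_kernel_tail(2)[OF _ wm]) simp
        also have "\<dots> < e" by (rule elim)
        finally show "dist (f n w) (omega_mellin w) < e" .
      qed
    qed
  qed
  thus "\<exists>d>0. cball z d \<subseteq> UNIV \<and> uniform_limit (cball z d) f omega_mellin sequentially"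
    by (intro exI[of _ 1]) auto
qed auto

text \<open>With free constants C and c the class is closed under sums, products and affine
  substitutions, unlike a bound with a fixed exponent function. The exponent 2 is generous: it
  absorbs the |z| ln |z| growth of factorials and of the reciprocal Gamma function.\<close>

definition order_le_2 :: "(complex \<Rightarrow> complex) \<Rightarrow> bool" where
  "order_le_2 f \<longleftrightarrow> (\<exists>C c. C \<ge> 0 \<and> c \<ge> 0 \<and> (\<forall>z. norm (f z) \<le> C * exp (c * norm z ^ 2)))"

lemma order_le_2I:
  assumes "\<And>z. norm (f z) \<le> C * exp (c * norm z ^ 2)"
  shows "order_le_2 f"
  unfolding order_le_2_def
proof (intro exI conjI allI)
  fix z
  have "norm (f z) \<le> C * exp (c * norm z ^ 2)" by (rule assms)
  also have "\<dots> \<le> \<bar>C\<bar> * exp (\<bar>c\<bar> * norm z ^ 2)" by (intro mult_mono) (auto intro: mult_right_mono)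
  finally show "norm (f z) \<le> \<bar>C\<bar> * exp (\<bar>c\<bar> * norm z ^ 2)" .
qed auto

lemma order_le_2_const: "order_le_2 (\<lambda>_. k)"
  by (rule order_le_2I[of _ "norm k" 0]) simp

lemma order_le_2_exp_linear: "order_le_2 (\<lambda>z. exp (k * z))"
proof (rule order_le_2I)
  fix z
  have "Re (k * z) \<le> norm k * norm z" using complex_Re_le_cmod[of "k * z"] by (simp add: norm_mult)
  also have "\<dots> \<le> norm k * (1 + norm z ^ 2)"
    by (intro mult_left_mono) (use sum_squares_ge_zero[of "norm z - 1/2" 0] in \<open>auto simp: power2_eq_square algebra_simps\<close>)
  finally have "norm (exp (k * z)) \<le> exp (norm k + norm k * norm z ^ 2)" by (simp add: algebra_simps)
  thus "norm (exp (k * z)) \<le> exp (norm k) * exp (norm k * norm z ^ 2)" by (simp add: exp_add)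
qed

lemma order_le_2_id: "order_le_2 (\<lambda>z. z)"
proof (rule order_le_2I)
  fix z :: complex
  have "norm z \<le> 1 + norm z ^ 2"
    using sum_squares_ge_zero[of "norm z - 1/2" 0] by (auto simp: power2_eq_square algebra_simps)
  also have "\<dots> \<le> exp (norm z ^ 2)" by (rule exp_ge_add_one_self)
  finally show "norm z \<le> 1 * exp (1 * norm z ^ 2)" by simp
qed

lemma order_le_2_add:
  assumes "order_le_2 f" "order_le_2 g" shows "order_le_2 (\<lambda>z. f z + g z)"
proof -
  obtain C c where f: "C \<ge> 0" "c \<ge> 0" "\<And>z. norm (f z) \<le> C * exp (c * norm z ^ 2)"
    using assms(1) unfolding order_le_2_def by blast
  obtain D d where g: "D \<ge> 0" "d \<ge> 0" "\<And>z. norm (g z) \<le> D * exp (d * norm z ^ 2)"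
    using assms(2) unfolding order_le_2_def by blast
  show ?thesis
  proof (rule order_le_2I)
    fix z
    have "norm (f z + g z) \<le> C * exp (c * norm z ^ 2) + D * exp (d * norm z ^ 2)"
      using norm_triangle_ineq[of "f z" "g z"] f(3)[of z] g(3)[of z] by linarith
    also have "\<dots> \<le> C * exp ((c + d) * norm z ^ 2) + D * exp ((c + d) * norm z ^ 2)"
      using f g by (intro add_mono mult_left_mono) (auto intro: mult_right_mono)
    finally show "norm (f z + g z) \<le> (C + D) * exp ((c + d) * norm z ^ 2)" by (simp add: algebra_simps)
  qed
qed

lemma order_le_2_mult:
  assumes "order_le_2 f" "order_le_2 g" shows "order_le_2 (\<lambda>z. f z * g z)"
proof -
  obtain C c where f: "C \<ge> 0" "c \<ge> 0" "\<And>z. norm (f z) \<le> C * exp (c * norm z ^ 2)"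
    using assms(1) unfolding order_le_2_def by blast
  obtain D d where g: "D \<ge> 0" "d \<ge> 0" "\<And>z. norm (g z) \<le> D * exp (d * norm z ^ 2)"
    using assms(2) unfolding order_le_2_def by blast
  show ?thesis
  proof (rule order_le_2I)
    fix z
    have "norm (f z * g z) \<le> (C * exp (c * norm z ^ 2)) * (D * exp (d * norm z ^ 2))"
      unfolding norm_mult using f g by (intro mult_mono) auto
    thus "norm (f z * g z) \<le> (C * D) * exp ((c + d) * norm z ^ 2)"
      by (simp add: algebra_simps exp_add)
  qed
qed

lemma order_le_2_affine:
  assumes "order_le_2 f" shows "order_le_2 (\<lambda>z. f (a * z + b))"
proof -
  obtain C c where f: "C \<ge> 0" "c \<ge> 0" "\<And>z. norm (f z) \<le> C * exp (c * norm z ^ 2)"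
    using assms(1) unfolding order_le_2_def by blast
  show ?thesis
  proof (rule order_le_2I)
    fix z
    have "norm (a * z + b) ^ 2 \<le> (norm a * norm z + norm b) ^ 2"
      using norm_triangle_ineq[of "a * z" b] by (intro power_mono) (auto simp: norm_mult)
    also have "\<dots> \<le> 2 * norm a ^ 2 * norm z ^ 2 + 2 * norm b ^ 2"
      using sum_squares_ge_zero[of "norm a * norm z - norm b" 0] by (simp add: power2_eq_square algebra_simps)
    finally have "c * norm (a * z + b) ^ 2 \<le> c * (2 * norm a ^ 2 * norm z ^ 2 + 2 * norm b ^ 2)"
      using f by (intro mult_left_mono) auto
    hence "C * exp (c * norm (a * z + b) ^ 2) \<le> C * exp (c * (2 * norm a ^ 2 * norm z ^ 2 + 2 * norm b ^ 2))"
      using f by (intro mult_left_mono) auto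
    also have "\<dots> = (C * exp (c * 2 * norm b ^ 2)) * exp ((c * 2 * norm a ^ 2) * norm z ^ 2)"
      by (simp add: algebra_simps flip: exp_add)
    finally show "norm (f (a * z + b)) \<le> (C * exp (c * 2 * norm b ^ 2)) * exp ((c * 2 * norm a ^ 2) * norm z ^ 2)"
      using f(3)[of "a * z + b"] by linarith
  qed
qed

text \<open>In the Weierstrass product each factor satisfies |(1 + w) e^-w| <= exp (|w|^2), from |1
  + w|^2 = 1 + (2 Re w + |w|^2) <= exp (2 Re w + |w|^2). With w = z/k the exponents sum to |z|^2
  times the sum of 1/k^2.\<close>

lemma order_le_2_rGamma: "order_le_2 rGamma"
proof -
  define S where "S = (\<Sum>k. inverse (real (Suc k) ^ 2))"
  have sm: "summable (\<lambda>k. inverse (real (Suc k) ^ 2))"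
    using inverse_power_summable[of 2, where 'a = real] by (subst summable_Suc_iff) simp
  have w: "norm ((1 + w) * exp (- w)) \<le> exp (norm w ^ 2)" for w :: complex
  proof -
    have "norm (1 + w) ^ 2 = 1 + (2 * Re w + norm w ^ 2)"
      unfolding cmod_power2 by (simp add: power2_eq_square algebra_simps)
    also have "\<dots> \<le> exp (2 * Re w + norm w ^ 2)" by (rule exp_ge_add_one_self)
    also have "\<dots> \<le> exp (2 * (Re w + norm w ^ 2))" by simp
    also have "\<dots> = exp (Re w + norm w ^ 2) ^ 2" by (rule exp_double)
    finally have "norm (1 + w) \<le> exp (Re w + norm w ^ 2)" by (rule power2_le_imp_le) simp
    hence "norm (1 + w) * exp (- Re w) \<le> exp (Re w + norm w ^ 2) * exp (- Re w)" by (intro mult_right_mono) auto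
    thus ?thesis by (simp add: norm_mult flip: exp_add)
  qed
  have main: "norm (rGamma z) \<le> norm (exp (euler_mascheroni * z) * z) * exp (S * norm z ^ 2)" for z :: complex
  proof (rule tendsto_le[OF sequentially_bot tendsto_const tendsto_norm[OF rGamma_Weierstrass_complex]])
    show "\<forall>\<^sub>F n in sequentially. norm (rGamma_series_Weierstrass z n) \<le> norm (exp (euler_mascheroni * z) * z) * exp (S * norm z ^ 2)"
    proof (rule always_eventually, rule allI)
      fix n
      have "norm (\<Prod>k=1..n. (1 + z / of_nat k) * exp (- z / of_nat k)) \<le> (\<Prod>k=1..n. exp (norm z ^ 2 * inverse (real k ^ 2)))"
        unfolding prod_norm[symmetric]
      proof (intro prod_mono conjI)
        fix k
        show "norm ((1 + z / of_nat k) * exp (- z / of_nat k)) \<le> exp (norm z ^ 2 * inverse (real k ^ 2))"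
        proof -
          have "norm (z / of_nat k) ^ 2 = norm z ^ 2 * inverse (real k ^ 2)"
            by (simp add: norm_divide power_divide inverse_eq_divide)
          thus ?thesis using w[of "z / of_nat k"] by (simp only: minus_divide_left)
        qed
      qed auto
      also have "\<dots> = exp (norm z ^ 2 * (\<Sum>k=1..n. inverse (real k ^ 2)))"
        by (simp add: exp_sum sum_distrib_left)
      also have "\<dots> \<le> exp (S * norm z ^ 2)"
      proof -
        have "(\<Sum>k=1..n. inverse (real k ^ 2)) = (\<Sum>k<n. inverse (real (Suc k) ^ 2))"
          by (rule sum.reindex_bij_witness[of _ Suc "\<lambda>k. k - 1"]) auto
        also have "\<dots> \<le> S" unfolding S_def by (intro sum_le_suminf sm) auto
        finally have "norm z ^ 2 * (\<Sum>k=1..n. inverse (real k ^ 2)) \<le> norm z ^ 2 * S"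
          by (rule mult_left_mono) simp
        thus ?thesis by (simp only: exp_le_cancel_iff mult.commute)
      qed
      finally have "norm (\<Prod>k=1..n. (1 + z / of_nat k) * exp (- z / of_nat k)) \<le> exp (S * norm z ^ 2)" .
      thus "norm (rGamma_series_Weierstrass z n) \<le> norm (exp (euler_mascheroni * z) * z) * exp (S * norm z ^ 2)"
        unfolding rGamma_series_Weierstrass_def norm_mult by (intro mult_left_mono) auto
    qed
  qed
  have "order_le_2 (\<lambda>z::complex. exp (euler_mascheroni * z) * z)"
    by (rule order_le_2_mult[OF order_le_2_exp_linear order_le_2_id])
  then obtain C c where C: "\<And>z::complex. norm (exp (euler_mascheroni * z) * z) \<le> C * exp (c * norm z ^ 2)"
    unfolding order_le_2_def by blast
  have "norm (rGamma z) \<le> C * exp (c * norm z ^ 2) * exp (S * norm z ^ 2)" for z :: complex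
    by (rule order_trans[OF main mult_right_mono[OF C]]) simp
  thus ?thesis by (intro order_le_2I[of _ C "c + S"]) (simp add: algebra_simps exp_add)
qed

text \<open>With m the ceiling of |z| the kernel bound gives 2 m!, and m! <= m^m <= exp (m^2), where
  m <= |z| + 1.\<close>

lemma order_le_2_omega_mellin: "order_le_2 omega_mellin"
proof (rule order_le_2I)
  fix z :: complex
  define m where "m = nat \<lceil>norm z\<rceil>"
  have "norm (omega_mellin z) \<le> 2 * fact m * exp (- 1)"
    unfolding omega_mellin_def m_def by (rule omega_kernel_tail(2)[OF _ abs_Re_le_ceiling]) simp
  also have "\<dots> \<le> 2 * fact m * 1" by (intro mult_left_mono) auto
  finally have 1: "norm (omega_mellin z) \<le> 2 * fact m" by simp
  have "fact m \<le> real m ^ m" using fact_le_power[of m, where 'a = real] by simp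
  also have "real m ^ m \<le> exp (real m) ^ m"
    using exp_ge_add_one_self[of "real m"] by (intro power_mono) linarith+
  also have "exp (real m) ^ m = exp (real m * real m)" by (rule exp_of_nat_mult[symmetric])
  finally have 2: "fact m \<le> exp (real m * real m)" .
  have "real m = of_int \<lceil>norm z\<rceil>" unfolding m_def
    by (rule of_nat_nat) (use ceiling_mono[OF norm_ge_zero[of z]] in simp)
  hence "real m \<le> norm z + 1" using ceiling_correct[of "norm z"] by linarith
  hence "real m * real m \<le> (norm z + 1) * (norm z + 1)" by (intro mult_mono) auto
  also have "\<dots> \<le> 2 + 2 * norm z ^ 2"
    using sum_squares_ge_zero[of "norm z - 1" 0] by (simp add: power2_eq_square algebra_simps)
  finally have "exp (real m * real m) \<le> exp (2 + 2 * norm z ^ 2)" by (simp only: exp_le_cancel_iff)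
  with 1 2 have "norm (omega_mellin z) \<le> 2 * exp (2 + 2 * norm z ^ 2)" by linarith
  thus "norm (omega_mellin z) \<le> (2 * exp 2) * exp (2 * norm z ^ 2)" by (simp add: exp_add)
qed

section \<open>The completed zeta function as a Mellin transform\<close>

lemma gamma_integral_scaled:
  fixes p c :: real
  assumes p: "p > 0" and c: "c > 0"
  shows "((\<lambda>u. exp (- c * u) * u powr (p - 1)) has_integral (Gamma p / c powr p)) {0<..}"
proof -
  define F where "F = (\<lambda>t::real. t powr (p - 1) / exp t)"
  have "(F has_integral Gamma p) {0..}" unfolding F_def by (rule Gamma_integral_real[OF p])
  moreover have "(\<lambda>x. if x \<in> {0..} then F x else 0) = (\<lambda>x. if x \<in> {0<..} then F x else 0)"
    by (auto simp: fun_eq_iff F_def)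
  ultimately have F: "(F has_integral Gamma p) {0<..}"
    using has_integral_restrict_UNIV[of "{0..}" F] has_integral_restrict_UNIV[of "{0<..}" F] by simp
  have ai: "F absolutely_integrable_on {0<..}"
    by (rule nonnegative_absolutely_integrable_1) (use F in \<open>auto simp: F_def\<close>)
  have img: "(\<lambda>u. c * u) ` {0<..} = {0<..}"
  proof (intro equalityI subsetI)
    fix x :: real assume "x \<in> {0<..}"
    thus "x \<in> (\<lambda>u. c * u) ` {0<..}" using c by (intro image_eqI[of _ _ "x / c"]) auto
  qed (use c in auto)
  have "(\<lambda>u. \<bar>c\<bar> * F (c * u)) absolutely_integrable_on {0<..} \<and> integral {0<..} (\<lambda>u. \<bar>c\<bar> * F (c * u)) = Gamma p"
  proof (subst has_absolute_integral_change_of_variables_1'[of "{0<..}" "\<lambda>u. c * u" "\<lambda>_. c"])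
    show "((\<lambda>u. c * u) has_field_derivative c) (at x within {0<..})" for x
      by (auto intro!: derivative_eq_intros)
  qed (use c ai img integral_unique[OF F] in \<open>auto simp: inj_on_def\<close>)
  hence "((\<lambda>u. \<bar>c\<bar> * F (c * u)) has_integral Gamma p) {0<..}"
    using set_lebesgue_integral_eq_integral(1) has_integral_iff by blast
  hence "((\<lambda>u. (1 / c powr p) * (\<bar>c\<bar> * F (c * u))) has_integral (1 / c powr p) * Gamma p) {0<..}"
    by (rule has_integral_mult_right)
  moreover have "(1 / c powr p) * (\<bar>c\<bar> * F (c * u)) = exp (- c * u) * u powr (p - 1)" if "u \<in> {0<..}" for u
    using c that by (simp add: F_def powr_mult powr_diff exp_minus field_simps)
  ultimately show ?thesis
    using has_integral_cong[of "{0<..}" "\<lambda>u. (1 / c powr p) * (\<bar>c\<bar> * F (c * u))" "\<lambda>u. exp (- c * u) * u powr (p - 1)"] by simp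
qed

text \<open>Each Gaussian integrates to a Gamma value times (n + 1)^(-2p). For real p all terms are
  nonnegative and monotone convergence justifies the interchange; complex arguments are reached
  later by the identity theorem.\<close>

lemma omega_mellin_zeta:
  assumes p: "p > 1/2"
  shows "((\<lambda>t. omega t * t powr (p - 1)) has_integral
     (Gamma p / pi powr p * (\<Sum>n. 1 / real (Suc n) powr (2 * p)))) {0<..}"
proof -
  define h where "h = (\<lambda>n t. exp (- pi * t * (real (Suc n))\<^sup>2) * t powr (p - 1))"
  define I where "I = (\<lambda>n. Gamma p / pi powr p * (1 / real (Suc n) powr (2 * p)))"
  have hI: "(h n has_integral I n) {0<..}" for n
  proof -
    have "((\<lambda>u. exp (- (pi * (real (Suc n))\<^sup>2) * u) * u powr (p - 1)) has_integral (Gamma p / (pi * (real (Suc n))\<^sup>2) powr p)) {0<..}"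
      by (rule gamma_integral_scaled) (use p in auto)
    moreover have "(pi * (real (Suc n))\<^sup>2) powr p = pi powr p * real (Suc n) powr (2 * p)"
      by (simp add: powr_mult powr_powr flip: powr_numeral)
    ultimately show ?thesis unfolding h_def I_def by (simp add: mult_ac)
  qed
  have smz: "summable (\<lambda>n. 1 / real (Suc n) powr (2 * p))"
  proof -
    have "summable (\<lambda>n. real n powr (- (2 * p)))" using p by (subst summable_real_powr_iff) auto
    hence "summable (\<lambda>n. real (Suc n) powr (- (2 * p)))" by (subst summable_Suc_iff)
    thus ?thesis by (simp add: powr_minus divide_inverse)
  qed
  have Isums: "I sums (Gamma p / pi powr p * (\<Sum>n. 1 / real (Suc n) powr (2 * p)))"
    unfolding I_def by (intro sums_mult summable_sums smz)
  define f where "f = (\<lambda>k t. \<Sum>n<k. h n t)"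
  have fI: "(f k has_integral (\<Sum>n<k. I n)) {0<..}" for k
    unfolding f_def by (intro has_integral_sum hI) auto
  have conv: "(\<lambda>t. omega t * t powr (p - 1)) integrable_on {0<..} \<and>
     (\<lambda>k. integral {0<..} (f k)) \<longlonglongrightarrow> integral {0<..} (\<lambda>t. omega t * t powr (p - 1))"
  proof (rule monotone_convergence_increasing)
    show "f k integrable_on {0<..}" for k using fI by blast
    show "f k t \<le> f (Suc k) t" for k t unfolding f_def by (simp add: h_def)
    show "(\<lambda>k. f k t) \<longlonglongrightarrow> omega t * t powr (p - 1)" if "t \<in> {0<..}" for t
    proof -
      have "(\<lambda>n. exp (- pi * t * (real (Suc n))\<^sup>2)) sums omega t"
        unfolding omega_def by (rule summable_sums[OF summable_omega]) (use that in auto)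
      from sums_mult2[OF this, of "t powr (p - 1)"] show ?thesis unfolding f_def h_def sums_def .
    qed
    have "(\<lambda>k. \<Sum>n<k. I n) \<longlonglongrightarrow> (Gamma p / pi powr p * (\<Sum>n. 1 / real (Suc n) powr (2 * p)))"
      using Isums by (simp add: sums_def)
    hence "bounded (range (\<lambda>k. \<Sum>n<k. I n))" by (rule convergent_imp_bounded)
    thus "bounded (range (\<lambda>k. integral {0<..} (f k)))" by (simp add: integral_unique[OF fI])
  qed
  hence "integral {0<..} (\<lambda>t. omega t * t powr (p - 1)) = Gamma p / pi powr p * (\<Sum>n. 1 / real (Suc n) powr (2 * p))"
    using Isums LIMSEQ_unique unfolding integral_unique[OF fI] sums_def by blast
  thus ?thesis using conv has_integral_integral by metis
qed

lemma omega_mellin_of_real: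
  obtains J where "omega_mellin (of_real q) = of_real J" "((\<lambda>t. omega t * t powr q) has_integral J) {1..}"
proof -
  let ?k = "\<lambda>t. of_real (omega t) * exp (of_real q * of_real (ln t)) :: complex"
  have k: "?k t = of_real (omega t * t powr q)" if "t \<in> {1..}" for t
    using that by (simp add: powr_def exp_of_real[symmetric])
  have "?k absolutely_integrable_on {1..}"
    by (rule omega_kernel_tail(1)[OF _ abs_Re_le_ceiling]) simp
  hence "(?k has_integral omega_mellin (of_real q)) {1..}"
    unfolding omega_mellin_def using set_lebesgue_integral_eq_integral(1) by blast
  hence c: "((\<lambda>t. complex_of_real (omega t * t powr q)) has_integral omega_mellin (of_real q)) {1..}"
    by (rule has_integral_eq[rotated]) (rule k)
  hence r: "((\<lambda>t. omega t * t powr q) has_integral Re (omega_mellin (of_real q))) {1..}"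
    using has_integral_Re[OF c] by simp
  have "((\<lambda>t. complex_of_real (omega t * t powr q)) has_integral of_real (Re (omega_mellin (of_real q)))) {1..}"
    using has_integral_linear[OF r bounded_linear_of_real] by (simp add: o_def)
  hence "omega_mellin (of_real q) = of_real (Re (omega_mellin (of_real q)))"
    using c has_integral_unique by blast
  thus thesis using that r by blast
qed

text \<open>The substitution t = 1/u turns (0,1] into [1, infinity), and the theta functional
  equation replaces omega (1/u) by (sqrt u (1 + 2 omega u) - 1)/2. The two elementary terms
  integrate to 1/(2p - 1) and -1/(2p); at p = s/2 they are the polar parts of the completed zeta
  function.\<close>

lemma omega_mellin_lower:
  assumes p: "p > 1/2" and J: "((\<lambda>t. omega t * t powr (- p - 1/2)) has_integral J) {1..}"
  shows "((\<lambda>t. omega t * t powr (p - 1)) has_integral (J + 1 / (2 * p - 1) - 1 / (2 * p))) {0<..1}"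
proof -
  define W where "W = J + 1 / (2 * p - 1) - 1 / (2 * p)"
  define f where "f = (\<lambda>t. omega t * t powr (p - 1))"
  have pt: "omega u * u powr (- p - 1/2) + 1/2 * u powr (- p - 1/2) - 1/2 * u powr (- p - 1) = \<bar>- (1 / u)\<^sup>2\<bar> * f (1 / u)"
    if u: "u \<in> {1..}" for u
  proof -
    have u0: "u > 0" using u by simp
    have om: "omega (1 / u) = (u powr (1/2) * (1 + 2 * omega u) - 1) / 2"
      using omega_functional_equation[OF u0] u0 by (simp add: powr_half_sqrt)
    have "\<bar>- (1 / u)\<^sup>2\<bar> * f (1 / u) = u powr (- p - 1) * omega (1 / u)"
    proof -
      have "(1 / u) powr (p - 1) = u powr (1 - p)" using u0 by (simp add: powr_divide powr_diff field_simps)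
      moreover have "\<bar>- (1 / u)\<^sup>2\<bar> = u powr (- 2)" using u0 by (simp add: powr_minus power_divide divide_inverse power_inverse)
      moreover have "(- 2) + (1 - p) = - p - 1" by simp
      hence "u powr (- 2) * u powr (1 - p) = u powr (- p - 1)" by (simp only: powr_add[symmetric])
      ultimately show ?thesis unfolding f_def by (metis mult.assoc mult.commute)
    qed
    moreover have "(- p - 1) + 1/2 = - p - 1/2" by simp
    hence "u powr (- p - 1) * u powr (1/2) = u powr (- p - 1/2)" by (simp only: powr_add[symmetric])
    ultimately show ?thesis unfolding om by (simp add: algebra_simps)
  qed
  have "((\<lambda>u. omega u * u powr (- p - 1/2) + 1/2 * u powr (- p - 1/2) - 1/2 * u powr (- p - 1)) has_integral
     (J + 1/2 * (- (1 powr (- p - 1/2 + 1)) / (- p - 1/2 + 1)) - 1/2 * (- (1 powr (- p - 1 + 1)) / (- p - 1 + 1)))) {1..}"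
    by (intro has_integral_diff has_integral_add J has_integral_mult_right has_integral_powr_to_inf) (use p in auto)
  moreover have "J + 1/2 * (- (1 powr (- p - 1/2 + 1)) / (- p - 1/2 + 1)) - 1/2 * (- (1 powr (- p - 1 + 1)) / (- p - 1 + 1)) = W"
    using p by (simp add: W_def field_simps)
  ultimately have "((\<lambda>u. omega u * u powr (- p - 1/2) + 1/2 * u powr (- p - 1/2) - 1/2 * u powr (- p - 1)) has_integral W) {1..}"
    by simp
  hence g: "((\<lambda>u. \<bar>- (1 / u)\<^sup>2\<bar> * f (1 / u)) has_integral W) {1..}"
    by (rule has_integral_eq[rotated]) (rule pt)
  have f0: "f t \<ge> 0" if "t > 0" for t using omega_nonneg[OF that] by (simp add: f_def)
  have ai: "(\<lambda>u. \<bar>- (1 / u)\<^sup>2\<bar> * f (1 / u)) absolutely_integrable_on {1..}"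
    by (rule nonnegative_absolutely_integrable_1) (use g f0 in auto)
  have img: "(\<lambda>u. 1 / u) ` {1..} = {0<..(1::real)}"
  proof (intro equalityI subsetI)
    fix x :: real assume "x \<in> {0<..1}"
    thus "x \<in> (\<lambda>u. 1 / u) ` {1..}" by (intro image_eqI[of _ _ "1 / x"]) auto
  qed auto
  have "f absolutely_integrable_on ((\<lambda>u. 1 / u) ` {1..}) \<and> integral ((\<lambda>u. 1 / u) ` {1..}) f = W"
  proof (subst has_absolute_integral_change_of_variables_1'[symmetric, where g' = "\<lambda>u. - (1 / u)\<^sup>2"])
    show "((\<lambda>u. 1 / u) has_field_derivative - (1 / x)\<^sup>2) (at x within {1..})" if "x \<in> {1..}" for x :: real
      using that by (auto intro!: derivative_eq_intros simp: power2_eq_square)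
  qed (use ai integral_unique[OF g] in \<open>auto simp: inj_on_def\<close>)
  thus ?thesis unfolding img f_def W_def using set_lebesgue_integral_eq_integral(1) has_integral_iff by blast
qed

text \<open>The completed zeta function without its polar terms 1/(s-1) and -1/s. It comes from both
  halves of the Mellin integral at p = s/2, and s -> 1 - s exchanges the two summands.\<close>

definition Xi :: "complex \<Rightarrow> complex" where
  "Xi s = omega_mellin (s / 2 - 1) + omega_mellin (- s / 2 - 1 / 2)"

lemma Xi_symmetric: "Xi (1 - s) = Xi s"
proof -
  have "(1 - s) / 2 - 1 = - s / 2 - 1 / 2" "- (1 - s) / 2 - 1 / 2 = s / 2 - 1" by (auto simp: field_simps)
  thus ?thesis by (simp only: Xi_def add.commute)
qed

lemma omega_mellin_cnj: "omega_mellin (cnj z) = cnj (omega_mellin z)"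
  unfolding omega_mellin_def integral_cnj
  by (intro integral_cong) (simp add: exp_cnj)

lemma Xi_cnj: "Xi (cnj s) = cnj (Xi s)"
  by (simp add: Xi_def flip: omega_mellin_cnj)

lemma Xi_holomorphic: "Xi holomorphic_on UNIV"
  unfolding Xi_def
  by (intro holomorphic_intros holomorphic_on_compose_gen[OF _ omega_mellin_holomorphic, unfolded o_def]) auto

lemma order_le_2_Xi: "order_le_2 Xi"
proof -
  have "order_le_2 (\<lambda>s. omega_mellin (1/2 * s + (- 1)) + omega_mellin ((- 1/2) * s + (- 1/2)))"
    by (intro order_le_2_add order_le_2_affine order_le_2_omega_mellin)
  thus ?thesis by (simp add: Xi_def[abs_def])
qed

lemma zeta_completed_real:
  assumes s: "s > (1::real)"
  shows "Gamma (of_real s / 2) * exp (- (of_real s / 2) * of_real (ln pi)) * dirichlet_series (\<lambda>_. 1) (of_real s)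
     = Xi (of_real s) + 1 / (of_real s - 1) - 1 / of_real s"
proof -
  define p where "p = s / 2"
  have p: "p > 1/2" using s by (simp add: p_def)
  obtain J1 where J1: "omega_mellin (of_real (p - 1)) = of_real J1" "((\<lambda>t. omega t * t powr (p - 1)) has_integral J1) {1..}"
    by (rule omega_mellin_of_real)
  obtain J2 where J2: "omega_mellin (of_real (- p - 1/2)) = of_real J2" "((\<lambda>t. omega t * t powr (- p - 1/2)) has_integral J2) {1..}"
    by (rule omega_mellin_of_real)
  have "((\<lambda>t. omega t * t powr (p - 1)) has_integral (J2 + 1 / (2 * p - 1) - 1 / (2 * p) + J1)) ({0<..1} \<union> {1..})"
    by (rule has_integral_Un[OF omega_mellin_lower[OF p J2(2)] J1(2)]) (auto intro: negligible_subset[of "{1}"])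
  moreover have "{0<..1} \<union> {1..} = {0<..(1::real)} \<union> {1..}" "{0<..(1::real)} \<union> {1..} = {0<..}" by auto
  ultimately have eq: "Gamma p / pi powr p * (\<Sum>n. 1 / real (Suc n) powr (2 * p)) = J2 + 1 / (2 * p - 1) - 1 / (2 * p) + J1"
    using omega_mellin_zeta[OF p] has_integral_unique by metis
  have D: "dirichlet_series (\<lambda>_. 1) (of_real s) = of_real (\<Sum>n. 1 / real (Suc n) powr (2 * p))"
  proof -
    have "1 / complex_of_nat (Suc n) powr of_real s = of_real (1 / real (Suc n) powr (2 * p))" for n
      using powr_of_real[of "real (Suc n)" s] by (simp add: p_def)
    moreover have "summable (\<lambda>n. 1 / real (Suc n) powr (2 * p))"
      using zeta_log(4) s unfolding abs_conv_beyond_def by (simp add: p_def)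
    ultimately show ?thesis unfolding dirichlet_series_def by (simp only: suminf_of_real)
  qed
  have G: "Gamma (of_real s / 2) = complex_of_real (Gamma p)"
    using Gamma_complex_of_real[of p] by (simp add: p_def)
  have E: "exp (- (of_real s / 2) * of_real (ln pi)) = complex_of_real (1 / pi powr p)"
  proof -
    have "exp (- (of_real s / 2) * of_real (ln pi)) = exp (complex_of_real (- p * ln pi))" by (simp add: p_def)
    also have "\<dots> = of_real (exp (- p * ln pi))" by (rule exp_of_real)
    also have "exp (- p * ln pi) = 1 / pi powr p" by (simp add: powr_def exp_minus divide_inverse)
    finally show ?thesis .
  qed
  have X: "Xi (of_real s) = of_real (J1 + J2)"
    using J1(1) J2(1) by (simp add: Xi_def p_def)
  have R: "complex_of_real (J2 + 1 / (2 * p - 1) - 1 / (2 * p) + J1) = Xi (of_real s) + 1 / (of_real s - 1) - 1 / of_real s"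
    unfolding X by (simp add: p_def)
  show ?thesis unfolding G E D R[symmetric] eq[symmetric] by simp
qed

text \<open>This is (s - 1) zeta(s), that is (s - 1) pi^(s/2) / Gamma(s/2) times Xi s + 1/(s-1) -
  1/s. The division by s is removed through rGamma (s/2) / s = rGamma (s/2 + 1) / 2, which leaves a
  visibly entire expression.\<close>

definition zetaF :: "complex \<Rightarrow> complex" where
  "zetaF s = exp (s / 2 * of_real (ln pi)) *
     ((s - 1) * rGamma (s / 2) * Xi s - (s - 1) / 2 * rGamma (s / 2 + 1) + rGamma (s / 2))"

lemma zetaF_eq:
  assumes "s \<noteq> 0" "s \<noteq> 1"
  shows "zetaF s = (s - 1) * (exp (s / 2 * of_real (ln pi)) * rGamma (s / 2) * (Xi s + 1 / (s - 1) - 1 / s))"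
proof -
  have "s / 2 * rGamma (s / 2 + 1) = rGamma (s / 2)" by (rule rGamma_plus1)
  hence r: "rGamma (s / 2 + 1) = 2 * rGamma (s / 2) / s" using assms by (simp add: field_simps)
  have ne: "s \<noteq> 0" "s - 1 \<noteq> 0" using assms by auto
  have gen: "(s - 1) * G * X - (s - 1) / 2 * (2 * G / s) + G = (s - 1) * (G * (X + 1 / (s - 1) - 1 / s))" for G X :: complex
    using ne by (simp add: divide_simps) (simp add: algebra_simps)
  show ?thesis unfolding zetaF_def r gen by (simp only: mult_ac)
qed

lemma zetaF_holomorphic: "zetaF holomorphic_on UNIV"
  unfolding zetaF_def by (intro holomorphic_intros Xi_holomorphic) auto

lemma order_le_2_zetaF: "order_le_2 zetaF"
proof -
  have "order_le_2 (\<lambda>s. exp ((of_real (ln pi) / 2) * s) *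
     ((s + (- 1)) * rGamma (1/2 * s + 0) * Xi s + (- 1/2) * (s + (- 1)) * rGamma (1/2 * s + 1) + rGamma (1/2 * s + 0)))"
    by (intro order_le_2_mult order_le_2_add order_le_2_exp_linear order_le_2_id order_le_2_const
        order_le_2_affine[OF order_le_2_rGamma] order_le_2_Xi)
  moreover have "(\<lambda>s. exp ((of_real (ln pi) / 2) * s) *
     ((s + (- 1)) * rGamma (1/2 * s + 0) * Xi s + (- 1/2) * (s + (- 1)) * rGamma (1/2 * s + 1) + rGamma (1/2 * s + 0))) = zetaF"
    by (rule ext) (simp add: zetaF_def field_simps)
  ultimately show ?thesis by simp
qed

text \<open>\<open>finite_order\<close> has no constant in the exponent. It is absorbed by raising
  the power: c |z|^2 is at most the cube of the larger of c and |z|.\<close>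

lemma order_le_2_finite_order:
  assumes "order_le_2 f" shows "finite_order f"
proof -
  obtain C c where f: "C \<ge> 0" "c \<ge> 0" "\<And>z. norm (f z) \<le> C * exp (c * norm z ^ 2)"
    using assms unfolding order_le_2_def by blast
  have "norm (f z) \<le> (C * exp (c ^ 3)) * exp (norm z powr 3)" for z
  proof -
    have "c * norm z ^ 2 \<le> c ^ 3 + norm z ^ 3"
    proof -
      have e: "norm z * norm z ^ 2 = norm z ^ 3" "c * c ^ 2 = c ^ 3"
        by (simp_all add: power2_eq_square power3_eq_cube)
      have nn: "c ^ 3 \<ge> 0" "norm z ^ 3 \<ge> 0" using f by simp_all
      show ?thesis
      proof (cases "c \<le> norm z")
        case True
        hence "c * norm z ^ 2 \<le> norm z * norm z ^ 2" by (intro mult_right_mono) auto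
        thus ?thesis using e nn by linarith
      next
        case False
        hence "c * norm z ^ 2 \<le> c * c ^ 2" using f by (intro mult_left_mono power_mono) auto
        thus ?thesis using e nn by linarith
      qed
    qed
    also have "norm z ^ 3 = norm z powr 3" by simp
    finally have "C * exp (c * norm z ^ 2) \<le> C * exp (c ^ 3 + norm z powr 3)"
      using f by (intro mult_left_mono) auto
    with f(3)[of z] show ?thesis by (simp add: exp_add mult_ac)
  qed
  thus ?thesis unfolding finite_order_def by blast
qed

text \<open>The Mellin argument gives the identity for real s > 1 only. These points accumulate at
  2, inside the connected half plane where both sides are holomorphic.\<close>

lemma zetaF_eq_dirichlet:
  assumes s: "1 < Re s"
  shows "zetaF s = (s - 1) * dirichlet_series (\<lambda>_. 1) s"
proof -
  let ?S = "{s. 1 < Re s}" and ?U = "complex_of_real ` {1<..}"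
  let ?h = "\<lambda>s. zetaF s - (s - 1) * dirichlet_series (\<lambda>_. 1) s"
  have "?h s = 0"
  proof (rule analytic_continuation[where S = ?S and U = ?U and \<xi> = 2 and f = ?h])
    show "?h holomorphic_on ?S"
      by (intro holomorphic_intros holomorphic_on_subset[OF zetaF_holomorphic] dirichlet_series_holomorphic zeta_log(4)) auto
    show "connected ?S" by (intro convex_connected convex_halfspace_Re_gt)
    show "open ?S" by (rule open_halfspace_Re_gt)
    show "(2::complex) islimpt ?U"
      unfolding islimpt_approachable
    proof (intro allI impI)
      fix e :: real assume e: "e > 0"
      show "\<exists>x'\<in>?U. x' \<noteq> 2 \<and> dist x' 2 < e"
      proof (intro bexI conjI)
        have "dist (complex_of_real (2 + e / 2)) 2 = \<bar>e / 2\<bar>"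
          by (simp add: dist_norm norm_divide)
        thus "dist (complex_of_real (2 + e / 2)) 2 < e" using e by simp
        show "complex_of_real (2 + e / 2) \<noteq> 2" using e by (simp add: complex_eq_iff)
        show "complex_of_real (2 + e / 2) \<in> ?U" by (rule imageI) (use e in simp)
      qed
    qed
    fix z assume "z \<in> ?U"
    then obtain x where x: "x > 1" "z = of_real x" by auto
    have G: "Gamma (of_real x / 2 :: complex) \<noteq> 0"
    proof -
      have "complex_of_real x / 2 = of_real (x / 2)" by simp
      moreover have "Gamma (x / 2) > 0" by (rule Gamma_real_pos) (use x in simp)
      ultimately show ?thesis by (simp only: Gamma_complex_of_real of_real_eq_0_iff; linarith)
    qed
    have "exp (of_real x / 2 * of_real (ln pi)) * rGamma (of_real x / 2) * (Xi (of_real x) + 1 / (of_real x - 1) - 1 / of_real x)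
       = (exp (of_real x / 2 * of_real (ln pi)) * exp (- (of_real x / 2) * of_real (ln pi))) *
         (rGamma (of_real x / 2) * Gamma (of_real x / 2)) * dirichlet_series (\<lambda>_. 1) (of_real x)"
      unfolding zeta_completed_real[OF x(1), symmetric] by (simp only: mult_ac)
    also have "exp (of_real x / 2 * of_real (ln pi)) * exp (- (of_real x / 2) * of_real (ln pi)) = (1::complex)"
      by (simp flip: exp_add)
    also have "rGamma (of_real x / 2) * Gamma (of_real x / 2) = (1::complex)"
      using G by (simp add: rGamma_inverse_Gamma)
    finally show "?h z = 0" using x zetaF_eq[of "of_real x"] by simp
  qed (use s in auto)
  thus ?thesis by simp
qed

text \<open>The value is - zeta(0). That it is nonzero removes 0 from the trivial zeros, so that
  they start at -2.\<close>

lemma zetaF_0: "zetaF 0 = 1 / 2"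
  by (simp add: zetaF_def)

lemma zetaF_1: "zetaF 1 \<noteq> 0"
proof -
  have "Gamma (1/2 :: complex) \<noteq> 0" using Gamma_one_half_complex by simp
  thus ?thesis by (simp add: zetaF_def rGamma_inverse_Gamma)
qed

section \<open>The explicit formula in the Selberg class\<close>

text \<open>The very choice made inside \<open>L_cont\<close>, without the division by (s - 1)^m:
  the entire function whose zeros are counted.\<close>

definition Lfun :: "(nat \<Rightarrow> complex) \<Rightarrow> complex \<Rightarrow> complex" where
  "Lfun a = (SOME F. continues a (m_of a) F)"

lemma continues_unique:
  assumes "continues a m F" "continues a m G"
  shows "F = G"
proof
  fix z
  show "F z = G z"
  proof (rule analytic_continuation_open[of "{s. 1 < Re s}" UNIV F G])
    show "{s. 1 < Re s} \<noteq> {}" by (auto intro: exI[of _ "2::complex"])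
  qed (use assms in \<open>auto simp: continues_def open_halfspace_Re_gt\<close>)
qed

lemma continues_Lfun:
  assumes "selberg_class a"
  shows "continues a (m_of a) (Lfun a)"
proof -
  have "\<exists>m. \<exists>F. continues a m F" using assms unfolding selberg_class_def by blast
  hence "\<exists>F. continues a (m_of a) F" unfolding m_of_def by (rule LeastI_ex)
  thus ?thesis unfolding Lfun_def by (rule someI_ex)
qed

lemma Lfun_holomorphic: "selberg_class a \<Longrightarrow> Lfun a holomorphic_on UNIV"
  using continues_Lfun by (simp add: continues_def)

lemma Lfun_eq:
  assumes "selberg_class a" "1 < Re s"
  shows "Lfun a s = (s - 1) ^ m_of a * dirichlet_series a s"
  using continues_Lfun[OF assms(1)] assms(2) by (simp add: continues_def)

lemma Lfun_nonzero:
  assumes "selberg_class a" "1 < Re s"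
  shows "Lfun a s \<noteq> 0"
proof -
  obtain b where "\<And>s. Re s > 1 \<Longrightarrow> exp (dirichlet_series b s) = dirichlet_series a s"
    using selberg_class_log[OF assms(1)] by metis
  hence "dirichlet_series a s \<noteq> 0" using assms(2) by (metis exp_not_eq_zero)
  thus ?thesis using assms by (auto simp: Lfun_eq)
qed

lemma finite_order_nat_exponent:
  assumes "finite_order F"
  obtains C q where "C > 0" "\<And>z. norm z \<ge> 1 \<Longrightarrow> norm (F z) \<le> C * exp (norm z ^ q)"
proof -
  obtain \<rho> C where C: "\<And>s. norm (F s) \<le> C * exp (norm s powr \<rho>)" using assms unfolding finite_order_def by blast
  define q where "q = nat \<lceil>\<bar>\<rho>\<bar>\<rceil>"
  have "norm (F z) \<le> (\<bar>C\<bar> + 1) * exp (norm z ^ q)" if z: "norm z \<ge> 1" for z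
  proof -
    have "\<rho> \<le> real q" unfolding q_def by linarith
    hence "norm z powr \<rho> \<le> norm z powr real q" using z by (intro powr_mono) auto
    also have "\<dots> = norm z ^ q" using z by (intro powr_realpow) linarith
    finally have "exp (norm z powr \<rho>) \<le> exp (norm z ^ q)" by simp
    hence "C * exp (norm z powr \<rho>) \<le> (\<bar>C\<bar> + 1) * exp (norm z ^ q)" by (intro mult_mono) auto
    with C[of z] show ?thesis by linarith
  qed
  thus thesis by (intro that[of "\<bar>C\<bar> + 1" q]) auto
qed

text \<open>Otherwise dividing by \<open>s - 1\<close> would contradict the minimality of \<open>m_of a\<close>.\<close>

lemma Lfun_1_nonzero:
  assumes a: "selberg_class a" and m: "m_of a > 0"
  shows "Lfun a 1 \<noteq> 0"
proof
  assume z: "Lfun a 1 = 0"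
  define F where "F = Lfun a"
  have F: "F holomorphic_on UNIV" "F 2 \<noteq> 0" "F 1 = 0"
    using Lfun_holomorphic[OF a] Lfun_nonzero[OF a, of 2] z by (auto simp: F_def)
  have an: "F analytic_on {1}" unfolding analytic_at using F by blast
  have "zorder F 1 > 0"
    using zorder_pos_iff'[OF an entire_frequently_nonzero[OF F(1,2)]] F(3) by simp
  then obtain n where n: "nat (zorder F 1) = Suc n" by (metis gr0_conv_Suc zero_less_nat_eq)
  obtain g where g: "g holomorphic_on UNIV" "\<And>z. F z = (z - 1) ^ Suc n * g z"
    using entire_factor_zero[OF F(1,2), of 1] n by metis
  define F2 where "F2 = (\<lambda>z. (z - 1) ^ n * g z)"
  have F2: "F2 holomorphic_on UNIV" unfolding F2_def by (intro holomorphic_intros g)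
  have FF: "F z = (z - 1) * F2 z" for z using g(2)[of z] by (simp add: F2_def)
  obtain k where k: "m_of a = Suc k" using m by (metis gr0_conv_Suc)
  have "continues a k F2"
    unfolding continues_def
  proof (intro conjI allI impI F2)
    obtain \<rho> C where C: "\<And>s. norm (F s) \<le> C * exp (norm s powr \<rho>)"
      using continues_Lfun[OF a] unfolding continues_def finite_order_def F_def by blast
    have "bounded (F2 ` cball 1 1)"
      by (intro compact_imp_bounded compact_continuous_image holomorphic_on_imp_continuous_on holomorphic_on_subset[OF F2]) auto
    then obtain B where B: "\<forall>z\<in>cball 1 1. norm (F2 z) \<le> B" by (auto simp: bounded_iff)
    have B0: "B \<ge> 0" using B[THEN bspec, of 1] norm_ge_zero[of "F2 1"] by (simp del: norm_ge_zero)
    \<comment> \<open>Dividing by s - 1 keeps the growth bound: outside the unit disc about 1 the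
      divisor has modulus at least 1, and inside it compactness gives a constant.\<close>
    have "norm (F2 s) \<le> (\<bar>C\<bar> + B) * exp (norm s powr \<rho>)" for s
    proof (cases "s \<in> cball 1 1")
      case True
      hence "norm (F2 s) \<le> B * 1" using B by auto
      also have "\<dots> \<le> (\<bar>C\<bar> + B) * exp (norm s powr \<rho>)" using B0 by (intro mult_mono) auto
      finally show ?thesis .
    next
      case False
      hence "norm (s - 1) \<ge> 1" by (simp add: dist_norm norm_minus_commute)
      hence "1 * norm (F2 s) \<le> norm (s - 1) * norm (F2 s)" by (intro mult_right_mono) auto
      also have "\<dots> = norm (F s)" by (simp add: FF norm_mult)
      also have "\<dots> \<le> C * exp (norm s powr \<rho>)" by (rule C)
      also have "\<dots> \<le> (\<bar>C\<bar> + B) * exp (norm s powr \<rho>)" using B0 by (intro mult_right_mono) auto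
      finally show ?thesis by simp
    qed
    thus "finite_order F2" unfolding finite_order_def by blast
    fix s :: complex assume s: "1 < Re s"
    hence ne: "s - 1 \<noteq> 0" by auto
    have "(s - 1) * F2 s = (s - 1) * ((s - 1) ^ k * dirichlet_series a s)"
      using Lfun_eq[OF a s] FF[of s] by (auto simp: F_def k mult.assoc)
    thus "F2 s = (s - 1) ^ k * dirichlet_series a s" using ne by auto
  qed
  moreover have "k < (LEAST m. \<exists>F. continues a m F)" using k unfolding m_of_def by simp
  ultimately show False using not_less_Least by blast
qed

abbreviation zord :: "(complex \<Rightarrow> complex) \<Rightarrow> complex \<Rightarrow> nat" where
  "zord F \<rho> \<equiv> nat (zorder F \<rho>)"

lemma zorder_entire:
  assumes "F holomorphic_on UNIV" "F z0 \<noteq> 0"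
  shows "zorder F \<rho> \<ge> 0" "zord F \<rho> > 0 \<longleftrightarrow> F \<rho> = 0" "zorder F \<rho> = 0 \<longleftrightarrow> F \<rho> \<noteq> 0"
proof -
  have an: "F analytic_on {\<rho>}" unfolding analytic_at using assms by blast
  note fr = entire_frequently_nonzero[OF assms]
  show "zorder F \<rho> \<ge> 0" by (rule zorder_ge_0[OF an fr])
  show "zord F \<rho> > 0 \<longleftrightarrow> F \<rho> = 0" using zorder_pos_iff'[OF an fr] by simp
  show "zorder F \<rho> = 0 \<longleftrightarrow> F \<rho> \<noteq> 0" by (rule zorder_eq_0_iff[OF an fr])
qed

text \<open>The pole at 1 enters the sum over zeros as a zero of multiplicity \<open>- m\<close>.\<close>

lemma has_sum_with_pole:
  fixes \<kappa> :: "complex \<Rightarrow> complex"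
  assumes "F 1 \<noteq> 0 \<Longrightarrow> o1 1 = (0::nat)"
    and "((\<lambda>\<rho>. of_nat (o1 \<rho>) * \<kappa> \<rho>) has_sum X) {\<rho>. F \<rho> = (0::complex)}"
  shows "((\<lambda>\<rho>. ((if \<rho> = 1 then of_nat m else 0) - of_nat (o1 \<rho>)) * \<kappa> \<rho>) has_sum (of_nat m * \<kappa> 1 - X)) (insert 1 {\<rho>. F \<rho> = 0})"
proof -
  let ?Z = "insert 1 {\<rho>. F \<rho> = 0}"
  have "((\<lambda>\<rho>. of_nat (o1 \<rho>) * \<kappa> \<rho>) has_sum X) ?Z"
    by (rule has_sum_cong_neutral[THEN iffD1, OF _ _ _ assms(2)]) (use assms(1) in auto)
  hence 1: "((\<lambda>\<rho>. (- 1) * (of_nat (o1 \<rho>) * \<kappa> \<rho>)) has_sum (- 1) * X) ?Z" by (rule has_sum_cmult_right)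
  have "((\<lambda>\<rho>. of_nat m * \<kappa> \<rho>) has_sum (\<Sum>\<rho>\<in>{1}. of_nat m * \<kappa> \<rho>)) {1}" by (rule has_sum_finite) simp
  hence 2: "((\<lambda>\<rho>. (if \<rho> = 1 then of_nat m else 0) * \<kappa> \<rho>) has_sum (\<Sum>\<rho>\<in>{1}. of_nat m * \<kappa> \<rho>)) ?Z"
    by (rule has_sum_cong_neutral[THEN iffD1, rotated 3]) auto
  show ?thesis using has_sum_add[OF 2 1] by (simp add: algebra_simps)
qed

text \<open>On Re s > 3/2 the function is (s - 1)^m exp B, with logarithmic derivative m/(s - 1) +
  B'. Its k-th derivative at 4 + j is evaluated both as a Dirichlet series and by partial fractions
  over the zeros; the resulting identities are the moments from which the formula for general g
  follows.\<close>

theorem explicit_formula_selberg: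
  assumes a: "selberg_class a" and b: "abs_conv_beyond b (3/2)"
    and exp: "\<And>s. Re s > 1 \<Longrightarrow> exp (dirichlet_series b s) = dirichlet_series a s"
    and g: "\<And>n. cont_diff n {0<..} g" and A: "1 < A" and supp: "\<And>u. u < A \<or> B < u \<Longrightarrow> g u = 0"
  shows "(\<lambda>\<rho>. norm (of_nat (zord (Lfun a) \<rho>) * mellin g \<rho>)) summable_on {\<rho>. Lfun a \<rho> = 0}"
    and "(\<Sum>\<^sub>\<infinity>n\<in>{1..}. b n * of_real (ln (real n)) * g (real n)) =
      of_nat (m_of a) * mellin g 1 - (\<Sum>\<^sub>\<infinity>\<rho>\<in>{\<rho>. Lfun a \<rho> = 0}. of_nat (zord (Lfun a) \<rho>) * mellin g \<rho>)"
proof -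
  define F where "F = Lfun a"
  define m where "m = m_of a"
  define o1 where "o1 = zord F"
  have F: "F holomorphic_on UNIV" "\<And>s. 1 < Re s \<Longrightarrow> F s \<noteq> 0"
    using Lfun_holomorphic[OF a] Lfun_nonzero[OF a] by (auto simp: F_def)
  have FB: "F s = (s - 1) ^ m * exp (dirichlet_series b s)" if "1 < Re s" for s
    using Lfun_eq[OF a that] exp[OF that] by (simp add: F_def m_def)
  have "finite_order F" using continues_Lfun[OF a] by (simp add: continues_def F_def)
  then obtain C q where Cq: "C > 0" "\<And>z. norm z \<ge> 1 \<Longrightarrow> norm (F z) \<le> C * exp (norm z ^ q)"
    using finite_order_nat_exponent by blast
  \<comment> \<open>One above the growth exponent: k itself is the exponent of the weight sum over
    zeros, and k + 1 is the order of the poles in the k-th derivative.\<close>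
  define k where "k = Suc q"
  have kq: "k > q" "Suc k > q" by (auto simp: k_def)
  have o1: "F 1 \<noteq> 0 \<Longrightarrow> o1 1 = 0" using zorder_entire(2)[OF F(1) F(2), of 2 1] by (auto simp: o1_def)
  let ?V = "{\<rho>. F \<rho> = 0}"
  let ?Z = "insert 1 ?V"
  \<comment> \<open>All zeros have Re <= 1, so N = 4 leaves Re (N - rho) >= 3, and the points 4 + j
    lie in the half plane where B converges absolutely.\<close>
  have Z: "Re \<rho> + 2 \<le> real 4" if "\<rho> \<in> ?Z" for \<rho>
    using that F(2)[of \<rho>] by (cases "Re \<rho> > 1") auto
  define wt :: "complex \<Rightarrow> complex" where "wt = (\<lambda>\<rho>. (if \<rho> = 1 then of_nat m else 0) - of_nat (o1 \<rho>))"
  define lam where "lam = (\<lambda>n. b n * complex_of_real (ln (real n)))"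
  define c where "c = (\<lambda>n. (- complex_of_real (ln (real n))) ^ Suc k * b n)"
  have dc: "abs_conv_beyond c (3/2)" unfolding c_def by (rule abs_conv_beyond_ln_power[OF b])
  have lc: "lam n * of_real (ln (real n)) ^ k = (-1) ^ Suc k * c n" for n
    by (simp add: lam_def c_def power_minus[of "complex_of_real (ln (real n))"] mult_ac flip: power_add)
  have s4: "3/2 < Re (of_nat (4 + j) :: complex)" for j by simp
  have pw: "complex_of_nat n powr of_nat (4 + j) = of_nat n ^ (4 + j)" if "n \<in> {1..}" for n j
    using that by (subst powr_nat') auto
  have s1: "(\<lambda>n. norm (lam n) * ln (real n) ^ k / real n ^ 4) summable_on {1..}"
  proof (rule summable_on_cong[THEN iffD1, OF _ dirichlet_series_has_sum(1)[OF dc s4[of 0]]])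
    fix n :: nat assume n: "n \<in> {1..}"
    have "norm (lam n) * ln (real n) ^ k = norm (lam n * of_real (ln (real n)) ^ k)"
      using n by (simp add: norm_mult norm_power)
    also have "\<dots> = norm (c n)" unfolding lc by (simp add: norm_mult norm_power)
    finally show "norm (c n / of_nat n powr of_nat (4 + 0)) = norm (lam n) * ln (real n) ^ k / real n ^ 4"
      unfolding pw[OF n] by (simp add: norm_divide norm_power)
  qed
  have nz4: "F (of_nat (4 + j)) \<noteq> 0" for j by (rule F(2)) simp
  have so: "(\<lambda>\<rho>. real (o1 \<rho>) / norm (of_nat 4 - \<rho>) ^ k) summable_on ?V"
    using higher_deriv_logderiv_entire(1)[OF F(1) nz4[of 0] kq(1) Cq] by (simp add: o1_def)
  have s2: "(\<lambda>\<rho>. norm (wt \<rho>) / norm (of_nat 4 - \<rho>) ^ k) summable_on ?Z"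
  proof -
    let ?f = "\<lambda>\<rho>. norm (wt \<rho>) / norm (of_nat 4 - \<rho>) ^ k"
    have "?f summable_on (?V - {1})"
      by (rule summable_on_cong[THEN iffD1, OF _ summable_on_subset_banach[OF so]]) (auto simp: wt_def)
    moreover have "?f summable_on {1}" by simp
    ultimately have "?f summable_on ((?V - {1}) \<union> {1})" by (intro summable_on_Un_disjoint) auto
    moreover have "(?V - {1}) \<union> {1} = ?Z" by auto
    ultimately show ?thesis by simp
  qed
  have ident: "(\<Sum>\<^sub>\<infinity>n\<in>{1..}. lam n * of_real (ln (real n)) ^ k / of_nat n ^ (4 + j)) =
      (\<Sum>\<^sub>\<infinity>\<rho>\<in>?Z. wt \<rho> * (fact k / (of_nat (4 + j) - \<rho>) ^ Suc k))" for j
  proof -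
    define s0 :: complex where "s0 = of_nat (4 + j)"
    have s0: "3/2 < Re s0" by (simp add: s0_def)
    have s01: "s0 \<notin> {1}" using s0 by auto
    let ?S = "{s. 3/2 < Re s}"
    have oS: "open ?S" by (rule open_halfspace_Re_gt)
    have ld: "deriv F s / F s = (\<Sum>\<rho>\<in>{1}. of_nat m / (s - \<rho>)) + dirichlet_series (\<lambda>n. - of_real (ln (real n)) * b n) s"
      if s: "s \<in> ?S" for s
    proof -
      have s': "1 < Re s" "3/2 < Re s" using s by auto
      have ne: "s - 1 \<noteq> 0" using s' by auto
      have dB: "((\<lambda>s. exp (dirichlet_series b s)) has_field_derivative
        exp (dirichlet_series b s) * dirichlet_series (\<lambda>n. - of_real (ln (real n)) * b n) s) (at s)"
        by (rule DERIV_fun_exp[OF dirichlet_series_has_field_derivative[OF b s'(2)]])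
      have dP: "((\<lambda>s. (s - 1) ^ m) has_field_derivative (s - 1) ^ m * (of_nat m / (s - 1))) (at s)"
      proof (cases m)
        case (Suc m')
        have "((\<lambda>s. s - 1) has_field_derivative 1) (at s)" by (auto intro!: derivative_eq_intros)
        from DERIV_power_Suc[OF this, of m'] show ?thesis using ne by (simp add: Suc mult_ac)
      qed simp
      have "(F has_field_derivative ((s - 1) ^ m * (of_nat m / (s - 1))) * exp (dirichlet_series b s) +
          (exp (dirichlet_series b s) * dirichlet_series (\<lambda>n. - of_real (ln (real n)) * b n) s) * (s - 1) ^ m) (at s)"
        by (rule has_field_derivative_transform_within_open[OF DERIV_mult[OF dP dB] oS s]) (use FB in auto)
      hence "deriv F s = F s * (of_nat m / (s - 1) + dirichlet_series (\<lambda>n. - of_real (ln (real n)) * b n) s)"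
        using FB[OF s'(1)] by (simp add: DERIV_imp_deriv algebra_simps)
      thus ?thesis using F(2)[OF s'(1)] by simp
    qed
    let ?B' = "\<lambda>n. - of_real (ln (real n)) * b n"
    have hol1: "(\<lambda>s. \<Sum>\<rho>\<in>{1}. of_nat m / (s - \<rho>)) holomorphic_on ?S"
      by (intro holomorphic_intros) auto
    have hol2: "dirichlet_series ?B' holomorphic_on ?S" by (rule dirichlet_series_holomorphic[OF abs_conv_beyond_ln[OF b]])
    have "(deriv ^^ k) (\<lambda>s. deriv F s / F s) s0 = (deriv ^^ k) (\<lambda>s. (\<Sum>\<rho>\<in>{1}. of_nat m / (s - \<rho>)) + dirichlet_series ?B' s) s0"
    proof (rule higher_deriv_transform_within_open[where S = ?S])
      show "(\<lambda>s. deriv F s / F s) holomorphic_on ?S"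
        by (intro holomorphic_intros holomorphic_on_subset[OF F(1)] holomorphic_deriv oS) (use F(2) in auto)
      show "(\<lambda>s. (\<Sum>\<rho>\<in>{1}. of_nat m / (s - \<rho>)) + dirichlet_series ?B' s) holomorphic_on ?S"
        by (intro holomorphic_on_add hol1 hol2)
    qed (use oS s0 ld in auto)
    also have "\<dots> = (deriv ^^ k) (\<lambda>s. \<Sum>\<rho>\<in>{1}. of_nat m / (s - \<rho>)) s0 + (deriv ^^ k) (dirichlet_series ?B') s0"
      by (rule higher_deriv_add[OF hol1 hol2 oS]) (use s0 in simp)
    also have "(deriv ^^ k) (\<lambda>s. \<Sum>\<rho>\<in>{1}. of_nat m / (s - \<rho>)) s0 = of_nat m * ((-1) ^ k * fact k / (s0 - 1) ^ Suc k)"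
      using higher_deriv_sum_simple_poles[OF _ s01, of k "\<lambda>_. of_nat m"] by simp
    also have "(deriv ^^ k) (dirichlet_series ?B') s0 = dirichlet_series c s0"
    proof -
      have "(deriv ^^ k) (dirichlet_series ?B') s0 = dirichlet_series (\<lambda>n. (- of_real (ln (real n))) ^ k * ?B' n) s0"
        by (rule higher_deriv_dirichlet_series[OF abs_conv_beyond_ln[OF b] s0])
      also have "(\<lambda>n. (- of_real (ln (real n))) ^ k * ?B' n) = c" by (simp add: c_def fun_eq_iff mult_ac)
      finally show ?thesis .
    qed
    finally have D: "(deriv ^^ k) (\<lambda>s. deriv F s / F s) s0 = of_nat m * ((-1) ^ k * fact k / (s0 - 1) ^ Suc k) + dirichlet_series c s0" .
    define \<kappa> where "\<kappa> = (\<lambda>\<rho>. fact k / (s0 - \<rho>) ^ Suc k)"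
    have hs: "((\<lambda>\<rho>. of_nat (o1 \<rho>) * ((-1) ^ k * fact k / (s0 - \<rho>) ^ Suc k)) has_sum (deriv ^^ k) (\<lambda>s. deriv F s / F s) s0) ?V"
      using higher_deriv_logderiv_entire(2)[OF F(1) nz4[of j] kq(2) Cq] by (simp add: o1_def s0_def)
    have sg: "(-1 :: complex) ^ k * (-1) ^ k = 1" by (simp flip: power_mult_distrib)
    have "((\<lambda>\<rho>. (-1) ^ k * (of_nat (o1 \<rho>) * ((-1) ^ k * fact k / (s0 - \<rho>) ^ Suc k))) has_sum
        (-1) ^ k * (of_nat m * ((-1) ^ k * fact k / (s0 - 1) ^ Suc k) + dirichlet_series c s0)) ?V"
      using has_sum_cmult_right[OF hs, of "(-1) ^ k"] unfolding D .
    moreover have "(-1) ^ k * (x * ((-1) ^ k * fact k / y)) = x * (fact k / y)" for x y :: complex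
    proof -
      have "(-1) ^ k * (x * ((-1) ^ k * fact k / y)) = ((-1) ^ k * (-1) ^ k) * (x * (fact k / y))" by (simp only: mult_ac times_divide_eq_right)
      thus ?thesis unfolding sg by simp
    qed
    ultimately have "((\<lambda>\<rho>. of_nat (o1 \<rho>) * \<kappa> \<rho>) has_sum (of_nat m * \<kappa> 1 + (-1) ^ k * dirichlet_series c s0)) ?V"
      unfolding \<kappa>_def by (simp only: distrib_left)
    \<comment> \<open>The pole contributes m times the kernel at 1 both to the derivative of F'/F
      and to the weights, so it cancels and the Dirichlet series alone remains.\<close>
    from has_sum_with_pole[OF o1 this, of m]
    have "((\<lambda>\<rho>. wt \<rho> * \<kappa> \<rho>) has_sum (of_nat m * \<kappa> 1 - (of_nat m * \<kappa> 1 + (-1) ^ k * dirichlet_series c s0))) ?Z"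
      unfolding wt_def by simp
    hence R: "(\<Sum>\<^sub>\<infinity>\<rho>\<in>?Z. wt \<rho> * \<kappa> \<rho>) = (-1) ^ Suc k * dirichlet_series c s0" by (simp add: infsumI)
    have "((\<lambda>n. (-1) ^ Suc k * (c n / of_nat n powr s0)) has_sum (-1) ^ Suc k * dirichlet_series c s0) {1..}"
      by (intro has_sum_cmult_right dirichlet_series_has_sum(2)[OF dc s0])
    hence "((\<lambda>n. lam n * of_real (ln (real n)) ^ k / of_nat n ^ (4 + j)) has_sum (-1) ^ Suc k * dirichlet_series c s0) {1..}"
      by (rule has_sum_cong[THEN iffD1, rotated]) (simp only: lc s0_def pw times_divide_eq_right)
    thus ?thesis using R unfolding \<kappa>_def s0_def by (simp only: infsumI)
  qed
  have k1: "1 \<le> k" by (simp add: k_def)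
  have E1: "(\<lambda>\<rho>. norm (wt \<rho> * mellin g \<rho>)) summable_on ?Z"
    by (rule explicit_formula_from_moments(1)[where N = 4 and lam = lam, OF order_refl k1 s1 Z s2 ident g A supp])
  have E2: "(\<Sum>\<^sub>\<infinity>n\<in>{1..}. lam n * g (real n)) = (\<Sum>\<^sub>\<infinity>\<rho>\<in>?Z. wt \<rho> * mellin g \<rho>)"
    by (rule explicit_formula_from_moments(2)[where N = 4, OF order_refl k1 s1 Z s2 ident g A supp])
  have S: "(\<lambda>\<rho>. norm (of_nat (o1 \<rho>) * mellin g \<rho>)) summable_on ?V"
  proof -
    let ?f = "\<lambda>\<rho>. norm (of_nat (o1 \<rho>) * mellin g \<rho>)"
    have sub: "(\<lambda>\<rho>. norm (wt \<rho> * mellin g \<rho>)) summable_on (?V - {1})"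
      by (rule summable_on_subset_banach[OF E1]) auto
    have "?f summable_on (?V - {1})"
      by (rule summable_on_cong[THEN iffD1, OF _ sub]) (auto simp: wt_def norm_mult)
    moreover have "?f summable_on (?V \<inter> {1})" by (intro summable_on_finite) auto
    ultimately have "?f summable_on ((?V - {1}) \<union> (?V \<inter> {1}))" by (intro summable_on_Un_disjoint) auto
    moreover have "(?V - {1}) \<union> (?V \<inter> {1}) = ?V" by auto
    ultimately show ?thesis by simp
  qed
  show "(\<lambda>\<rho>. norm (of_nat (zord (Lfun a) \<rho>) * mellin g \<rho>)) summable_on {\<rho>. Lfun a \<rho> = 0}"
    using S unfolding o1_def F_def .
  have "((\<lambda>\<rho>. of_nat (o1 \<rho>) * mellin g \<rho>) has_sum (\<Sum>\<^sub>\<infinity>\<rho>\<in>?V. of_nat (o1 \<rho>) * mellin g \<rho>)) ?V"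
    by (rule has_sum_infsum[OF abs_summable_summable[OF S]])
  from infsumI[OF has_sum_with_pole[OF o1 this, of m]]
  show "(\<Sum>\<^sub>\<infinity>n\<in>{1..}. b n * of_real (ln (real n)) * g (real n)) =
      of_nat (m_of a) * mellin g 1 - (\<Sum>\<^sub>\<infinity>\<rho>\<in>{\<rho>. Lfun a \<rho> = 0}. of_nat (zord (Lfun a) \<rho>) * mellin g \<rho>)"
    using E2 unfolding lam_def wt_def o1_def F_def m_def by simp
qed

section \<open>Zeros of the completed function\<close>

text \<open>The reciprocal of the gamma factor: entire, with the poles of the gamma factor as its
  zeros, so that only nonnegative orders have to be handled.\<close>

definition gamma_prod :: "nat \<Rightarrow> (nat \<Rightarrow> real) \<Rightarrow> (nat \<Rightarrow> complex) \<Rightarrow> complex \<Rightarrow> complex" where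
  "gamma_prod r lam mu s = (\<Prod>j<r. rGamma (of_real (lam j) * s + mu j))"

lemma gamma_prod_holomorphic: "gamma_prod r lam mu holomorphic_on UNIV"
  unfolding gamma_prod_def[abs_def]
  by (intro holomorphic_intros)

lemma gamma_prod_nonzero:
  assumes "\<And>j. j < r \<Longrightarrow> lam j > 0 \<and> Re (mu j) \<ge> 0" "Re s > 0"
  shows "gamma_prod r lam mu s \<noteq> 0"
proof -
  have "rGamma (of_real (lam j) * s + mu j) \<noteq> 0" if "j < r" for j
  proof -
    have "Re (of_real (lam j) * s + mu j) > 0" using assms(1)[OF that] assms(2) by (simp add: add_pos_nonneg)
    hence "of_real (lam j) * s + mu j \<notin> \<int>\<^sub>\<le>\<^sub>0"
      by (metis nonpos_Ints_cases' linorder_not_less neg_le_0_iff_le of_nat_0_le_iff uminus_complex.sel(1) complex_Re_of_nat)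
    thus ?thesis by (simp add: rGamma_eq_zero_iff)
  qed
  thus ?thesis by (simp add: gamma_prod_def)
qed

text \<open>True at every s, poles included, since \<open>Gamma\<close> is 0 at its poles and
  division by 0 gives 0 on both sides.\<close>

lemma completed_eq:
  "completed a Q r lam mu s = (of_real Q powr s * Lfun a s) / (gamma_prod r lam mu s * (s - 1) ^ m_of a)"
proof -
  have "(\<Prod>j<r. Gamma (of_real (lam j) * s + mu j)) = inverse (gamma_prod r lam mu s)"
    unfolding gamma_prod_def prod_inversef[symmetric] by (simp add: rGamma_inverse_Gamma)
  thus ?thesis by (simp add: completed_def L_cont_def Lfun_def divide_inverse mult_ac)
qed

text \<open>Instantiated twice in the end, for the given L-function with its gamma data and for
  zeta, so that everything about zeros is proved once.\<close>

locale selberg_data =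
  fixes a :: "nat \<Rightarrow> complex" and Q :: real and r :: nat and lam :: "nat \<Rightarrow> real"
    and mu :: "nat \<Rightarrow> complex" and \<omega> :: complex
  assumes sel: "selberg_class a" and gam: "gamma_data a Q r lam mu \<omega>"
begin

abbreviation "F \<equiv> Lfun a"
abbreviation "A \<equiv> gamma_prod r lam mu"
abbreviation "Lstar \<equiv> completed a Q r lam mu"

lemma Q: "Q > 0" and lm: "\<And>j. j < r \<Longrightarrow> lam j > 0 \<and> Re (mu j) \<ge> 0" and om: "norm \<omega> = 1"
  and feq: "\<And>s. 0 < Re s \<Longrightarrow> Re s < 1 \<Longrightarrow> Lstar s = \<omega> * cnj (Lstar (1 - cnj s))"
  using gam unfolding gamma_data_def by blast+

lemma F_hol: "F holomorphic_on UNIV" and F_nz: "\<And>s. 1 < Re s \<Longrightarrow> F s \<noteq> 0"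
  using Lfun_holomorphic[OF sel] Lfun_nonzero[OF sel] by auto

lemma F_2: "F 2 \<noteq> 0" by (rule F_nz) simp

lemma A_hol: "A holomorphic_on UNIV" by (rule gamma_prod_holomorphic)

lemma A_nz: "0 < Re s \<Longrightarrow> A s \<noteq> 0" using gamma_prod_nonzero[of r lam mu] lm by blast

lemma A_2: "A 2 \<noteq> 0" by (rule A_nz) simp

lemma Q_hol: "(\<lambda>s. of_real Q powr s) holomorphic_on S"
  by (intro holomorphic_intros)

text \<open>The completed function is a quotient of entire functions that do not vanish at 2, hence
  meromorphic and not identically zero, and orders subtract. The exponential Q^s contributes
  nothing.\<close>

lemma Lstar_order:
  "Lstar meromorphic_on {\<rho>}" "\<exists>\<^sub>F w in at \<rho>. Lstar w \<noteq> 0"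
  "zorder Lstar \<rho> = zorder F \<rho> - zorder A \<rho> - (if \<rho> = 1 then int (m_of a) else 0)"
proof -
  define U where "U = (\<lambda>s. of_real Q powr s * F s)"
  define P where "P = (\<lambda>s::complex. (s - 1) ^ m_of a)"
  define V where "V = (\<lambda>s. P s * A s)"
  have Q0: "of_real Q powr s \<noteq> (0::complex)" for s using Q by simp
  have U: "U holomorphic_on UNIV" "U 2 \<noteq> 0"
    unfolding U_def using F_2 Q0 by (auto intro!: holomorphic_intros F_hol)
  have P: "P holomorphic_on UNIV" "P 2 \<noteq> 0" unfolding P_def by (auto intro!: holomorphic_intros)
  have V: "V holomorphic_on UNIV" "V 2 \<noteq> 0"
    unfolding V_def using A_2 P by (auto intro!: holomorphic_intros A_hol)
  have mer: "f meromorphic_on {\<rho>}" if "f holomorphic_on UNIV" for f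
  proof (rule analytic_on_imp_meromorphic_on)
    show "f analytic_on {\<rho>}" unfolding analytic_at using that by blast
  qed
  have an: "f analytic_on {\<rho>}" if "f holomorphic_on UNIV" for f
    unfolding analytic_at using that by blast
  note fU = entire_frequently_nonzero[OF U] and fV = entire_frequently_nonzero[OF V]
  have L: "Lstar = (\<lambda>s. U s / V s)"
    by (rule ext) (simp add: completed_eq U_def V_def P_def mult.commute)
  show "Lstar meromorphic_on {\<rho>}" unfolding L by (intro meromorphic_intros mer U V)
  have "\<forall>\<^sub>F w in at \<rho>. U w \<noteq> 0 \<and> w \<in> UNIV"
    by (rule non_zero_neighbour_alt[where ?\<beta> = 2]) (use U in auto)
  moreover have "\<forall>\<^sub>F w in at \<rho>. V w \<noteq> 0 \<and> w \<in> UNIV"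
    by (rule non_zero_neighbour_alt[where ?\<beta> = 2]) (use V in auto)
  ultimately have "\<forall>\<^sub>F w in at \<rho>. Lstar w \<noteq> 0" unfolding L by eventually_elim auto
  thus "\<exists>\<^sub>F w in at \<rho>. Lstar w \<noteq> 0" by (simp add: eventually_frequently)
  have zU: "zorder U \<rho> = zorder F \<rho>"
    unfolding U_def by (rule zorder_mult_entire_nonzero[OF Q_hol F_hol Q0 F_2])
  have zP: "zorder P \<rho> = (if \<rho> = 1 then int (m_of a) else 0)"
  proof (cases "\<rho> = 1")
    case True
    have "zorder P 1 = int (m_of a)"
      by (rule zorder_eqI[where S = UNIV and g = "\<lambda>_. 1"]) (auto simp: P_def)
    thus ?thesis using True by simp
  next
    case False
    have "zorder P \<rho> = 0" by (rule zorder_eq_0I[OF an[OF P(1)]]) (use False in \<open>simp add: P_def\<close>)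
    thus ?thesis using False by simp
  qed
  have "zorder V \<rho> = zorder P \<rho> + zorder A \<rho>"
    unfolding V_def
    by (rule zorder_mult[OF mer[OF P(1)] entire_frequently_nonzero[OF P] mer[OF A_hol] entire_frequently_nonzero[OF A_hol A_2]])
  moreover have "zorder Lstar \<rho> = zorder U \<rho> - zorder V \<rho>"
    unfolding L by (rule zorder_divide[OF mer[OF U(1)] fU mer[OF V(1)] fV])
  ultimately show "zorder Lstar \<rho> = zorder F \<rho> - zorder A \<rho> - (if \<rho> = 1 then int (m_of a) else 0)"
    using zU zP by simp
qed

lemma zero_mult_eq: "zero_mult Lstar \<rho> = zord Lstar \<rho>"
  using Lstar_order(1,2)[of \<rho>] meromorphic_at_iff[of Lstar \<rho>] unfolding zero_mult_def by auto

lemma A_order_0: "0 < Re \<rho> \<Longrightarrow> zorder A \<rho> = 0"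
  using zorder_entire(3)[OF A_hol A_2] A_nz by blast

text \<open>Here the gamma factor has no poles, and the only other discrepancy is the pole at 1. If
  m > 0 then F 1 is nonzero, the order of the completed function is negative, and both
  multiplicities are 0.\<close>

lemma zero_mult_right: "0 < Re \<rho> \<Longrightarrow> zero_mult Lstar \<rho> = zord F \<rho>"
proof -
  assume \<rho>: "0 < Re \<rho>"
  have "zorder F 1 = 0" if "m_of a > 0"
    using zorder_entire(3)[OF F_hol F_2] Lfun_1_nonzero[OF sel that] by blast
  thus ?thesis unfolding zero_mult_eq Lstar_order(3) A_order_0[OF \<rho>] by (cases "m_of a = 0") auto
qed

text \<open>Orders subtract, so passing from F to the completed function can only lose zeros, and at
  most as many as A has. To the right of the imaginary axis nothing is lost.\<close>

lemma zero_mult_le: "zero_mult Lstar \<rho> \<le> zord F \<rho>"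
  and zero_mult_ge: "zord F \<rho> \<le> zero_mult Lstar \<rho> + (if Re \<rho> \<le> 0 then zord A \<rho> else 0)"
proof -
  have z: "zorder F \<rho> \<ge> 0" "zorder A \<rho> \<ge> 0"
    using zorder_entire(1)[OF F_hol F_2] zorder_entire(1)[OF A_hol A_2] by auto
  show "zero_mult Lstar \<rho> \<le> zord F \<rho>" unfolding zero_mult_eq Lstar_order(3) using z by auto
  show "zord F \<rho> \<le> zero_mult Lstar \<rho> + (if Re \<rho> \<le> 0 then zord A \<rho> else 0)"
  proof (cases "Re \<rho> \<le> 0")
    case True
    hence "\<rho> \<noteq> 1" by auto
    thus ?thesis unfolding zero_mult_eq Lstar_order(3) using z True by auto
  next
    case False
    thus ?thesis using zero_mult_right[of \<rho>] by simp
  qed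
qed

lemma cnj_reflect_holomorphic:
  assumes "f holomorphic_on UNIV"
  shows "(\<lambda>s. cnj (f (1 - cnj s))) holomorphic_on UNIV"
proof -
  have "(\<lambda>s. f (1 - s)) holomorphic_on UNIV"
    by (intro holomorphic_on_compose_gen[OF _ assms, unfolded o_def] holomorphic_intros) auto
  hence "cnj \<circ> (\<lambda>s. f (1 - s)) \<circ> cnj holomorphic_on UNIV"
    by (intro holomorphic_on_compose_cnj_cnj) (auto intro: holomorphic_on_subset)
  thus ?thesis by (simp add: o_def)
qed

text \<open>With all denominators cleared the functional equation reads \<open>f1 * F = f2 * A\<close>, where
  \<open>f1\<close> and \<open>f2\<close> have no zeros in \<open>Re s < 0\<close>; there the zeros of \<open>F\<close> and \<open>A\<close> cancel.\<close>

lemma zero_mult_left: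
  assumes \<rho>: "Re \<rho> < 0"
  shows "zero_mult Lstar \<rho> = 0"
proof -
  define Fc where "Fc = (\<lambda>s. cnj (F (1 - cnj s)))"
  define Ac where "Ac = (\<lambda>s. cnj (A (1 - cnj s)))"
  define m where "m = m_of a"
  have hol: "Fc holomorphic_on UNIV" "Ac holomorphic_on UNIV"
    unfolding Fc_def Ac_def by (intro cnj_reflect_holomorphic F_hol A_hol)+
  have Q0: "of_real Q powr s \<noteq> (0::complex)" for s using Q by simp
  have om0: "\<omega> \<noteq> 0" using om by auto
  \<comment> \<open>Reflecting (s - 1)^m gives ((1 - cnj s) - 1)^m, whose conjugate is (- s)^m. Both
    sides of the functional equation are multiplied by all four denominators.\<close>
  define f1 where "f1 = (\<lambda>s. of_real Q powr s * Ac s * (- s) ^ m)"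
  define f2 where "f2 = (\<lambda>s. \<omega> * of_real Q powr (1 - s) * Fc s * (s - 1) ^ m)"
  have f12: "f1 holomorphic_on UNIV" "f2 holomorphic_on UNIV"
    unfolding f1_def f2_def by (intro holomorphic_intros hol)+
  have eq: "f1 s * F s = f2 s * A s" for s
  proof (rule analytic_continuation_open[of "{s. 0 < Re s} \<inter> {s. Re s < 1}" UNIV "\<lambda>s. f1 s * F s" "\<lambda>s. f2 s * A s" s])
    show "open ({s. 0 < Re s} \<inter> {s. Re s < 1})"
      by (intro open_Int open_halfspace_Re_gt open_halfspace_Re_lt)
    have "1/2 \<in> {s. 0 < Re s} \<inter> {s. Re s < 1}" by simp
    thus "{s. 0 < Re s} \<inter> {s. Re s < 1} \<noteq> {}" by blast
    fix s assume "s \<in> {s. 0 < Re s} \<inter> {s. Re s < 1}"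
    hence s: "0 < Re s" "Re s < 1" by auto
    have ne: "A s \<noteq> 0" "Ac s \<noteq> 0" "s \<noteq> 0" "s - 1 \<noteq> 0"
    proof -
      show "A s \<noteq> 0" by (rule A_nz[OF s(1)])
      have "A (1 - cnj s) \<noteq> 0" by (rule A_nz) (use s in simp)
      thus "Ac s \<noteq> 0" by (simp add: Ac_def)
    qed (use s in auto)
    have "cnj (of_real Q powr (1 - cnj s)) = of_real Q powr (1 - s)"
      using Q by (subst cnj_powr) (auto simp: complex_nonpos_Reals_iff)
    hence "cnj (Lstar (1 - cnj s)) = (of_real Q powr (1 - s) * Fc s) / (Ac s * (- s) ^ m)"
      by (simp add: completed_eq Fc_def Ac_def m_def)
    hence E: "(of_real Q powr s * F s) / (A s * (s - 1) ^ m) = \<omega> * ((of_real Q powr (1 - s) * Fc s) / (Ac s * (- s) ^ m))"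
      using feq[OF s] by (simp only: completed_eq m_def)
    have cross: "x * q = w * y * p" if "x / p = w * (y / q)" "p \<noteq> 0" "q \<noteq> 0" for x y p q w :: complex
      using that by (simp add: field_simps)
    have "A s * (s - 1) ^ m \<noteq> 0" "Ac s * (- s) ^ m \<noteq> 0" using ne by auto
    from cross[OF E this]
    have "(of_real Q powr s * F s) * (Ac s * (- s) ^ m) = \<omega> * (of_real Q powr (1 - s) * Fc s) * (A s * (s - 1) ^ m)" .
    thus "f1 s * F s = f2 s * A s" unfolding f1_def f2_def by (simp only: mult_ac)
  qed (auto intro!: holomorphic_intros f12 F_hol A_hol)
  have n1: "f1 \<rho> \<noteq> 0"
  proof -
    have "A (1 - cnj \<rho>) \<noteq> 0" by (rule A_nz) (use \<rho> in simp)
    thus ?thesis using Q0 \<rho> by (auto simp: f1_def Ac_def)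
  qed
  have n2: "f2 \<rho> \<noteq> 0"
  proof -
    have "F (1 - cnj \<rho>) \<noteq> 0" by (rule F_nz) (use \<rho> in simp)
    moreover have "\<rho> \<noteq> 1" using \<rho> by auto
    ultimately show ?thesis using Q0 om0 by (auto simp: f2_def Fc_def)
  qed
  have "zorder F \<rho> = zorder (\<lambda>s. f1 s * F s) \<rho>"
    by (rule zorder_mult_entire_nonzero[symmetric, OF f12(1) F_hol n1 F_2])
  also have "(\<lambda>s. f1 s * F s) = (\<lambda>s. f2 s * A s)" using eq by (rule ext)
  also have "zorder (\<lambda>s. f2 s * A s) \<rho> = zorder A \<rho>"
    by (rule zorder_mult_entire_nonzero[OF f12(2) A_hol n2 A_2])
  finally show ?thesis unfolding zero_mult_eq Lstar_order(3) using \<rho> by auto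
qed

lemma zeros_Lstar:
  assumes "\<rho> \<in> zeros_of Lstar"
  shows "F \<rho> = 0" "0 \<le> Re \<rho>" "Re \<rho> \<le> 1"
proof -
  have p: "zero_mult Lstar \<rho> > 0" using assms by (simp add: zeros_of_def)
  hence "zord F \<rho> > 0" using zero_mult_le[of \<rho>] by simp
  thus F0: "F \<rho> = 0" using zorder_entire(2)[OF F_hol F_2] by blast
  show "0 \<le> Re \<rho>" using p zero_mult_left[of \<rho>] by (cases "Re \<rho> < 0") auto
  show "Re \<rho> \<le> 1" using F0 F_nz[of \<rho>] by (cases "Re \<rho> > 1") auto
qed

text \<open>The zeros of the reciprocal Gamma function are simple, with derivative (-1)^n n! at -n,
  and composition with an affine map of slope lam j > 0 keeps them simple.\<close>

lemma zord_A_eq: "zord A \<rho> = (\<Sum>j<r. if of_real (lam j) * \<rho> + mu j \<in> \<int>\<^sub>\<le>\<^sub>0 then 1 else 0)"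
proof -
  let ?f = "\<lambda>j s. rGamma (of_real (lam j) * s + mu j)"
  have hol: "?f j holomorphic_on UNIV" for j by (intro holomorphic_intros)
  have an: "?f j analytic_on {\<rho>}" for j unfolding analytic_at using hol by blast
  have "\<forall>\<^sub>F w in at \<rho>. A w \<noteq> 0 \<and> w \<in> UNIV"
    by (rule non_zero_neighbour_alt[where ?\<beta> = 2]) (use A_hol A_2 in auto)
  hence ev: "\<forall>\<^sub>F w in at \<rho>. (\<Prod>j\<in>{..<r}. ?f j w) \<noteq> 0" by eventually_elim (auto simp: gamma_prod_def)
  have "zorder A \<rho> = (\<Sum>j<r. zorder (?f j) \<rho>)"
    unfolding gamma_prod_def[abs_def] by (rule zorder_prod_analytic[OF an ev])
  also have "\<dots> = (\<Sum>j<r. int (if of_real (lam j) * \<rho> + mu j \<in> \<int>\<^sub>\<le>\<^sub>0 then 1 else 0))"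
  proof (rule sum.cong)
    fix j assume "j \<in> {..<r}"
    hence l: "lam j > 0" using lm by auto
    show "zorder (?f j) \<rho> = int (if of_real (lam j) * \<rho> + mu j \<in> \<int>\<^sub>\<le>\<^sub>0 then 1 else 0)"
    proof (cases "of_real (lam j) * \<rho> + mu j \<in> \<int>\<^sub>\<le>\<^sub>0")
      case False
      thus ?thesis using zorder_eq_0I[OF an] by (simp add: rGamma_eq_zero_iff)
    next
      case True
      then obtain n where n: "of_real (lam j) * \<rho> + mu j = - of_nat n" by (elim nonpos_Ints_cases')
      have d1: "((\<lambda>s. of_real (lam j) * s + mu j) has_field_derivative of_real (lam j)) (at \<rho>)"
        by (auto intro!: derivative_eq_intros)
      have d2: "(rGamma has_field_derivative (-1) ^ n * fact n) (at (of_real (lam j) * \<rho> + mu j))"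
        unfolding n by (rule has_field_derivative_rGamma_nonpos_int)
      have "(?f j has_field_derivative ((-1) ^ n * fact n) * of_real (lam j)) (at \<rho>)"
        by (rule DERIV_chain2[OF d2 d1])
      hence d: "deriv (?f j) \<rho> \<noteq> 0" using l by (simp add: DERIV_imp_deriv)
      have "zorder (?f j) \<rho> = 1"
        by (rule zorder_zero_eqI'[OF an]) (use d True in \<open>auto simp: rGamma_eq_zero_iff\<close>)
      thus ?thesis using True by simp
    qed
  qed auto
  finally show ?thesis by (simp flip: of_nat_sum)
qed

text \<open>The zeros from the j-th factor are rho = - (n + mu j)/lam j, and Re (mu j) >= 0 gives Re
  rho <= - n/lam j. Weighted by 2 powr Re rho they are dominated by a geometric series of ratio 2
  powr (- 1/lam j).\<close>

lemma trivial_zeros_bound: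
  "\<exists>C\<ge>0. \<forall>T. finite T \<longrightarrow> (\<Sum>\<rho>\<in>T. real (zord A \<rho>) * 2 powr Re \<rho>) \<le> C"
proof -
  define x where "x = (\<lambda>j. 2 powr (- 1 / lam j))"
  define C where "C = (\<Sum>j<r. 1 / (1 - x j))"
  have x: "0 < x j" "x j < 1" if "j < r" for j
    using lm[OF that] powr_less_mono[of "- 1 / lam j" 0 2] by (auto simp: x_def)
  have "(\<Sum>\<rho>\<in>T. real (zord A \<rho>) * 2 powr Re \<rho>) \<le> C" if T: "finite T" for T
  proof -
    let ?P = "\<lambda>j \<rho>. of_real (lam j) * \<rho> + mu j \<in> \<int>\<^sub>\<le>\<^sub>0"
    have "(\<Sum>\<rho>\<in>T. real (zord A \<rho>) * 2 powr Re \<rho>) = (\<Sum>\<rho>\<in>T. \<Sum>j<r. if ?P j \<rho> then 2 powr Re \<rho> else 0)"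
      unfolding zord_A_eq by (simp add: sum_distrib_right if_distrib if_distribR cong: if_cong)
    also have "\<dots> = (\<Sum>j<r. \<Sum>\<rho>\<in>T. if ?P j \<rho> then 2 powr Re \<rho> else 0)" by (rule sum.swap)
    also have "\<dots> \<le> C"
      unfolding C_def
    proof (rule sum_mono)
      fix j assume "j \<in> {..<r}"
      hence j: "j < r" by simp
      have l: "lam j > 0" "Re (mu j) \<ge> 0" using lm[OF j] by auto
      define Tj where "Tj = {\<rho>\<in>T. ?P j \<rho>}"
      define nn where "nn = (\<lambda>\<rho>. nat \<lfloor>- Re (of_real (lam j) * \<rho> + mu j)\<rfloor>)"
      have nn: "of_real (lam j) * \<rho> + mu j = - of_nat (nn \<rho>)" if "\<rho> \<in> Tj" for \<rho>
      proof -
        from that obtain n where n: "of_real (lam j) * \<rho> + mu j = - of_nat n"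
          unfolding Tj_def by (auto elim!: nonpos_Ints_cases')
        hence "nn \<rho> = n" unfolding nn_def by simp
        thus ?thesis using n by simp
      qed
      have inj: "inj_on nn Tj"
      proof (rule inj_onI)
        fix \<rho> \<rho>' assume h: "\<rho> \<in> Tj" "\<rho>' \<in> Tj" "nn \<rho> = nn \<rho>'"
        have "of_real (lam j) * \<rho> + mu j = of_real (lam j) * \<rho>' + mu j" using nn[OF h(1)] nn[OF h(2)] h(3) by simp
        thus "\<rho> = \<rho>'" using l by simp
      qed
      have le: "2 powr Re \<rho> \<le> x j ^ nn \<rho>" if "\<rho> \<in> Tj" for \<rho>
      proof -
        have "lam j * Re \<rho> + Re (mu j) = - real (nn \<rho>)" using arg_cong[OF nn[OF that], of Re] by simp
        hence "Re \<rho> \<le> real (nn \<rho>) * (- 1 / lam j)" using l by (simp add: field_simps)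
        hence "2 powr Re \<rho> \<le> 2 powr (real (nn \<rho>) * (- 1 / lam j))" by (intro powr_mono) auto
        also have "\<dots> = x j ^ nn \<rho>" by (simp add: x_def powr_power mult.commute)
        finally show ?thesis .
      qed
      have "(\<Sum>\<rho>\<in>T. if ?P j \<rho> then 2 powr Re \<rho> else 0) = (\<Sum>\<rho>\<in>Tj. 2 powr Re \<rho>)"
        unfolding Tj_def using T by (simp add: sum.inter_filter)
      also have "\<dots> \<le> (\<Sum>\<rho>\<in>Tj. x j ^ nn \<rho>)" by (rule sum_mono) (rule le)
      also have "\<dots> = (\<Sum>n\<in>nn ` Tj. x j ^ n)" by (simp add: sum.reindex[OF inj] o_def)
      also have "\<dots> \<le> (\<Sum>n. x j ^ n)"
        using x[OF j] T by (intro sum_le_suminf summable_geometric) (auto simp: Tj_def)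
      also have "\<dots> = 1 / (1 - x j)" using x[OF j] by (intro suminf_geometric) auto
      finally show "(\<Sum>\<rho>\<in>T. if ?P j \<rho> then 2 powr Re \<rho> else 0) \<le> 1 / (1 - x j)" .
    qed
    finally show ?thesis .
  qed
  moreover have "C \<ge> 0" unfolding C_def using x by (intro sum_nonneg) (auto simp: less_imp_le)
  ultimately show ?thesis by blast
qed

lemma zeros_summable:
  assumes g: "\<And>n. cont_diff n {0<..} g" and c: "1 < c" and supp: "\<And>u. u < c \<or> B < u \<Longrightarrow> g u = 0"
  shows "(\<lambda>\<rho>. norm (of_nat (zero_mult Lstar \<rho>) * mellin g \<rho>)) summable_on {\<rho>. F \<rho> = 0}"
proof -
  obtain b where b: "abs_conv_beyond b (3/2)" "\<And>s. Re s > 1 \<Longrightarrow> exp (dirichlet_series b s) = dirichlet_series a s"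
    using selberg_class_log[OF sel] by metis
  show ?thesis
  proof (rule summable_on_comparison_test[OF explicit_formula_selberg(1)[OF sel b g c supp]])
    show "norm (of_nat (zero_mult Lstar \<rho>) * mellin g \<rho>) \<le> norm (of_nat (zord F \<rho>) * mellin g \<rho>)" for \<rho>
      using zero_mult_le[of \<rho>] by (simp add: norm_mult mult_right_mono)
  qed auto
qed

text \<open>The explicit formula runs over all zeros of F; replacing their orders by those of the
  completed function affects only zeros cancelled by A in Re rho <= 0, and the weighted count C pays
  for them. The decay of the transform is asked only at common zeros of F and A: for zeta this
  leaves out the point 0, where a test function growing like u^2 would violate the bound
  needed.\<close>

theorem zero_sum_vs_prime_sum:
  assumes b: "abs_conv_beyond b (3/2)" "\<And>s. Re s > 1 \<Longrightarrow> exp (dirichlet_series b s) = dirichlet_series a s"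
    and C: "\<And>T. finite T \<Longrightarrow> (\<Sum>\<rho>\<in>T. real (zord A \<rho>) * 2 powr Re \<rho>) \<le> C"
    and g: "\<And>n. cont_diff n {0<..} g" and c: "1 < c" and supp: "\<And>u. u < c \<or> B < u \<Longrightarrow> g u = 0"
    and M: "M \<ge> 0" "\<And>\<rho>. Re \<rho> \<le> 0 \<Longrightarrow> F \<rho> = 0 \<Longrightarrow> A \<rho> = 0 \<Longrightarrow> norm (mellin g \<rho>) \<le> M * 2 powr Re \<rho>"
  shows "norm (of_nat (m_of a) * mellin g 1 - (\<Sum>\<^sub>\<infinity>\<rho>\<in>zeros_of Lstar. of_nat (zero_mult Lstar \<rho>) * mellin g \<rho>)
     - (\<Sum>\<^sub>\<infinity>n\<in>{1..}. b n * of_real (ln (real n)) * g (real n))) \<le> M * C"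
proof -
  let ?V = "{\<rho>. F \<rho> = 0}"
  let ?zm = "\<lambda>\<rho>. of_nat (zero_mult Lstar \<rho>) * mellin g \<rho>" and ?zo = "\<lambda>\<rho>. of_nat (zord F \<rho>) * mellin g \<rho>"
  have so: "(\<lambda>\<rho>. norm (?zo \<rho>)) summable_on ?V" by (rule explicit_formula_selberg(1)[OF sel b g c supp])
  have sm: "(\<lambda>\<rho>. norm (?zm \<rho>)) summable_on ?V" by (rule zeros_summable[OF g c supp])
  have E: "(\<Sum>\<^sub>\<infinity>n\<in>{1..}. b n * of_real (ln (real n)) * g (real n)) = of_nat (m_of a) * mellin g 1 - infsum ?zo ?V"
    by (rule explicit_formula_selberg(2)[OF sel b g c supp])
  have Z: "infsum ?zm (zeros_of Lstar) = infsum ?zm ?V"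
  proof (rule infsum_cong_neutral)
    show "?zm \<rho> = 0" if "\<rho> \<in> zeros_of Lstar - ?V" for \<rho> using that zeros_Lstar(1) by blast
    show "?zm \<rho> = 0" if "\<rho> \<in> ?V - zeros_of Lstar" for \<rho> using that by (simp add: zeros_of_def)
  qed (rule refl)
  define d where "d = (\<lambda>\<rho>. ?zo \<rho> + (- 1) * ?zm \<rho>)"
  have hd: "(d has_sum (infsum ?zo ?V + (- 1) * infsum ?zm ?V)) ?V"
    unfolding d_def
    by (rule has_sum_add[OF has_sum_infsum[OF abs_summable_summable[OF so]]
          has_sum_cmult_right[OF has_sum_infsum[OF abs_summable_summable[OF sm]]]])
  have nd: "norm (d \<rho>) \<le> M * (real (zord A \<rho>) * 2 powr Re \<rho>)" if \<rho>: "F \<rho> = 0" for \<rho>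
  proof -
    have "d \<rho> = of_nat (zord F \<rho> - zero_mult Lstar \<rho>) * mellin g \<rho>"
      using zero_mult_le[of \<rho>] by (simp add: d_def of_nat_diff algebra_simps)
    hence nd: "norm (d \<rho>) = real (zord F \<rho> - zero_mult Lstar \<rho>) * norm (mellin g \<rho>)" by (simp add: norm_mult)
    show ?thesis
    proof (cases "Re \<rho> \<le> 0 \<and> A \<rho> = 0")
      case True
      have "real (zord F \<rho> - zero_mult Lstar \<rho>) \<le> real (zord A \<rho>)" using zero_mult_ge[of \<rho>] True by simp
      hence "norm (d \<rho>) \<le> real (zord A \<rho>) * (M * 2 powr Re \<rho>)"
        unfolding nd using M(2)[of \<rho>] True \<rho> by (intro mult_mono) auto
      thus ?thesis by (simp add: mult_ac)
    next
      case False
      have "zord A \<rho> = 0 \<or> \<not> Re \<rho> \<le> 0" using False zorder_entire(3)[OF A_hol A_2, of \<rho>] by auto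
      hence "zord F \<rho> - zero_mult Lstar \<rho> = 0" using zero_mult_ge[of \<rho>] by (elim disjE) (simp_all split: if_splits)
      thus ?thesis unfolding nd using M(1) by simp
    qed
  qed
  have sd: "(\<lambda>\<rho>. norm (d \<rho>)) summable_on ?V"
  proof (rule summable_on_comparison_test[OF summable_on_add[OF so sm]])
    show "norm (d \<rho>) \<le> norm (?zo \<rho>) + norm (?zm \<rho>)" for \<rho>
      using norm_triangle_ineq4[of "?zo \<rho>" "?zm \<rho>"] unfolding d_def by simp
  qed auto
  have "norm (infsum d ?V) \<le> infsum (\<lambda>\<rho>. norm (d \<rho>)) ?V" by (rule norm_infsum_bound[OF sd])
  also have "\<dots> \<le> M * C"
  proof (rule infsum_le_finite_sums[OF sd])
    fix T assume T: "finite T" "T \<subseteq> ?V"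
    have "(\<Sum>\<rho>\<in>T. norm (d \<rho>)) \<le> (\<Sum>\<rho>\<in>T. M * (real (zord A \<rho>) * 2 powr Re \<rho>))"
      by (rule sum_mono) (use T nd in auto)
    also have "\<dots> = M * (\<Sum>\<rho>\<in>T. real (zord A \<rho>) * 2 powr Re \<rho>)" by (simp add: sum_distrib_left)
    also have "\<dots> \<le> M * C" by (rule mult_left_mono[OF C[OF T(1)] M(1)])
    finally show "(\<Sum>\<rho>\<in>T. norm (d \<rho>)) \<le> M * C" .
  qed
  finally have "norm (infsum ?zo ?V + (- 1) * infsum ?zm ?V) \<le> M * C" unfolding infsumI[OF hd] .
  moreover have "of_nat (m_of a) * mellin g 1 - infsum ?zm (zeros_of Lstar) - (\<Sum>\<^sub>\<infinity>n\<in>{1..}. b n * of_real (ln (real n)) * g (real n))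
      = infsum ?zo ?V + (- 1) * infsum ?zm ?V"
    unfolding E Z by simp
  ultimately show ?thesis by simp
qed

end

section \<open>Comparison of the two explicit formulas\<close>

lemma continues_zetaF: "continues (\<lambda>_. 1) 1 zetaF"
  unfolding continues_def
  using zetaF_holomorphic order_le_2_finite_order[OF order_le_2_zetaF] zetaF_eq_dirichlet by simp

text \<open>With m = 0 the zeta series itself would be entire, and (s - 1) zeta(s) would vanish at
  1, against \<open>zetaF_1\<close>.\<close>

lemma m_of_zeta: "m_of (\<lambda>_. 1) = 1"
  unfolding m_of_def
proof (rule Least_equality)
  show "\<exists>F. continues (\<lambda>_. 1) 1 F" using continues_zetaF by blast
  fix m assume "\<exists>F. continues (\<lambda>_. 1) m F"
  then obtain F where F: "continues (\<lambda>_. 1) m F" by blast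
  show "1 \<le> m"
  proof (rule ccontr)
    assume "\<not> 1 \<le> m"
    hence m: "m = 0" by simp
    have F': "F holomorphic_on UNIV" "\<And>s. 1 < Re s \<Longrightarrow> F s = dirichlet_series (\<lambda>_. 1) s"
      using F unfolding m continues_def by auto
    have "zetaF 1 = (1 - 1) * F 1"
    proof (rule analytic_continuation_open[of "{s. 1 < Re s}" UNIV zetaF "\<lambda>s. (s - 1) * F s" 1])
      show "open {s. 1 < Re s}" by (rule open_halfspace_Re_gt)
      have "2 \<in> {s::complex. 1 < Re s}" by simp
      thus "{s::complex. 1 < Re s} \<noteq> {}" by blast
      show "(\<lambda>s. (s - 1) * F s) holomorphic_on UNIV" by (intro holomorphic_intros F')
      show "zetaF s = (s - 1) * F s" if "s \<in> {s. 1 < Re s}" for s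
        using that zetaF_eq_dirichlet[of s] F'(2)[of s] by simp
    qed (simp_all add: zetaF_holomorphic connected_UNIV)
    thus False using zetaF_1 by simp
  qed
qed

lemma Lfun_zeta: "Lfun (\<lambda>_. 1) = zetaF"
  unfolding Lfun_def m_of_zeta
  by (rule some_equality[where P = "continues (\<lambda>_. 1) 1", OF continues_zetaF])
     (rule continues_unique[OF _ continues_zetaF])

lemma zeta_star_eq_completed:
  "zeta_star = completed (\<lambda>_. 1) (pi powr (- 1/2)) 1 (\<lambda>_. 1/2) (\<lambda>_. 0)"
proof
  fix s :: complex
  have "of_real (pi powr (- 1/2)) powr s = exp (s * of_real (ln (pi powr (- 1/2))))"
    by (simp add: powr_def Ln_of_real del: ln_powr)
  also have "ln (pi powr (- 1/2)) = - (1/2) * ln pi" by (simp add: ln_powr)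
  also have "exp (s * of_real (- (1/2) * ln pi)) = of_real pi powr (- s / 2)"
    by (simp add: powr_def Ln_of_real)
  finally show "zeta_star s = completed (\<lambda>_. 1) (pi powr (- 1/2)) 1 (\<lambda>_. 1/2) (\<lambda>_. 0) s"
    by (simp add: zeta_star_def completed_def)
qed

lemma zeta_star_eq_Xi:
  assumes "0 < Re s" "s \<noteq> 1"
  shows "zeta_star s = Xi s + 1 / (s - 1) - 1 / s"
proof -
  have "s / 2 \<notin> \<int>\<^sub>\<le>\<^sub>0"
  proof
    assume "s / 2 \<in> \<int>\<^sub>\<le>\<^sub>0"
    then obtain n where "s / 2 = - of_nat n" by (elim nonpos_Ints_cases')
    hence "Re (s / 2) = - real n" by simp
    thus False using assms by simp
  qed
  hence G: "Gamma (s / 2) * rGamma (s / 2) = 1" by (simp add: rGamma_inverse_Gamma Gamma_eq_zero_iff)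
  have e: "of_real pi powr (- s / 2) * exp (s / 2 * of_real (ln pi)) = (1 :: complex)"
    by (simp add: powr_def Ln_of_real flip: exp_add)
  have "s \<noteq> 0" using assms by auto
  have "zeta_star s = of_real pi powr (- s / 2) * Gamma (s / 2) *
     ((s - 1) * (exp (s / 2 * of_real (ln pi)) * rGamma (s / 2) * (Xi s + 1 / (s - 1) - 1 / s)) / (s - 1))"
    using zetaF_eq[OF \<open>s \<noteq> 0\<close> assms(2)] Lfun_zeta[unfolded Lfun_def] unfolding zeta_star_def L_cont_def m_of_zeta
    by simp
  also have "\<dots> = (of_real pi powr (- s / 2) * exp (s / 2 * of_real (ln pi))) * (Gamma (s / 2) * rGamma (s / 2)) * (Xi s + 1 / (s - 1) - 1 / s)"
    using assms(2) by simp
  finally show ?thesis unfolding e G by simp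
qed

text \<open>\<open>Xi\<close> is invariant under s -> 1 - s and commutes with conjugation, while the
  polar terms 1/(s-1) and -1/s are exchanged.\<close>

lemma gamma_data_zeta: "gamma_data (\<lambda>_. 1) (pi powr (- 1/2)) 1 (\<lambda>_. 1/2) (\<lambda>_. 0) 1"
  unfolding gamma_data_def zeta_star_eq_completed[symmetric]
proof (intro conjI allI impI)
  fix s :: complex assume s: "0 < Re s \<and> Re s < 1"
  have ne: "s \<noteq> 0" "s \<noteq> 1" using s by auto
  have ne': "1 - cnj s \<noteq> 1"
    using ne by (metis complex_cnj_zero_iff diff_0_right diff_left_imp_eq)
  have 1: "zeta_star s = Xi s + 1 / (s - 1) - 1 / s" by (rule zeta_star_eq_Xi) (use s ne in auto)
  have 2: "zeta_star (1 - cnj s) = Xi (1 - cnj s) + 1 / (1 - cnj s - 1) - 1 / (1 - cnj s)"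
    by (rule zeta_star_eq_Xi) (use s ne' in auto)
  have "cnj (zeta_star (1 - cnj s)) = Xi s + 1 / (- s) - 1 / (1 - s)"
    unfolding 2 Xi_symmetric Xi_cnj by simp
  also have "1 / (1 - s) = - (1 / (s - 1))" by (metis minus_diff_eq minus_divide_right)
  finally show "zeta_star s = 1 * cnj (zeta_star (1 - cnj s))" unfolding 1 by simp
qed auto

lemma selberg_class_zeta: "selberg_class (\<lambda>_. 1)"
  unfolding selberg_class_def
proof (intro conjI)
  let ?b = "\<lambda>n. mangoldt n / complex_of_real (ln (real n))"
  show "\<forall>s. 1 < Re s \<longrightarrow> summable (\<lambda>n. norm (1 / of_nat (Suc n) powr s :: complex))"
    using abs_conv_beyond_summable[OF zeta_log(4)] by blast
  show "\<exists>m F. continues (\<lambda>_. 1) m F" using continues_zetaF by blast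
  show "\<exists>Q r lam mu \<omega>. gamma_data (\<lambda>_. 1) Q r lam mu \<omega>" using gamma_data_zeta by blast
  show "\<forall>\<epsilon>>0. \<exists>C. \<forall>n\<ge>1. norm (1::complex) \<le> C * real n powr \<epsilon>"
    by (intro allI impI exI[of _ 1]) (simp add: ge_one_powr_ge_zero)
  show "\<exists>b \<theta>. \<theta> < 1/2 \<and>
        (\<forall>n. b n \<noteq> 0 \<longrightarrow> (\<exists>p k. prime p \<and> k \<ge> 1 \<and> n = p ^ k)) \<and>
        (\<exists>C. \<forall>n\<ge>1. norm (b n) \<le> C * real n powr \<theta>) \<and>
        (\<forall>s. 1 < Re s \<longrightarrow> summable (\<lambda>n. b (Suc n) / of_nat (Suc n) powr s) \<and>
              exp (dirichlet_series b s) = dirichlet_series (\<lambda>_. 1) s)"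
  proof (rule exI[of _ ?b], rule exI[of _ 0], intro conjI)
    show "\<forall>n. ?b n \<noteq> 0 \<longrightarrow> (\<exists>p k. prime p \<and> k \<ge> 1 \<and> n = p ^ k)" using zeta_log(1) by blast
    show "\<exists>C. \<forall>n\<ge>1. norm (?b n) \<le> C * real n powr 0" using zeta_log(2) by blast
    show "\<forall>s. 1 < Re s \<longrightarrow> summable (\<lambda>n. ?b (Suc n) / of_nat (Suc n) powr s) \<and>
              exp (dirichlet_series ?b s) = dirichlet_series (\<lambda>_. 1) s"
    proof (intro allI impI conjI)
      fix s :: complex assume s: "1 < Re s"
      show "summable (\<lambda>n. ?b (Suc n) / of_nat (Suc n) powr s)"
        by (rule summable_norm_cancel[OF abs_conv_beyond_summable[OF zeta_log(3) s]])
      show "exp (dirichlet_series ?b s) = dirichlet_series (\<lambda>_. 1) s" by (rule zeta_log(5)[OF s])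
    qed
  qed simp
qed

section \<open>Bounds and dilations for test functions\<close>

lemma smooth_on_imp_cont_diff:
  assumes "smooth_on {0<..} f"
  shows "cont_diff n {0<..} f"
proof -
  obtain D where D: "\<And>x. x \<in> {0<..} \<Longrightarrow> D 0 x = f x"
    "\<And>k x. x \<in> {0<..} \<Longrightarrow> (D k has_vector_derivative D (Suc k) x) (at x)"
    using assms unfolding smooth_on_def by blast
  have "cont_diff n {0<..} (D k)" for n k
  proof (induction n arbitrary: k)
    case 0
    show ?case using D(2)[THEN has_vector_derivative_continuous] by (auto intro: continuous_at_imp_continuous_on)
  next
    case (Suc n)
    show ?case by (rule cont_diff_SucI[OF _ D(2) Suc.IH]) auto
  qed
  thus ?thesis by (intro cont_diff_cong[OF _ D(1)]) auto
qed

lemma continuous_on_mellin_integrand: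
  fixes g :: "real \<Rightarrow> complex" and \<rho> :: complex
  assumes "continuous_on {0<..} g"
  shows "continuous_on {0<..} (\<lambda>u. g u * of_real u powr \<rho> / of_real u)"
  by (intro continuous_intros assms) (auto simp: complex_nonpos_Reals_iff)

text \<open>For u >= 2 and a nonpositive exponent, u^(Re rho + k) is at most its value at 2. The
  measure du/u contributes (beta - alpha)/alpha, which is invariant under dilation, so the bound is
  uniform in x when the support is stretched by 1/x.\<close>

lemma mellin_bound:
  assumes g: "continuous_on {0<..} g" and \<alpha>: "2 \<le> \<alpha>" "\<alpha> \<le> \<beta>"
    and supp: "\<And>u. u < \<alpha> \<or> \<beta> < u \<Longrightarrow> g u = 0"
    and H: "H \<ge> 0" "\<And>u. \<alpha> \<le> u \<Longrightarrow> norm (g u) \<le> H * u powr k" and \<rho>: "Re \<rho> + k \<le> 0"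
  shows "norm (mellin g \<rho>) \<le> H * ((\<beta> - \<alpha>) / \<alpha>) * 2 powr (Re \<rho> + k)"
proof -
  let ?f = "\<lambda>u. g u * of_real u powr \<rho> / of_real u"
  note cont = continuous_on_mellin_integrand[OF g, of \<rho>]
  have "mellin g \<rho> = integral {\<alpha>..\<beta>} ?f"
    unfolding mellin_def by (rule compact_support_absolutely_integrable(2)[OF cont]) (use \<alpha> supp in auto)
  also have "norm \<dots> \<le> (H * 2 powr (Re \<rho> + k) / \<alpha>) * (\<beta> - \<alpha>)"
  proof (rule integral_bound[OF \<alpha>(2)])
    show "continuous_on {\<alpha>..\<beta>} ?f" by (rule continuous_on_subset[OF cont]) (use \<alpha> in auto)
    fix u assume "u \<in> {\<alpha>..\<beta>}"
    hence u: "\<alpha> \<le> u" "2 \<le> u" using \<alpha> by auto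
    have "norm (?f u) = norm (g u) * u powr Re \<rho> / u"
      using u by (simp add: norm_mult norm_divide norm_powr_real_powr)
    also have "\<dots> \<le> (H * u powr k) * u powr Re \<rho> / u"
      using u H by (intro divide_right_mono mult_right_mono) auto
    also have "\<dots> = H * u powr (Re \<rho> + k) / u" by (simp add: powr_add)
    also have "\<dots> \<le> H * 2 powr (Re \<rho> + k) / \<alpha>"
      using u H \<alpha> \<rho> by (intro frac_le mult_left_mono powr_mono2') auto
    finally show "norm (?f u) \<le> H * 2 powr (Re \<rho> + k) / \<alpha>" .
  qed
  finally show ?thesis by (simp add: mult_ac)
qed

lemma mellin_scale:
  assumes g: "continuous_on {0<..} g" and c: "c > 0" and \<alpha>: "0 < \<alpha>"
    and supp: "\<And>u. u < \<alpha> \<or> \<beta> < u \<Longrightarrow> g u = 0"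
  shows "mellin g \<rho> = of_real c powr (- \<rho>) * mellin (\<lambda>u. g (u / c)) \<rho>"
proof -
  let ?f = "\<lambda>u. g u * of_real u powr \<rho> / of_real u"
  let ?k = "\<lambda>u. g (u / c) * of_real u powr \<rho> / of_real u"
  note cont = continuous_on_mellin_integrand[OF g, of \<rho>]
  have "continuous_on {0<..} (g \<circ> (\<lambda>u. u / c))"
    by (intro continuous_on_compose continuous_intros continuous_on_subset[OF g]) (use c in auto)
  hence gc: "continuous_on {0<..} (\<lambda>u. g (u / c))" by (simp add: o_def)
  note contc = continuous_on_mellin_integrand[OF gc, of \<rho>]
  have 1: "mellin g \<rho> = integral {\<alpha>..\<beta>} ?f"
    unfolding mellin_def by (rule compact_support_absolutely_integrable(2)[OF cont]) (use \<alpha> supp in auto)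
  have 2: "mellin (\<lambda>u. g (u / c)) \<rho> = integral {c * \<alpha>..c * \<beta>} ?k"
    unfolding mellin_def
  proof (rule compact_support_absolutely_integrable(2)[OF contc])
    show "0 < c * \<alpha>" using c \<alpha> by simp
    show "?k u = 0" if "u < c * \<alpha> \<or> c * \<beta> < u" for u
      using supp[of "u / c"] that c by (auto simp: field_simps)
  qed auto
  have "(?k has_integral integral {c * \<alpha>..c * \<beta>} ?k) {c * \<alpha>..c * \<beta>}"
  proof (intro integrable_integral integrable_continuous_real continuous_on_subset[OF contc])
    show "{c * \<alpha>..c * \<beta>} \<subseteq> {0<..}" using mult_pos_pos[OF c \<alpha>] by auto
  qed
  hence "((\<lambda>u. ?k (c * u)) has_integral (1 / \<bar>c\<bar>) *\<^sub>R integral {c * \<alpha>..c * \<beta>} ?k) ((\<lambda>u. u / c) ` {c * \<alpha>..c * \<beta>})"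
    by (rule has_integral_stretch_real) (use c in auto)
  also have "(\<lambda>u. u / c) ` {c * \<alpha>..c * \<beta>} = {\<alpha>..\<beta>}" using c by simp
  finally have "((\<lambda>u. ?k (c * u)) has_integral (1 / \<bar>c\<bar>) *\<^sub>R integral {c * \<alpha>..c * \<beta>} ?k) {\<alpha>..\<beta>}" .
  hence "((\<lambda>u. (of_real c * of_real c powr (- \<rho>)) * ?k (c * u)) has_integral
     (of_real c * of_real c powr (- \<rho>)) * ((1 / \<bar>c\<bar>) *\<^sub>R integral {c * \<alpha>..c * \<beta>} ?k)) {\<alpha>..\<beta>}"
    by (rule has_integral_mult_right)
  moreover have "(of_real c * of_real c powr (- \<rho>)) * ((1 / \<bar>c\<bar>) *\<^sub>R integral {c * \<alpha>..c * \<beta>} ?k)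
      = of_real c powr (- \<rho>) * mellin (\<lambda>u. g (u / c)) \<rho>"
    unfolding 2 using c by (simp add: scaleR_conv_of_real)
  moreover have "(of_real c * of_real c powr (- \<rho>)) * ?k (c * u) = ?f u" if "u \<in> {\<alpha>..\<beta>}" for u
  proof -
    have u: "u > 0" using that \<alpha> by simp
    have "of_real (c * u) powr \<rho> = of_real c powr \<rho> * of_real u powr \<rho>"
      using c u by (simp add: powr_times_real)
    moreover have "of_real c powr (- \<rho>) * of_real c powr \<rho> = (1::complex)"
      using c by (simp flip: powr_add)
    ultimately show ?thesis using c u by (simp add: field_simps)
  qed
  ultimately have "(?f has_integral of_real c powr (- \<rho>) * mellin (\<lambda>u. g (u / c)) \<rho>) {\<alpha>..\<beta>}"
    using has_integral_cong[of "{\<alpha>..\<beta>}" "\<lambda>u. (of_real c * of_real c powr (- \<rho>)) * ?k (c * u)" ?f] by simp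
  thus ?thesis using 1 integral_unique by metis
qed

text \<open>For a general x the support may reach below 1, outside the range of the explicit
  formula. Dilation by c = 2/alpha moves it to u >= 2 and multiplies the transform by c^(- rho),
  which is bounded because the zeros of the completed function lie in the strip 0 <= Re rho <=
  1.\<close>

lemma (in selberg_data) zero_sum_summable:
  assumes g: "\<And>n. cont_diff n {0<..} g" and \<alpha>: "0 < \<alpha>" and supp: "\<And>u. u < \<alpha> \<or> \<beta> < u \<Longrightarrow> g u = 0"
  shows "(\<lambda>\<rho>. of_nat (zero_mult Lstar \<rho>) * mellin g \<rho>) summable_on zeros_of Lstar"
proof -
  define c where "c = 2 / \<alpha>"
  have c: "c > 0" using \<alpha> by (simp add: c_def)
  let ?gc = "\<lambda>u. g (u / c)"
  have "cont_diff n {0<..} (\<lambda>u. g ((1 / c) * u))" for n by (rule cont_diff_compose_scale[OF _ g]) (use c in simp)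
  hence gc: "cont_diff n {0<..} ?gc" for n by simp
  have "(\<lambda>\<rho>. norm (of_nat (zero_mult Lstar \<rho>) * mellin ?gc \<rho>)) summable_on {\<rho>. F \<rho> = 0}"
  proof (rule zeros_summable[OF gc, where c = 2 and B = "c * \<beta>"])
    fix u assume "u < 2 \<or> c * \<beta> < u"
    hence "u / c < \<alpha> \<or> \<beta> < u / c" using c \<alpha> by (auto simp: c_def field_simps)
    thus "g (u / c) = 0" by (rule supp)
  qed simp
  hence "(\<lambda>\<rho>. norm (of_nat (zero_mult Lstar \<rho>) * mellin ?gc \<rho>)) summable_on zeros_of Lstar"
    by (rule summable_on_subset_banach) (use zeros_Lstar(1) in blast)
  hence s: "(\<lambda>\<rho>. (1 + 1 / c) * norm (of_nat (zero_mult Lstar \<rho>) * mellin ?gc \<rho>)) summable_on zeros_of Lstar"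
    by (rule summable_on_cmult_right)
  have "(\<lambda>\<rho>. norm (of_nat (zero_mult Lstar \<rho>) * mellin g \<rho>)) summable_on zeros_of Lstar"
  proof (rule summable_on_comparison_test[OF s])
    fix \<rho> assume \<rho>: "\<rho> \<in> zeros_of Lstar"
    have "norm (of_real c powr (- \<rho>) :: complex) = c powr (- Re \<rho>)" using c by (simp add: norm_powr_real_powr)
    \<comment> \<open>One bound for both cases: at most 1 if c >= 1, and at most 1/c if c <
      1.\<close>
    also have "\<dots> \<le> 1 + 1 / c"
    proof (cases "c \<ge> 1")
      case True
      hence "c powr (- Re \<rho>) \<le> c powr 0" using zeros_Lstar(2)[OF \<rho>] by (intro powr_mono) auto
      moreover have "1 / c > 0" "c powr 0 = 1" using c by simp_all
      ultimately show ?thesis by linarith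
    next
      case False
      hence "c powr (- Re \<rho>) \<le> c powr (- 1)" using zeros_Lstar(3)[OF \<rho>] c by (intro powr_mono') auto
      moreover have "c powr (- 1) = 1 / c" using c by (simp add: powr_minus divide_inverse)
      ultimately show ?thesis by linarith
    qed
    finally have n: "norm (of_real c powr (- \<rho>) :: complex) \<le> 1 + 1 / c" .
    have "mellin g \<rho> = of_real c powr (- \<rho>) * mellin ?gc \<rho>"
      by (rule mellin_scale[OF cont_diff_imp_continuous_on[OF g] c \<alpha> supp])
    hence "norm (of_nat (zero_mult Lstar \<rho>) * mellin g \<rho>) =
        norm (of_real c powr (- \<rho>) :: complex) * norm (of_nat (zero_mult Lstar \<rho>) * mellin ?gc \<rho>)"
      by (simp add: norm_mult)
    also have "\<dots> \<le> (1 + 1 / c) * norm (of_nat (zero_mult Lstar \<rho>) * mellin ?gc \<rho>)"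
      by (rule mult_right_mono[OF n norm_ge_zero])
    finally show "norm (of_nat (zero_mult Lstar \<rho>) * mellin g \<rho>) \<le>
      (1 + 1 / c) * norm (of_nat (zero_mult Lstar \<rho>) * mellin ?gc \<rho>)" .
  qed simp
  thus ?thesis by (rule abs_summable_summable)
qed

lemma mellin_1: "mellin g 1 = integral {0<..} g"
  unfolding mellin_def by (rule integral_cong) simp

text \<open>The gamma factor has its poles at 0, -2, -4 and so on, and 0 is excluded by
  \<open>zetaF_0\<close>. The result is what u^2 growth of the test function requires, namely Re rho
  + 2 <= 0.\<close>

lemma trivial_zero_zeta:
  assumes "zetaF \<rho> = 0" "gamma_prod 1 (\<lambda>_. 1/2) (\<lambda>_. 0) \<rho> = 0"
  shows "Re \<rho> \<le> - 2"
proof -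
  have "rGamma (\<rho> / 2) = 0" using assms(2) by (simp add: gamma_prod_def)
  then obtain n where n: "\<rho> / 2 = - of_nat n" by (auto simp: rGamma_eq_zero_iff elim!: nonpos_Ints_cases')
  have "n \<noteq> 0"
  proof
    assume "n = 0"
    hence "\<rho> = 0" using n by simp
    thus False using assms(1) zetaF_0 by simp
  qed
  moreover have "Re (\<rho> / 2) = - real n" unfolding n by simp
  ultimately show ?thesis by simp
qed

lemma C0inf_support:
  assumes "h \<in> C0inf"
  obtains a b H where "0 < a" "a \<le> b" "\<And>u. u < a \<or> b < u \<Longrightarrow> h u = 0" "H \<ge> 0" "\<And>u. norm (h u) \<le> H"
proof -
  obtain a b where ab: "0 < a" "\<And>u. u < a \<or> b < u \<Longrightarrow> h u = 0" and sm: "smooth_on {0<..} h"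
    using assms unfolding C0inf_def by blast
  define b' where "b' = max a b"
  have "continuous_on {0<..} h" using smooth_on_imp_cont_diff[OF sm, of 0] by simp
  hence "continuous_on {a..b'} h" by (rule continuous_on_subset) (use ab in auto)
  hence "bounded (h ` {a..b'})" by (intro compact_imp_bounded compact_continuous_image) auto
  then obtain H where H: "\<And>u. u \<in> {a..b'} \<Longrightarrow> norm (h u) \<le> H" unfolding bounded_iff by blast
  have "norm (h a) \<le> H" by (rule H) (simp add: b'_def)
  hence H0: "H \<ge> 0" using norm_ge_zero order_trans by blast
  have "norm (h u) \<le> H" for u
  proof (cases "u \<in> {a..b'}")
    case False
    hence "h u = 0" by (intro ab) (auto simp: b'_def)
    thus ?thesis using H0 by simp
  qed (rule H)
  thus ?thesis using ab H0 by (intro that[of a b' H]) (auto simp: b'_def)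
qed

text \<open>Summability belongs to the conclusion because an infinite sum without it is 0 by
  convention; it is claimed for every x > 0, the bound only for small x. (S3) merely asserts that
  gamma data exist, so the completed function is formed with an arbitrary admissible tuple.\<close>

theorem theorem1:
  fixes \<phi> h :: "real \<Rightarrow> complex" and Q :: real and r :: nat
    and lam :: "nat \<Rightarrow> real" and mu :: "nat \<Rightarrow> complex" and \<omega> :: complex
  assumes "\<phi> \<in> C_L 1" and "h \<in> C0inf"
    and "gamma_data (\<lambda>n. \<phi> (real n)) Q r lam mu \<omega>"
  shows "(\<forall>x>0.
      (\<lambda>\<rho>. of_nat (zero_mult (completed (\<lambda>n. \<phi> (real n)) Q r lam mu) \<rho>) *
              integral {0<..} (\<lambda>u. h (x * u) * of_real u powr \<rho> / of_real u))
        summable_on zeros_of (completed (\<lambda>n. \<phi> (real n)) Q r lam mu) \<and>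
      (\<lambda>\<rho>. of_nat (zero_mult zeta_star \<rho>) *
              integral {0<..} (\<lambda>u. h (x * u) * \<phi> u * of_real u powr \<rho> / of_real u))
        summable_on zeros_of zeta_star) \<and>
    (\<exists>C \<delta>. \<delta> > 0 \<and> (\<forall>x. 0 < x \<and> x < \<delta> \<longrightarrow>
      norm ((of_nat (m_of (\<lambda>n. \<phi> (real n))) * integral {0<..} (\<lambda>u. h (x * u))
          - (\<Sum>\<^sub>\<infinity>\<rho>\<in>zeros_of (completed (\<lambda>n. \<phi> (real n)) Q r lam mu).
               of_nat (zero_mult (completed (\<lambda>n. \<phi> (real n)) Q r lam mu) \<rho>) *
               integral {0<..} (\<lambda>u. h (x * u) * of_real u powr \<rho> / of_real u)))
        - (integral {0<..} (\<lambda>u. h (x * u) * \<phi> u)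
          - (\<Sum>\<^sub>\<infinity>\<rho>\<in>zeros_of zeta_star.
               of_nat (zero_mult zeta_star \<rho>) *
               integral {0<..} (\<lambda>u. h (x * u) * \<phi> u * of_real u powr \<rho> / of_real u))))
      \<le> C))"
proof -
  define a where "a = (\<lambda>n. \<phi> (real n))"
  have \<phi>: "smooth_on {0<..} \<phi>" "selberg_class a" "euler_rank a 1" "\<exists>C>0. \<forall>u>0. norm (\<phi> u) \<le> C * u ^ 2"
    using assms(1) unfolding C_L_def a_def by auto
  obtain C where C: "C > 0" "\<And>u. u > 0 \<Longrightarrow> norm (\<phi> u) \<le> C * u ^ 2" using \<phi>(4) by blast
  obtain \<alpha> \<beta> H where h: "0 < \<alpha>" "\<alpha> \<le> \<beta>" "\<And>u. u < \<alpha> \<or> \<beta> < u \<Longrightarrow> h u = 0" "H \<ge> 0" "\<And>u. norm (h u) \<le> H"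
    using C0inf_support[OF assms(2)] by blast
  have hs: "smooth_on {0<..} h" using assms(2) by (simp add: C0inf_def)
  interpret L: selberg_data a Q r lam mu \<omega>
    by unfold_locales (use \<phi>(2) assms(3) in \<open>simp_all add: a_def\<close>)
  interpret Z: selberg_data "\<lambda>_. 1" "pi powr (- 1/2)" 1 "\<lambda>_. 1/2" "\<lambda>_. 0" 1
    by unfold_locales (rule selberg_class_zeta, rule gamma_data_zeta)
  define g1 where "g1 = (\<lambda>x u. h (x * u))"
  define g2 where "g2 = (\<lambda>x u. h (x * u) * \<phi> u)"
  have ck1: "cont_diff n {0<..} (g1 x)" if "x > 0" for n x
    unfolding g1_def by (rule cont_diff_compose_scale[OF that smooth_on_imp_cont_diff[OF hs]])
  have ck2: "cont_diff n {0<..} (g2 x)" if "x > 0" for n x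
    unfolding g2_def using cont_diff_mult[OF _ ck1[OF that, unfolded g1_def] smooth_on_imp_cont_diff[OF \<phi>(1)]] by simp
  have s1: "g1 x u = 0" and s2: "g2 x u = 0" if "x > 0" "u < \<alpha> / x \<or> \<beta> / x < u" for x u
  proof -
    have "h (x * u) = 0" by (rule h(3)) (use that in \<open>auto simp: field_simps\<close>)
    thus "g1 x u = 0" "g2 x u = 0" by (simp_all add: g1_def g2_def)
  qed
  define S1 where "S1 = (\<lambda>x. \<Sum>\<^sub>\<infinity>\<rho>\<in>zeros_of L.Lstar. of_nat (zero_mult L.Lstar \<rho>) * mellin (g1 x) \<rho>)"
  define S2 where "S2 = (\<lambda>x. \<Sum>\<^sub>\<infinity>\<rho>\<in>zeros_of zeta_star. of_nat (zero_mult zeta_star \<rho>) * mellin (g2 x) \<rho>)"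
  have sum1: "(\<lambda>\<rho>. of_nat (zero_mult L.Lstar \<rho>) * mellin (g1 x) \<rho>) summable_on zeros_of L.Lstar" if x: "x > 0" for x
    by (rule L.zero_sum_summable[OF ck1[OF x] _ s1[OF x]]) (use x h in auto)
  have sum2: "(\<lambda>\<rho>. of_nat (zero_mult zeta_star \<rho>) * mellin (g2 x) \<rho>) summable_on zeros_of zeta_star" if x: "x > 0" for x
    unfolding zeta_star_eq_completed
    by (rule Z.zero_sum_summable[OF ck2[OF x] _ s2[OF x]]) (use x h in auto)
  obtain C1 where C1: "\<And>T. finite T \<Longrightarrow> (\<Sum>\<rho>\<in>T. real (zord L.A \<rho>) * 2 powr Re \<rho>) \<le> C1"
    using L.trivial_zeros_bound by blast
  obtain C2 where C2: "\<And>T. finite T \<Longrightarrow> (\<Sum>\<rho>\<in>T. real (zord Z.A \<rho>) * 2 powr Re \<rho>) \<le> C2"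
    using Z.trivial_zeros_bound by blast
  obtain b where b: "abs_conv_beyond b (3/2)" "b 1 = 0" "\<And>n. b n \<noteq> 0 \<Longrightarrow> primepow n"
    "\<And>s. Re s > 1 \<Longrightarrow> exp (dirichlet_series b s) = dirichlet_series a s" "a 1 = 1"
    by (rule selberg_class_log[OF \<phi>(2)]) (rule that)
  define bz where "bz = (\<lambda>n. mangoldt n / complex_of_real (ln (real n)))"
  have bz: "abs_conv_beyond bz (3/2)" "\<And>s. Re s > 1 \<Longrightarrow> exp (dirichlet_series bz s) = dirichlet_series (\<lambda>_. 1) s"
    using abs_conv_beyond_mono[OF zeta_log(3), of "3/2"] zeta_log(5) unfolding bz_def by simp_all
  define M1 where "M1 = H * ((\<beta> - \<alpha>) / \<alpha>)"
  \<comment> \<open>The factor 4 is 2^2: the growth u^2 of phi turns 2 powr Re rho into 2 powr (Re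
    rho + 2).\<close>
  define M2 where "M2 = 4 * (H * C) * ((\<beta> - \<alpha>) / \<alpha>)"
  have M: "M1 \<ge> 0" "M2 \<ge> 0" unfolding M1_def M2_def using h C by simp_all
  have main: "norm ((of_nat (m_of a) * integral {0<..} (g1 x) - S1 x) - (integral {0<..} (g2 x) - S2 x)) \<le> M1 * C1 + M2 * C2"
    if x: "0 < x" "x < \<alpha> / 2" for x
  proof -
    \<comment> \<open>For x < alpha/2 both test functions are supported in u >= 2, as
      \<open>mellin_bound\<close> and the explicit formula require.\<close>
    have ax: "2 \<le> \<alpha> / x" "1 < \<alpha> / x" "\<alpha> / x \<le> \<beta> / x" using x h by (auto simp: field_simps)
    have ratio: "(\<beta> / x - \<alpha> / x) / (\<alpha> / x) = (\<beta> - \<alpha>) / \<alpha>" using x h by (simp add: field_simps)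
    define P1 where "P1 = (\<Sum>\<^sub>\<infinity>n\<in>{1..}. b n * of_real (ln (real n)) * g1 x (real n))"
    define P2 where "P2 = (\<Sum>\<^sub>\<infinity>n\<in>{1..}. bz n * of_real (ln (real n)) * g2 x (real n))"
    have T1: "norm (of_nat (m_of a) * mellin (g1 x) 1 - S1 x - P1) \<le> M1 * C1"
      unfolding S1_def P1_def
    proof (rule L.zero_sum_vs_prime_sum[OF b(1) b(4) C1 ck1[OF x(1)] ax(2) s1[OF x(1)] M(1)])
      fix \<rho> :: complex assume \<rho>: "Re \<rho> \<le> 0"
      have "norm (mellin (g1 x) \<rho>) \<le> H * ((\<beta> / x - \<alpha> / x) / (\<alpha> / x)) * 2 powr (Re \<rho> + 0)"
      proof (rule mellin_bound[OF cont_diff_imp_continuous_on[OF ck1[OF x(1)]] ax(1) ax(3) s1[OF x(1)] h(4)])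
        show "norm (g1 x u) \<le> H * u powr 0" if "\<alpha> / x \<le> u" for u
          using h(5) ax that by (simp add: g1_def)
      qed (use \<rho> in auto)
      thus "norm (mellin (g1 x) \<rho>) \<le> M1 * 2 powr Re \<rho>" unfolding ratio M1_def by simp
    qed
    have T2: "norm (of_nat (m_of (\<lambda>_. 1)) * mellin (g2 x) 1 - S2 x - P2) \<le> M2 * C2"
      unfolding S2_def P2_def zeta_star_eq_completed
    proof (rule Z.zero_sum_vs_prime_sum[OF bz C2 ck2[OF x(1)] ax(2) s2[OF x(1)] M(2)])
      fix \<rho> :: complex assume \<rho>: "Lfun (\<lambda>_. 1) \<rho> = 0" "Z.A \<rho> = 0"
      have r: "Re \<rho> \<le> - 2" by (rule trivial_zero_zeta) (use \<rho> Lfun_zeta in simp_all)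
      have "norm (mellin (g2 x) \<rho>) \<le> (H * C) * ((\<beta> / x - \<alpha> / x) / (\<alpha> / x)) * 2 powr (Re \<rho> + 2)"
      proof (rule mellin_bound[OF cont_diff_imp_continuous_on[OF ck2[OF x(1)]] ax(1) ax(3) s2[OF x(1)]])
        show "0 \<le> H * C" using h(4) C(1) by simp
        show "norm (g2 x u) \<le> (H * C) * u powr 2" if "\<alpha> / x \<le> u" for u
        proof -
          have u: "u > 0" using that ax by linarith
          have "norm (g2 x u) \<le> H * (C * u ^ 2)"
            unfolding g2_def norm_mult using h(4,5) C(2)[OF u] by (intro mult_mono) auto
          thus ?thesis using u by (simp add: mult.assoc)
        qed
      qed (use r in auto)
      moreover have powr_4: "2 powr (Re \<rho> + 2) = 4 * 2 powr Re \<rho>" by (simp add: powr_add)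
      ultimately show "norm (mellin (g2 x) \<rho>) \<le> M2 * 2 powr Re \<rho>" 
        unfolding ratio M2_def powr_4 by (simp only: mult_ac)
    qed
    \<comment> \<open>Both sums have the term mangoldt n times phi n times h (x n), by
      \<open>rank_one_log_coeffs\<close>. At n = 1 the coefficient \<open>bz\<close> is a quotient 0
      / 0 = 0, which matches mangoldt 1 = 0.\<close>
    have "P1 = P2"
      unfolding P1_def P2_def
    proof (rule infsum_cong)
      fix n :: nat assume "n \<in> {1..}"
      hence n: "n \<ge> 1" by simp
      have "bz n * of_real (ln (real n)) = mangoldt n"
        using n by (cases "n = 1") (auto simp: bz_def)
      thus "b n * of_real (ln (real n)) * g1 x (real n) = bz n * of_real (ln (real n)) * g2 x (real n)"
        using rank_one_log_coeffs[OF \<phi>(2,3) b n] by (simp add: g1_def g2_def a_def)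
    qed
    hence "(of_nat (m_of a) * integral {0<..} (g1 x) - S1 x) - (integral {0<..} (g2 x) - S2 x) =
        (of_nat (m_of a) * mellin (g1 x) 1 - S1 x - P1) - (of_nat (m_of (\<lambda>_. 1)) * mellin (g2 x) 1 - S2 x - P2)"
      unfolding mellin_1 m_of_zeta by simp
    also have "norm \<dots> \<le> M1 * C1 + M2 * C2" by (rule norm_triangle_le_diff[OF add_mono[OF T1 T2]])
    finally show ?thesis .
  qed
  show ?thesis
    using sum1 sum2 main h(1)
    unfolding S1_def S2_def g1_def g2_def a_def mellin_def
    by (intro conjI allI impI exI[of _ "M1 * C1 + M2 * C2"] exI[of _ "\<alpha> / 2"]) auto
qed

end
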